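(* There exist universal constants $c_0,c_1,C,\xi>0$ with $C\xi<1$ such that the following holds. Let $Q$ be the generator of a mixing continuous-time Markov chain on a finite set $\mathbf{V}$, $|\mathbf{V}|\ge2$, with stationary distribution $\pi$. Let $\rho(Q)=t_{\mathrm{mix}}^Q/\mathsf{m}(Q)$ and $\alpha(Q)=(1+q_{\max}t_{\mathrm{mix}}^Q)\pi_{\max}$. If $Q$ is reversible and transitive, set $\mathsf{err}(Q)=c_0\sqrt{\rho(Q)\ln(1/\rho(Q))}$; otherwise, set $\mathsf{err}(Q)=c_1\sqrt{\alpha(Q)\ln(1/\alpha(Q))}$. Let $k\ge2$, $\ell=\binom k2$, and assume $\mathsf{err}(Q)\le1/(10\ell)$ and $k^2\mathsf{err}(Q)\le\xi$. Then for every probability measure $\lambda^{(k)}$ on $\mathbf{V}^k$, $$\mathrm{Law}_{\lambda^{(k)}}\big(M^{(k)}\big)=\mathsf{Exp}\Big(\frac{\mathsf{m}(Q)}{\ell},\ C k^2\mathsf{err}(Q)+2r_{\lambda^{(k)}},\ C k^2\mathsf{err}(Q)\Big),$$ where $r_{\lambda^{(k)}}=\mathbf{P}_{\lambda^{(k)}}\big(M^{(k)}\le t_{\mathrm{mix}}^Q(\mathsf{err}(Q)^2)\big)$.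
   Context: The chain has rates $q(x,y)\ge0$ ($x\neq y$); $q_{\max}=\max_x\sum_{y\ne x}q(x,y)$, $\pi_{\max}=\max_x\pi(x)$. Mixing: unique stationary distribution $\pi$ and $\mathrm{Law}_x(X_t)\to\pi$ for each $x$. Transitive: for all $x,y\in\mathbf{V}$ there is a permutation $\phi$ of $\mathbf{V}$ with $\phi(x)=y$ and $q(\phi(u),\phi(v))=q(u,v)$ for all $u\ne v$. Reversible: $\pi(x)q(x,y)=\pi(y)q(y,x)$. $t_{\mathrm{mix}}^Q(\alpha)$ is the smallest $T\ge0$ with $\max_xd_{\mathrm{TV}}(\mathrm{Law}_x(X_T),\pi)\le\alpha$ ($d_{\mathrm{TV}}(p,q)=\frac12\sum_s|p(s)-q(s)|$), $t_{\mathrm{mix}}^Q=t_{\mathrm{mix}}^Q(1/4)$. Under $\mathbf{P}_{\lambda^{(k)}}$, $X(1),\dots,X(k)$ evolve as independent chains with generator $Q$ with initial state $(X_0(1),\dots,X_0(k))$ of law $\lambda^{(k)}$. $M^{(k)}=\inf\{t\ge0:\exists\,1\le i<j\le k,\ X_t(i)=X_t(j)\}$ and $\mathsf{m}(Q)=\mathbf{E}_{\pi\otimes\pi}[M^{(2)}]$. For $m>0$, $\alpha>0$, $\beta\in(0,1)$, $\nu=\mathsf{Exp}(m,\alpha,\beta)$ means that $\nu$ is the law of a random variable $\widetilde Z$ with $\widetilde Z\ge0$ a.s. and $(1-\alpha)e^{-t/((1-\beta)m)}\le\mathbf{P}(\widetilde Z\ge t)\le(1+\alpha)e^{-t/((1+\beta)m)}$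 for all $t>0$. "Universal" means independent of all the objects above.
   Formalization: Adds the hypothesis ρ(Q) ≤ 1/e (reversible and transitive case) or α(Q) ≤ 1/e (otherwise), since err is undefined above 1 and the claim fails for two-state chains with α(Q) just below 1; V is taken as a finite set of natural numbers, which loses nothing up to relabelling. *)

theory Defs
  imports "HOL-Probability.Probability" "HOL-Combinatorics.Permutations"
begin

subsection \<open>Rates, generator and transition semigroup\<close>

text \<open>A generator on a finite set \<open>V\<close> is given by its off-diagonal rates \<open>q x y\<close>. The values
  \<open>q x x\<close>, and the values of \<open>q\<close> outside \<open>V\<close>, are never used.\<close>

definition rates :: "'v set \<Rightarrow> ('v \<Rightarrow> 'v \<Rightarrow> real) \<Rightarrow> bool" where
  "rates V q \<longleftrightarrow> (\<forall>x\<in>V. \<forall>y\<in>V. x \<noteq> y \<longrightarrow> 0 \<le> q x y)"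

definition gen :: "'v set \<Rightarrow> ('v \<Rightarrow> 'v \<Rightarrow> real) \<Rightarrow> 'v \<Rightarrow> 'v \<Rightarrow> real" where
  "gen V q x y = (if x = y then - (\<Sum>z\<in>V - {x}. q x z) else q x y)"

primrec gen_pow :: "'v set \<Rightarrow> ('v \<Rightarrow> 'v \<Rightarrow> real) \<Rightarrow> nat \<Rightarrow> 'v \<Rightarrow> 'v \<Rightarrow> real" where
  "gen_pow V q 0 x y = (if x = y then 1 else 0)"
| "gen_pow V q (Suc n) x y = (\<Sum>z\<in>V. gen V q x z * gen_pow V q n z y)"

text \<open>The entry \<open>(x, y)\<close> of the matrix exponential of \<open>t Q\<close>; as a function of \<open>y\<close> this is the law
  of \<open>X\<^sub>t\<close> for the chain started from \<open>x\<close>.\<close>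

definition trans_prob :: "'v set \<Rightarrow> ('v \<Rightarrow> 'v \<Rightarrow> real) \<Rightarrow> real \<Rightarrow> 'v \<Rightarrow> 'v \<Rightarrow> real" where
  "trans_prob V q t x y = (\<Sum>n. t ^ n / fact n * gen_pow V q n x y)"

definition stationary :: "'v set \<Rightarrow> ('v \<Rightarrow> 'v \<Rightarrow> real) \<Rightarrow> ('v \<Rightarrow> real) \<Rightarrow> bool" where
  "stationary V q p \<longleftrightarrow>
     (\<forall>x\<in>V. 0 \<le> p x) \<and> (\<Sum>x\<in>V. p x) = 1 \<and>
     (\<forall>t\<ge>0. \<forall>y\<in>V. (\<Sum>x\<in>V. p x * trans_prob V q t x y) = p y)"

definition mixing :: "'v set \<Rightarrow> ('v \<Rightarrow> 'v \<Rightarrow> real) \<Rightarrow> ('v \<Rightarrow> real) \<Rightarrow> bool" where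
  "mixing V q \<pi> \<longleftrightarrow>
     stationary V q \<pi> \<and> (\<forall>p. stationary V q p \<longrightarrow> (\<forall>x\<in>V. p x = \<pi> x)) \<and>
     (\<forall>x\<in>V. \<forall>y\<in>V. ((\<lambda>t. trans_prob V q t x y) \<longlongrightarrow> \<pi> y) at_top)"

definition transitive :: "'v set \<Rightarrow> ('v \<Rightarrow> 'v \<Rightarrow> real) \<Rightarrow> bool" where
  "transitive V q \<longleftrightarrow>
     (\<forall>x\<in>V. \<forall>y\<in>V. \<exists>\<phi>. \<phi> permutes V \<and> \<phi> x = y \<and>
        (\<forall>u\<in>V. \<forall>v\<in>V. u \<noteq> v \<longrightarrow> q (\<phi> u) (\<phi> v) = q u v))"

definition reversible :: "'v set \<Rightarrow> ('v \<Rightarrow> 'v \<Rightarrow> real) \<Rightarrow> ('v \<Rightarrow> real) \<Rightarrow> bool" where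
  "reversible V q \<pi> \<longleftrightarrow> (\<forall>x\<in>V. \<forall>y\<in>V. \<pi> x * q x y = \<pi> y * q y x)"

definition q_max :: "'v set \<Rightarrow> ('v \<Rightarrow> 'v \<Rightarrow> real) \<Rightarrow> real" where
  "q_max V q = Max ((\<lambda>x. \<Sum>y\<in>V - {x}. q x y) ` V)"

definition pi_max :: "'v set \<Rightarrow> ('v \<Rightarrow> real) \<Rightarrow> real" where
  "pi_max V \<pi> = Max (\<pi> ` V)"

definition d_TV :: "'v set \<Rightarrow> ('v \<Rightarrow> real) \<Rightarrow> ('v \<Rightarrow> real) \<Rightarrow> real" where
  "d_TV V p p' = (1 / 2) * (\<Sum>s\<in>V. \<bar>p s - p' s\<bar>)"

definition t_mix :: "'v set \<Rightarrow> ('v \<Rightarrow> 'v \<Rightarrow> real) \<Rightarrow> ('v \<Rightarrow> real) \<Rightarrow> real \<Rightarrow> real" where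
  "t_mix V q \<pi> a = (LEAST T. 0 \<le> T \<and> Max ((\<lambda>x. d_TV V (trans_prob V q T x) \<pi>) ` V) \<le> a)"

subsection \<open>The chain and its independent copies\<close>

text \<open>Right-continuous paths \<open>{0..} \<rightarrow> V\<close>, where \<open>V\<close> is discrete, with the \<open>\<sigma>\<close>-algebra generated
  by the coordinates.\<close>

definition path_space :: "'v set \<Rightarrow> (real \<Rightarrow> 'v) measure" where
  "path_space V =
     restrict_space (Pi\<^sub>M {0..} (\<lambda>_. count_space V))
       {\<omega>. \<forall>t\<ge>0. eventually (\<lambda>u. \<omega> u = \<omega> t) (at_right t)}"

text \<open>\<open>P x\<close> is the law, on path space, of the Markov chain with the given rates started from \<open>x\<close>.
  A probability measure on \<open>path_space V\<close> is determined by its finite-dimensional distributions,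
  so \<open>P\<close> is determined on \<open>V\<close> by \<open>V\<close> and \<open>q\<close>.\<close>

definition markov_chain ::
  "'v set \<Rightarrow> ('v \<Rightarrow> 'v \<Rightarrow> real) \<Rightarrow> ('v \<Rightarrow> (real \<Rightarrow> 'v) measure) \<Rightarrow> bool" where
  "markov_chain V q P \<longleftrightarrow>
     (\<forall>x\<in>V. prob_space (P x) \<and> sets (P x) = sets (path_space V) \<and>
        (\<forall>n (t :: nat \<Rightarrow> real) s.
           t 0 = 0 \<longrightarrow> mono t \<longrightarrow> s 0 = x \<longrightarrow> (\<forall>j\<le>n. s j \<in> V) \<longrightarrow>
           measure (P x) {\<omega> \<in> space (P x). \<forall>j\<le>n. \<omega> (t j) = s j} =
             (\<Prod>j<n. trans_prob V q (t (Suc j) - t j) (s j) (s (Suc j)))))"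

text \<open>The set of \<open>k\<close>-tuples over \<open>V\<close> is \<open>{..<k} \<rightarrow>\<^sub>E V\<close>. The \<open>k\<close> chains are independent given their
  initial states, which have joint law \<open>\<Lambda>\<close>; \<open>\<omega> i t\<close> is the position of chain \<open>i\<close> at time \<open>t\<close>.\<close>

definition initial_law :: "'v set \<Rightarrow> nat \<Rightarrow> (nat \<Rightarrow> 'v) measure \<Rightarrow> bool" where
  "initial_law V k \<Lambda> \<longleftrightarrow> prob_space \<Lambda> \<and> sets \<Lambda> = Pow ({..<k} \<rightarrow>\<^sub>E V)"

definition indep_chains ::
  "nat \<Rightarrow> ('v \<Rightarrow> (real \<Rightarrow> 'v) measure) \<Rightarrow> (nat \<Rightarrow> 'v) measure \<Rightarrow> (nat \<Rightarrow> real \<Rightarrow> 'v) measure" where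
  "indep_chains k P \<Lambda> = bind \<Lambda> (\<lambda>s. Pi\<^sub>M {..<k} (\<lambda>i. P (s i)))"

text \<open>The value is \<open>\<infinity>\<close> if no two chains ever meet.\<close>

definition meeting_time :: "nat \<Rightarrow> (nat \<Rightarrow> real \<Rightarrow> 'v) \<Rightarrow> ennreal" where
  "meeting_time k \<omega> = Inf {ennreal t | t. 0 \<le> t \<and> (\<exists>i j. i < j \<and> j < k \<and> \<omega> i t = \<omega> j t)}"

definition stationary_pair :: "'v set \<Rightarrow> ('v \<Rightarrow> real) \<Rightarrow> (nat \<Rightarrow> 'v) measure" where
  "stationary_pair V \<pi> = point_measure ({..<2} \<rightarrow>\<^sub>E V) (\<lambda>s. ennreal (\<pi> (s 0) * \<pi> (s 1)))"

text \<open>The expectation is finite for mixing chains.\<close>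

definition mean_meeting ::
  "'v set \<Rightarrow> ('v \<Rightarrow> real) \<Rightarrow> ('v \<Rightarrow> (real \<Rightarrow> 'v) measure) \<Rightarrow> real" where
  "mean_meeting V \<pi> P =
     enn2real (\<integral>\<^sup>+ \<omega>. meeting_time 2 \<omega> \<partial>indep_chains 2 P (stationary_pair V \<pi>))"

subsection \<open>Error terms and approximately exponential laws\<close>

definition rho ::
  "'v set \<Rightarrow> ('v \<Rightarrow> 'v \<Rightarrow> real) \<Rightarrow> ('v \<Rightarrow> real) \<Rightarrow> ('v \<Rightarrow> (real \<Rightarrow> 'v) measure) \<Rightarrow> real" where
  "rho V q \<pi> P = t_mix V q \<pi> (1 / 4) / mean_meeting V \<pi> P"

definition alpha :: "'v set \<Rightarrow> ('v \<Rightarrow> 'v \<Rightarrow> real) \<Rightarrow> ('v \<Rightarrow> real) \<Rightarrow> real" where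
  "alpha V q \<pi> = (1 + q_max V q * t_mix V q \<pi> (1 / 4)) * pi_max V \<pi>"

definition err ::
  "real \<Rightarrow> real \<Rightarrow> 'v set \<Rightarrow> ('v \<Rightarrow> 'v \<Rightarrow> real) \<Rightarrow> ('v \<Rightarrow> real) \<Rightarrow>
   ('v \<Rightarrow> (real \<Rightarrow> 'v) measure) \<Rightarrow> real" where
  "err c\<^sub>0 c\<^sub>1 V q \<pi> P =
     (if reversible V q \<pi> \<and> transitive V q
      then c\<^sub>0 * sqrt (rho V q \<pi> P * ln (1 / rho V q \<pi> P))
      else c\<^sub>1 * sqrt (alpha V q \<pi> * ln (1 / alpha V q \<pi>)))"

text \<open>The expression \<open>sqrt (x * ln (1 / x))\<close> in \<open>err\<close> is meant for small \<open>x\<close>. It increases on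
  \<open>(0, 1/e]\<close> but decreases to \<open>0\<close> as \<open>x\<close> increases to \<open>1\<close>, and over the reals it is not defined
  for \<open>x > 1\<close>, where the library's \<open>sqrt\<close> of a negative number is negative. Smallness of \<open>err\<close>
  is therefore only a meaningful assumption on the range below.\<close>

definition err_in_range ::
  "'v set \<Rightarrow> ('v \<Rightarrow> 'v \<Rightarrow> real) \<Rightarrow> ('v \<Rightarrow> real) \<Rightarrow> ('v \<Rightarrow> (real \<Rightarrow> 'v) measure) \<Rightarrow> bool" where
  "err_in_range V q \<pi> P \<longleftrightarrow>
     (if reversible V q \<pi> \<and> transitive V q then rho V q \<pi> P else alpha V q \<pi>) \<le> exp (- 1)"

text \<open>Nonnegativity of the random variable is built into the type \<open>ennreal\<close>.\<close>

definition approx_exp :: "ennreal measure \<Rightarrow> real \<Rightarrow> real \<Rightarrow> real \<Rightarrow> bool" where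
  "approx_exp \<nu> m a b \<longleftrightarrow>
     prob_space \<nu> \<and> sets \<nu> = sets borel \<and> 0 < m \<and> 0 < a \<and> 0 < b \<and> b < 1 \<and>
     (\<forall>t>0. (1 - a) * exp (- t / ((1 - b) * m)) \<le> measure \<nu> {z. ennreal t \<le> z} \<and>
            measure \<nu> {z. ennreal t \<le> z} \<le> (1 + a) * exp (- t / ((1 + b) * m)))"

end

(* Everything reduces to discrete time: by right continuity of the paths, {M >= N s} is the
   decreasing limit, over dyadic grids, of the events that no collision occurs at a grid time before
   N s, and the probabilities of the latter are computed from the transition matrices by finite
   recursions. No strong Markov property in continuous time is needed.

   Let e be the error and s the mixing time to accuracy e^2. After skipping a window of length s the
   k chains are almost stationary and independent, so the survival probability over a block of
   length N s with N s / m of order e gets multiplied by 1 - P (1 + O(k^2 e)), where P is the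
   probability that k stationary chains meet within N s. Geometric decay over blocks gives an
   exponential law. For k = 2, summing the block inequalities over all blocks identifies P with
   (N s / m) (1 + O(e)), m being the mean meeting time; for general k the union bound and the
   second Bonferroni inequality give (k choose 2) times that. The events that two different pairs
   meet are almost disjoint, because at the first meeting of one pair the other pair contains a
   chain that is still stationary and independent of everything else.

   This needs s / m and H to be O(e^2), where H bounds the probability that a chain from an
   arbitrary state meets a stationary one before time s. In the transitive case the
   starting state is irrelevant, so H is the probability that two stationary chains meet before time
   s; a probability well above e^2 forces m to be at most of order s / H.
   In general, chains that have met stay together for a time of order 1 / q_max, whereas a
   stationary chain coincides with an independent one at any given time with probability at most
   max pi, which bounds H and, applied to longer times, 1 / m. *)

theory Submission
  imports Defs
begin

subsection \<open>Killed finite Markov chains\<close>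

text \<open>The decoupling is asymmetric. For an upper bound on survival, collisions during a mixing
  window are simply ignored. For a lower bound they must be excluded, and from an arbitrary
  surviving state their probability may be close to 1; it is small only after one more window of
  mixing. The lower recursion therefore subtracts a multiple of the survival probability one window
  earlier. It closes because survival probabilities of consecutive windows differ at most by a
  factor 2, which propagates from P(M >= s) >= 1/2. If r >= 1/2 this start fails, but then the
  claimed lower bound is at most 0.

  Constants: e = 10 sqrt(x ln(1/x)) gives e^2 = 100 x ln(1/x), just above the 96 x ln(1/x) that
  bounds s / m in the general case. There 96 = 3 * 32, with 3 the price of passing from accuracy 1/4
  to e^2 and 32 the constant in the comparison of the mixing time with alpha * m. The first-order
  relative errors of one block add up to at most 10 k^2 e; C = 20 leaves room for the second-order
  ones, which k^2 e <= 1/1000 makes negligible.\<close>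

definition kop :: "'a set \<Rightarrow> ('a \<Rightarrow> 'a \<Rightarrow> real) \<Rightarrow> ('a \<Rightarrow> real) \<Rightarrow> 'a \<Rightarrow> real" where
  "kop S K F x = (\<Sum>y\<in>S. K x y * F y)"

definition killed :: "'a set \<Rightarrow> ('a \<Rightarrow> 'a \<Rightarrow> real) \<Rightarrow> 'a set \<Rightarrow> ('a \<Rightarrow> real) \<Rightarrow> 'a \<Rightarrow> real" where
  "killed S K B F x = (if x \<in> B then 0 else kop S K F x)"

text \<open>The tested times are 0 to \<open>n - 1\<close>: a state is tested before each step, the
  final one is not. Consecutive blocks thus share no tested time, which makes
  \<open>surv_add\<close> exact, and on a grid exactly the times below \<open>N * s\<close> are
  tested, as the event M >= N s requires.\<close>

primrec surv :: "'a set \<Rightarrow> ('a \<Rightarrow> 'a \<Rightarrow> real) \<Rightarrow> 'a set \<Rightarrow> nat \<Rightarrow> 'a \<Rightarrow> real" where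
  "surv S K B 0 x = 1"
| "surv S K B (Suc n) x = (if x \<in> B then 0 else kop S K (surv S K B n) x)"

abbreviation hit :: "'a set \<Rightarrow> ('a \<Rightarrow> 'a \<Rightarrow> real) \<Rightarrow> 'a set \<Rightarrow> nat \<Rightarrow> 'a \<Rightarrow> real" where
  "hit S K B n x \<equiv> 1 - surv S K B n x"

text \<open>The chain runs freely until it first meets \<open>A\<close>, and only from that moment
  on is \<open>B\<close> looked for, within the time that is left. An earlier visit to
  \<open>B\<close> is neither counted nor excluded. This ordered form is what a decomposition at the
  first hit of a union produces.\<close>

primrec hit_before ::
  "'a set \<Rightarrow> ('a \<Rightarrow> 'a \<Rightarrow> real) \<Rightarrow> 'a set \<Rightarrow> 'a set \<Rightarrow> nat \<Rightarrow> 'a \<Rightarrow> real" where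
  "hit_before S K A B 0 x = 0"
| "hit_before S K A B (Suc n) x =
     (if x \<in> A then hit S K B (Suc n) x else kop S K (hit_before S K A B n) x)"

lemma kop_cong: "(\<And>y. y \<in> S \<Longrightarrow> F y = G y) \<Longrightarrow> kop S K F x = kop S K G x"
  by (simp add: kop_def)

lemma kop_lin: "kop S K (\<lambda>y. a * F y + b * G y) x = a * kop S K F x + b * kop S K G x"
  by (simp add: kop_def sum.distrib sum_distrib_left algebra_simps)

lemma kop_diff: "kop S K (\<lambda>y. F y - G y) x = kop S K F x - kop S K G x"
  by (simp add: kop_def sum_subtractf right_diff_distrib)

lemma kop_sum: "kop S K (\<lambda>y. \<Sum>i\<in>I. F i y) x = (\<Sum>i\<in>I. kop S K (F i) x)"
  unfolding kop_def sum_distrib_left by (rule sum.swap)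

lemma killed_pow_Suc:
  "(killed S K B ^^ Suc n) F x = (if x \<in> B then 0 else kop S K ((killed S K B ^^ n) F) x)"
  by (simp add: killed_def[of S K B "(killed S K B ^^ n) F"])

lemma surv_eq_killed: "surv S K B n x = (killed S K B ^^ n) (\<lambda>_. 1) x"
proof (induction n arbitrary: x)
  case (Suc n)
  have "surv S K B n = (killed S K B ^^ n) (\<lambda>_. 1)" using Suc by auto
  then show ?case by (simp add: killed_pow_Suc del: funpow.simps)
qed simp

lemma surv_add: "surv S K B (n + m) x = (killed S K B ^^ n) (surv S K B m) x"
proof -
  have "surv S K B m = (killed S K B ^^ m) (\<lambda>_. 1)" by (auto simp: surv_eq_killed)
  then show ?thesis by (simp add: surv_eq_killed funpow_add)
qed

lemma killed_pow_lin:
  "(killed S K B ^^ n) (\<lambda>y. a * F y + b * G y) x =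
     a * (killed S K B ^^ n) F x + b * (killed S K B ^^ n) G x"
proof (induction n arbitrary: x)
  case (Suc n)
  then have "(killed S K B ^^ n) (\<lambda>y. a * F y + b * G y) =
     (\<lambda>x. a * (killed S K B ^^ n) F x + b * (killed S K B ^^ n) G x)" by auto
  then show ?case by (simp add: killed_pow_Suc kop_lin del: funpow.simps)
qed simp

locale finite_kernel =
  fixes S :: "'a set" and K :: "'a \<Rightarrow> 'a \<Rightarrow> real"
  assumes fin: "finite S"
    and K_nonneg: "\<And>x y. x \<in> S \<Longrightarrow> y \<in> S \<Longrightarrow> 0 \<le> K x y"
    and K_sum: "\<And>x. x \<in> S \<Longrightarrow> (\<Sum>y\<in>S. K x y) = 1"
begin

lemma kop_const: "x \<in> S \<Longrightarrow> kop S K (\<lambda>_. c) x = c"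
  by (simp add: kop_def K_sum flip: sum_distrib_right)

lemma kop_mono:
  assumes "x \<in> S" "\<And>y. y \<in> S \<Longrightarrow> F y \<le> G y"
  shows "kop S K F x \<le> kop S K G x"
  unfolding kop_def using assms K_nonneg by (intro sum_mono mult_left_mono) auto

lemma kop_nonneg: "x \<in> S \<Longrightarrow> (\<And>y. y \<in> S \<Longrightarrow> 0 \<le> F y) \<Longrightarrow> 0 \<le> kop S K F x"
  using kop_mono[of x "\<lambda>_. 0" F] kop_const[of x 0] by simp

lemma kop_le_const: "x \<in> S \<Longrightarrow> (\<And>y. y \<in> S \<Longrightarrow> F y \<le> c) \<Longrightarrow> kop S K F x \<le> c"
  using kop_mono[of x F "\<lambda>_. c"] kop_const[of x c] by simp

lemma kop_pow_bounds:
  "x \<in> S \<Longrightarrow> (\<And>y. y \<in> S \<Longrightarrow> 0 \<le> F y \<and> F y \<le> c) \<Longrightarrow>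
    0 \<le> (kop S K ^^ n) F x \<and> (kop S K ^^ n) F x \<le> c"
proof (induction n arbitrary: x)
  case (Suc n) then show ?case by (auto intro!: kop_nonneg kop_le_const)
qed simp

lemma killed_mono:
  assumes "x \<in> S" "\<And>y. y \<in> S \<Longrightarrow> F y \<le> G y"
  shows "killed S K B F x \<le> killed S K B G x"
  using kop_mono[OF assms] by (auto simp: killed_def)

lemma killed_pow_mono:
  "x \<in> S \<Longrightarrow> (\<And>y. y \<in> S \<Longrightarrow> F y \<le> G y) \<Longrightarrow>
     (killed S K B ^^ n) F x \<le> (killed S K B ^^ n) G x"
proof (induction n arbitrary: x)
  case (Suc n) then show ?case by (auto intro!: killed_mono)
qed simp

lemma killed_pow_le_kop_pow:
  "x \<in> S \<Longrightarrow> (\<And>y. y \<in> S \<Longrightarrow> 0 \<le> F y) \<Longrightarrow>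
     0 \<le> (killed S K B ^^ n) F x \<and> (killed S K B ^^ n) F x \<le> (kop S K ^^ n) F x"
proof (induction n arbitrary: x)
  case (Suc n)
  then have "kop S K ((killed S K B ^^ n) F) x \<le> kop S K ((kop S K ^^ n) F) x"
    by (intro kop_mono) auto
  moreover have "0 \<le> kop S K ((killed S K B ^^ n) F) x" using Suc by (intro kop_nonneg) auto
  ultimately show ?case by (auto simp: killed_def[of S K B "(killed S K B ^^ n) F"])
qed simp

lemma surv_bounds: "x \<in> S \<Longrightarrow> 0 \<le> surv S K B n x \<and> surv S K B n x \<le> 1"
proof (induction n arbitrary: x)
  case (Suc n) then show ?case by (auto intro!: kop_nonneg kop_le_const)
qed simp

lemma surv_antimono:
  assumes "x \<in> S" "n \<le> n'"
  shows "surv S K B n' x \<le> surv S K B n x"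
proof -
  have "(killed S K B ^^ n) (surv S K B (n' - n)) x \<le> (killed S K B ^^ n) (\<lambda>_. 1) x"
    using assms(1) surv_bounds by (intro killed_pow_mono) auto
  then show ?thesis using surv_add[of S K B n "n' - n" x] assms(2) by (simp add: surv_eq_killed)
qed

lemma hit_Suc: "x \<in> S \<Longrightarrow>
    hit S K B (Suc n) x = (if x \<in> B then 1 else kop S K (\<lambda>y. hit S K B n y) x)"
  by (simp add: kop_diff kop_const)

text \<open>The free and the killed evolution differ only on trajectories that visit
  \<open>B\<close> at one of the first \<open>n\<close> times, and there the payoff is at most
  1.\<close>

lemma kop_pow_minus_killed_pow:
  "x \<in> S \<Longrightarrow> (\<And>y. y \<in> S \<Longrightarrow> 0 \<le> F y \<and> F y \<le> 1) \<Longrightarrow>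
     (kop S K ^^ n) F x - (killed S K B ^^ n) F x \<le> hit S K B n x"
proof (induction n arbitrary: x)
  case (Suc n)
  show ?case
  proof (cases "x \<in> B")
    case True
    then show ?thesis using kop_pow_bounds[of x F 1 "Suc n"] Suc.prems by (simp add: killed_pow_Suc del: funpow.simps)
  next
    case False
    have "kop S K (\<lambda>y. (kop S K ^^ n) F y - (killed S K B ^^ n) F y) x \<le>
        kop S K (\<lambda>y. hit S K B n y) x"
      using Suc by (intro kop_mono) auto
    then show ?thesis using False Suc.prems
      by (simp add: killed_def[of S K B "(killed S K B ^^ n) F"] kop_diff kop_const)
  qed
qed simp

lemma hit_add_le:
  assumes "x \<in> S"
  shows "hit S K B (n + m) x \<le> hit S K B n x + (kop S K ^^ n) (\<lambda>y. hit S K B m y) x"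
proof -
  have "(killed S K B ^^ n) (\<lambda>y. hit S K B m y) x =
      (killed S K B ^^ n) (\<lambda>_. 1) x - (killed S K B ^^ n) (surv S K B m) x"
    using killed_pow_lin[where a=1 and F="\<lambda>_. 1" and b="-1" and G="surv S K B m"] by simp
  moreover have "(killed S K B ^^ n) (\<lambda>y. hit S K B m y) x \<le> (kop S K ^^ n) (\<lambda>y. hit S K B m y) x"
    using killed_pow_le_kop_pow[OF assms, where F="\<lambda>y. hit S K B m y"] surv_bounds by auto
  ultimately show ?thesis by (simp add: surv_add surv_eq_killed[of S K B n])
qed

section \<open>Decoupling by a mixing window\<close>

context
  fixes \<mu> :: "'a \<Rightarrow> real" and L :: nat and d :: real
  assumes mix: "\<And>F y. y \<in> S \<Longrightarrow> (\<And>z. z \<in> S \<Longrightarrow> 0 \<le> F z \<and> F z \<le> 1) \<Longrightarrow>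
    \<bar>(kop S K ^^ L) F y - (\<Sum>z\<in>S. \<mu> z * F z)\<bar> \<le> d"
begin

text \<open>Killing is dropped during the \<open>L\<close> steps of the window; whatever state
  survived the first \<open>n\<close> steps is then forgotten up to \<open>d\<close>, and the last
  \<open>m\<close> steps start from \<mu>. The error comes multiplied by the survival probability,
  so it is relative and the bound can be iterated.\<close>

lemma surv_mix_upper:
  assumes x: "x \<in> S"
  shows "surv S K B (n + (L + m)) x \<le> surv S K B n x * ((\<Sum>z\<in>S. \<mu> z * surv S K B m z) + d)"
proof -
  let ?c = "(\<Sum>z\<in>S. \<mu> z * surv S K B m z) + d"
  \<comment> \<open>The redundant \<open>* 1\<close> and \<open>0 * 1\<close> give the constant
    bound the shape of \<open>killed_pow_lin\<close>.\<close>
  have "surv S K B (L + m) y \<le> ?c * 1 + 0 * 1" if "y \<in> S" for y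
  proof -
    have "surv S K B (L + m) y \<le> (kop S K ^^ L) (surv S K B m) y"
      unfolding surv_add using killed_pow_le_kop_pow[OF that, of "surv S K B m"] surv_bounds by auto
    moreover have "\<bar>(kop S K ^^ L) (surv S K B m) y - (\<Sum>z\<in>S. \<mu> z * surv S K B m z)\<bar> \<le> d"
      using surv_bounds by (intro mix that)
    ultimately show ?thesis by (simp add: abs_le_iff)
  qed
  then have "(killed S K B ^^ n) (surv S K B (L + m)) x \<le>
      (killed S K B ^^ n) (\<lambda>y. ?c * 1 + 0 * 1) x"
    using x by (intro killed_pow_mono)
  then show ?thesis
    unfolding killed_pow_lin surv_add[of _ _ _ n] by (simp add: surv_eq_killed[of _ _ _ n] mult.commute)
qed

text \<open>Hits in the window that precedes the last block have to be subtracted, and from a fixed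
  state they may be certain. So the window from \<open>n\<close> to \<open>n + L\<close> is used for
  mixing before the window in which hits are counted. Killing is dropped in this first window, hence
  the subtracted term carries survival up to \<open>n\<close> and not up to
  \<open>n + L\<close>.\<close>

lemma surv_mix_lower:
  assumes x: "x \<in> S"
  shows "surv S K B (n + L) x * ((\<Sum>z\<in>S. \<mu> z * surv S K B m z) - d)
      - surv S K B n x * (1 - (\<Sum>z\<in>S. \<mu> z * surv S K B L z) + d)
    \<le> surv S K B (n + L + (L + m)) x"
proof -
  let ?c = "(\<Sum>z\<in>S. \<mu> z * surv S K B m z) - d"
  let ?c' = "1 - (\<Sum>z\<in>S. \<mu> z * surv S K B L z) + d"
  let ?h = "\<lambda>y. hit S K B L y"
  have sb: "\<And>z. z \<in> S \<Longrightarrow> 0 \<le> surv S K B m z \<and> surv S K B m z \<le> 1"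
    "\<And>z. z \<in> S \<Longrightarrow> 0 \<le> surv S K B L z \<and> surv S K B L z \<le> 1"
    "\<And>z. z \<in> S \<Longrightarrow> 0 \<le> 1 - surv S K B L z"
    using surv_bounds by auto
  have pow1: "(kop S K ^^ L) (\<lambda>_. 1) y = 1" if "y \<in> S" for y
    using that
  proof (induction L arbitrary: y)
    case (Suc L)
    have "kop S K ((kop S K ^^ L) (\<lambda>_. 1)) y = kop S K (\<lambda>_. 1) y"
      using Suc by (intro kop_cong) auto
    then show ?case using Suc.prems by (simp add: kop_const)
  qed simp
  have pow_diff: "(kop S K ^^ L) (\<lambda>y. F y - G y) = (\<lambda>y. (kop S K ^^ L) F y - (kop S K ^^ L) G y)" for F G
    by (induction L) (auto simp: kop_diff)
  have "?c * 1 + (-1) * ?h y \<le> surv S K B (L + m) y" if "y \<in> S" for y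
  proof -
    have "(kop S K ^^ L) (surv S K B m) y - ?h y \<le> surv S K B (L + m) y"
      using kop_pow_minus_killed_pow[where F="surv S K B m" and n=L and B=B, OF that sb(1)]
      by (simp add: surv_add)
    moreover have "\<bar>(kop S K ^^ L) (surv S K B m) y - (\<Sum>z\<in>S. \<mu> z * surv S K B m z)\<bar> \<le> d"
      using sb(1) by (intro mix that)
    ultimately show ?thesis by (simp add: abs_le_iff)
  qed
  then have "(killed S K B ^^ (n + L)) (\<lambda>y. ?c * 1 + (-1) * ?h y) x \<le> (killed S K B ^^ (n + L)) (surv S K B (L + m)) x"
    using x by (intro killed_pow_mono)
  then have 1: "?c * surv S K B (n + L) x - (killed S K B ^^ (n + L)) ?h x \<le> surv S K B (n + L + (L + m)) x"
    unfolding killed_pow_lin surv_add[of _ _ _ "n + L" "L + m"] by (simp add: surv_eq_killed[of _ _ _ "n + L"])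
  have "(killed S K B ^^ L) ?h y \<le> ?c' * 1 + 0 * 1" if "y \<in> S" for y
  proof -
    have "(killed S K B ^^ L) ?h y \<le> (kop S K ^^ L) ?h y"
      using killed_pow_le_kop_pow[OF that, where F="?h"] sb(3) by auto
    also have "\<dots> = 1 - (kop S K ^^ L) (surv S K B L) y"
      using that by (simp add: pow_diff pow1)
    finally show ?thesis using mix[where F="surv S K B L", OF that sb(2)] by (simp add: abs_le_iff)
  qed
  then have "(killed S K B ^^ n) ((killed S K B ^^ L) ?h) x \<le> (killed S K B ^^ n) (\<lambda>y. ?c' * 1 + 0 * 1) x"
    using x by (intro killed_pow_mono)
  then have "(killed S K B ^^ (n + L)) ?h x \<le> ?c' * surv S K B n x"
    unfolding killed_pow_lin by (simp add: funpow_add surv_eq_killed[of _ _ _ n])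
  then show ?thesis using 1 by (simp add: mult.commute)
qed

end

section \<open>Union bound and second Bonferroni inequality\<close>

lemma hit_Union_le:
  assumes "finite I" "x \<in> S"
  shows "hit S K (\<Union>i\<in>I. B i) n x \<le> (\<Sum>i\<in>I. hit S K (B i) n x)"
  using assms(2)
proof (induction n arbitrary: x)
  case (Suc n)
  have nn: "0 \<le> hit S K (B i) (Suc n) x" for i
    using surv_bounds[OF Suc.prems, of "B i" "Suc n"] by linarith
  show ?case
  proof (cases "\<exists>i\<in>I. x \<in> B i")
    case True
    then obtain i where i: "i \<in> I" "x \<in> B i" by auto
    have "(\<Sum>i\<in>{i}. hit S K (B i) (Suc n) x) \<le> (\<Sum>i\<in>I. hit S K (B i) (Suc n) x)"
      using assms(1) i nn by (intro sum_mono2) auto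
    then show ?thesis using i by auto
  next
    case False
    have "kop S K (\<lambda>y. hit S K (\<Union>i\<in>I. B i) n y) x \<le> kop S K (\<lambda>y. \<Sum>i\<in>I. hit S K (B i) n y) x"
      using Suc by (intro kop_mono) auto
    also have "\<dots> = (\<Sum>i\<in>I. hit S K (B i) (Suc n) x)"
      unfolding kop_sum hit_Suc[OF Suc.prems] using False by (intro sum.cong) auto
    finally show ?thesis using False hit_Suc[OF Suc.prems, of "\<Union>i\<in>I. B i" n] by auto
  qed
qed simp

lemma hit_before_nonneg: "x \<in> S \<Longrightarrow> 0 \<le> hit_before S K A B n x"
proof (induction n arbitrary: x)
  case (Suc n)
  have "0 \<le> hit S K B (Suc n) x" using surv_bounds[OF Suc.prems, of B "Suc n"] by linarith
  then show ?case using Suc by (auto intro!: kop_nonneg simp del: surv.simps)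
qed simp

text \<open>At the first visit to the union, say in \<open>B i\<close>, the term for
  \<open>i\<close> cancels the hit of the union, and every other \<open>j\<close> leaves the
  probability of hitting \<open>B j\<close> from then on, which is \<open>hit_before\<close> for
  \<open>i\<close> and \<open>j\<close>. If several sets contain the state, any of them may serve as
  \<open>B i\<close>, as the other terms are nonnegative.\<close>

lemma hit_Union_ge:
  assumes "finite I" "x \<in> S"
  shows "(\<Sum>i\<in>I. hit S K (B i) n x) - hit S K (\<Union>i\<in>I. B i) n x
    \<le> (\<Sum>i\<in>I. \<Sum>j\<in>I - {i}. hit_before S K (B i) (B j) n x)"
  using assms(2)
proof (induction n arbitrary: x)
  case (Suc n)
  let ?H = "\<lambda>i n y. hit S K (B i) n y"
  show ?case
  proof (cases "\<exists>i\<in>I. x \<in> B i")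
    case True
    then obtain i where i: "i \<in> I" "x \<in> B i" by auto
    have "(\<Sum>j\<in>I - {i}. ?H j (Suc n) x) = (\<Sum>j\<in>I - {i}. hit_before S K (B i) (B j) (Suc n) x)"
      using i by (intro sum.cong) auto
    also have "\<dots> = (\<Sum>l\<in>{i}. \<Sum>j\<in>I - {l}. hit_before S K (B l) (B j) (Suc n) x)" by simp
    also have "\<dots> \<le> (\<Sum>l\<in>I. \<Sum>j\<in>I - {l}. hit_before S K (B l) (B j) (Suc n) x)"
      using assms(1) i Suc.prems by (intro sum_mono2 sum_nonneg hit_before_nonneg) auto
    finally show ?thesis using i assms(1)
      by (auto simp: sum.remove[of I i] simp del: hit_before.simps)
  next
    case False
    have "(\<Sum>i\<in>I. ?H i (Suc n) x) - hit S K (\<Union>i\<in>I. B i) (Suc n) x =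
        kop S K (\<lambda>y. (\<Sum>i\<in>I. ?H i n y) - hit S K (\<Union>i\<in>I. B i) n y) x"
      unfolding kop_diff[where F="\<lambda>y. \<Sum>i\<in>I. ?H i n y"] kop_sum
      using False unfolding hit_Suc[OF Suc.prems] by (intro arg_cong2[where f=minus] sum.cong) auto
    also have "\<dots> \<le> kop S K (\<lambda>y. \<Sum>i\<in>I. \<Sum>j\<in>I - {i}. hit_before S K (B i) (B j) n y) x"
      using Suc by (intro kop_mono) auto
    also have "\<dots> = (\<Sum>i\<in>I. \<Sum>j\<in>I - {i}. hit_before S K (B i) (B j) (Suc n) x)"
      unfolding kop_sum using False by (intro sum.cong) auto
    finally show ?thesis .
  qed
qed simp

end

subsection \<open>Independent copies of a chain in discrete time\<close>

lemma sum_PiE_insert: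
  assumes "i \<notin> I"
  shows "(\<Sum>y\<in>insert i I \<rightarrow>\<^sub>E V. f y) = (\<Sum>v\<in>V. \<Sum>y\<in>I \<rightarrow>\<^sub>E V. f (y(i := v)))"
  unfolding PiE_insert_eq
  by (subst sum.reindex[OF inj_combinator[OF assms, of "\<lambda>_. V"]]) (simp add: sum.cartesian_product case_prod_beta' comp_def)

text \<open>The factors are exchanged one at a time; since the remaining factors have total mass 1,
  each exchange costs only the distance between the two factors exchanged.\<close>

lemma prod_L1:
  fixes a b :: "'i \<Rightarrow> 'v \<Rightarrow> real"
  assumes "finite I" "finite V"
    and "\<And>i v. i \<in> I \<Longrightarrow> v \<in> V \<Longrightarrow> 0 \<le> a i v" "\<And>i. i \<in> I \<Longrightarrow> (\<Sum>v\<in>V. a i v) = 1"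
    and "\<And>i v. i \<in> I \<Longrightarrow> v \<in> V \<Longrightarrow> 0 \<le> b i v" "\<And>i. i \<in> I \<Longrightarrow> (\<Sum>v\<in>V. b i v) = 1"
  shows "(\<Sum>y\<in>I \<rightarrow>\<^sub>E V. \<bar>(\<Prod>i\<in>I. a i (y i)) - (\<Prod>i\<in>I. b i (y i))\<bar>) \<le> (\<Sum>i\<in>I. \<Sum>v\<in>V. \<bar>a i v - b i v\<bar>)"
  using assms(1,3-)
proof (induction I)
  case (insert i I)
  let ?A = "\<lambda>y. \<Prod>i\<in>I. a i (y i)" and ?B = "\<lambda>y. \<Prod>i\<in>I. b i (y i)"
  have A: "0 \<le> ?A y" if "y \<in> I \<rightarrow>\<^sub>E V" for y
    using that insert.prems by (intro prod_nonneg) auto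
  have A1: "(\<Sum>y\<in>I \<rightarrow>\<^sub>E V. ?A y) = 1"
    using insert assms(2) by (subst prod_sum_PiE[symmetric]) auto
  have upd: "(\<Prod>j\<in>I. c j ((y(i := v)) j)) = (\<Prod>j\<in>I. c j (y j))" for c :: "'i \<Rightarrow> 'v \<Rightarrow> real" and y v
    using insert by (intro prod.cong) auto
  have "(\<Sum>y\<in>insert i I \<rightarrow>\<^sub>E V. \<bar>(\<Prod>i\<in>insert i I. a i (y i)) - (\<Prod>i\<in>insert i I. b i (y i))\<bar>) =
     (\<Sum>v\<in>V. \<Sum>y\<in>I \<rightarrow>\<^sub>E V. \<bar>a i v * ?A y - b i v * ?B y\<bar>)"
    unfolding sum_PiE_insert[OF insert(2)] prod.insert[OF insert(1,2)] upd by simp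
  also have "\<dots> \<le> (\<Sum>v\<in>V. \<Sum>y\<in>I \<rightarrow>\<^sub>E V. \<bar>a i v - b i v\<bar> * ?A y + b i v * \<bar>?A y - ?B y\<bar>)"
  proof (intro sum_mono)
    fix v y assume v: "v \<in> V" and y: "y \<in> I \<rightarrow>\<^sub>E V"
    have "a i v * ?A y - b i v * ?B y = (a i v - b i v) * ?A y + b i v * (?A y - ?B y)"
      by (simp add: algebra_simps)
    then have "\<bar>a i v * ?A y - b i v * ?B y\<bar> \<le> \<bar>(a i v - b i v) * ?A y\<bar> + \<bar>b i v * (?A y - ?B y)\<bar>"
      by linarith
    then show "\<bar>a i v * ?A y - b i v * ?B y\<bar> \<le> \<bar>a i v - b i v\<bar> * ?A y + b i v * \<bar>?A y - ?B y\<bar>"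
      using A[OF y] insert.prems(3)[OF insertI1 v] by (simp add: abs_mult)
  qed
  also have "\<dots> = (\<Sum>v\<in>V. \<bar>a i v - b i v\<bar>) + (\<Sum>y\<in>I \<rightarrow>\<^sub>E V. \<bar>?A y - ?B y\<bar>)"
    using insert.prems(4)[of i] A1
    by (simp add: sum.distrib flip: sum_distrib_left sum_distrib_right)
  also have "\<dots> \<le> (\<Sum>i\<in>insert i I. \<Sum>v\<in>V. \<bar>a i v - b i v\<bar>)"
    using insert by simp
  finally show ?case .
qed simp

abbreviation tuples :: "nat \<Rightarrow> 'v set \<Rightarrow> (nat \<Rightarrow> 'v) set" where
  "tuples k V \<equiv> {..<k} \<rightarrow>\<^sub>E V"

definition prodK :: "nat \<Rightarrow> ('v \<Rightarrow> 'v \<Rightarrow> real) \<Rightarrow> (nat \<Rightarrow> 'v) \<Rightarrow> (nat \<Rightarrow> 'v) \<Rightarrow> real" where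
  "prodK k p x y = (\<Prod>i<k. p (x i) (y i))"

text \<open>Ordered pairs instead of 2-tuples: any two coordinates \<open>i\<close> and
  \<open>j\<close> of a \<open>k\<close>-tuple project to this one chain.\<close>

definition pairK :: "('v \<Rightarrow> 'v \<Rightarrow> real) \<Rightarrow> 'v \<times> 'v \<Rightarrow> 'v \<times> 'v \<Rightarrow> real" where
  "pairK p x y = p (fst x) (fst y) * p (snd x) (snd y)"

definition index_pairs :: "nat \<Rightarrow> (nat \<times> nat) set" where
  "index_pairs k = {(i, j). i < j \<and> j < k}"

definition coll :: "nat \<times> nat \<Rightarrow> (nat \<Rightarrow> 'v) set" where
  "coll a = {y. y (fst a) = y (snd a)}"

definition meet_set :: "nat \<Rightarrow> (nat \<Rightarrow> 'v) set" where
  "meet_set k = (\<Union>a\<in>index_pairs k. coll a)"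

definition diag :: "('v \<times> 'v) set" where
  "diag = {z. fst z = snd z}"

primrec steps :: "'v set \<Rightarrow> ('v \<Rightarrow> 'v \<Rightarrow> real) \<Rightarrow> nat \<Rightarrow> 'v \<Rightarrow> 'v \<Rightarrow> real" where
  "steps V p 0 x y = (if x = y then 1 else 0)"
| "steps V p (Suc n) x y = (\<Sum>z\<in>V. p x z * steps V p n z y)"

lemma finite_index_pairs: "finite (index_pairs k)"
  by (rule finite_subset[of _ "{..<k} \<times> {..<k}"]) (auto simp: index_pairs_def)

lemma card_index_pairs: "card (index_pairs k) = k choose 2"
proof (induction k)
  case (Suc k)
  have "index_pairs (Suc k) = index_pairs k \<union> (\<lambda>i. (i, k)) ` {..<k}"
    by (auto simp: index_pairs_def)
  moreover have "card ((\<lambda>i. (i, k)) ` {..<k}) = k" by (simp add: card_image inj_on_def)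
  moreover have "index_pairs k \<inter> (\<lambda>i. (i, k)) ` {..<k} = {}" by (auto simp: index_pairs_def)
  ultimately show ?case
    using Suc finite_index_pairs[of k] by (simp add: card_Un_disjoint numeral_2_eq_2)
qed (simp add: index_pairs_def)

locale step_kernel =
  fixes V :: "'v set" and p :: "'v \<Rightarrow> 'v \<Rightarrow> real" and \<pi> :: "'v \<Rightarrow> real"
  assumes finV: "finite V"
    and p_nonneg: "\<And>x y. x \<in> V \<Longrightarrow> y \<in> V \<Longrightarrow> 0 \<le> p x y"
    and p_sum: "\<And>x. x \<in> V \<Longrightarrow> (\<Sum>y\<in>V. p x y) = 1"
    and pi_nonneg: "\<And>x. x \<in> V \<Longrightarrow> 0 \<le> \<pi> x"
    and pi_sum: "(\<Sum>x\<in>V. \<pi> x) = 1"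
    and pi_stat: "\<And>y. y \<in> V \<Longrightarrow> (\<Sum>x\<in>V. \<pi> x * p x y) = \<pi> y"
begin

lemma steps_nonneg: "x \<in> V \<Longrightarrow> y \<in> V \<Longrightarrow> 0 \<le> steps V p n x y"
  by (induction n arbitrary: x) (auto intro!: sum_nonneg mult_nonneg_nonneg p_nonneg)

lemma steps_sum: "x \<in> V \<Longrightarrow> (\<Sum>y\<in>V. steps V p n x y) = 1"
proof (induction n arbitrary: x)
  case (Suc n)
  have "(\<Sum>y\<in>V. \<Sum>z\<in>V. p x z * steps V p n z y) = (\<Sum>z\<in>V. p x z * (\<Sum>y\<in>V. steps V p n z y))"
    unfolding sum_distrib_left by (rule sum.swap)
  then show ?case using Suc p_sum by simp
qed (use finV in simp)

lemma steps_stat: "y \<in> V \<Longrightarrow> (\<Sum>x\<in>V. \<pi> x * steps V p n x y) = \<pi> y"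
proof (induction n)
  case 0
  have "(\<Sum>x\<in>V. \<pi> x * (if x = y then 1 else 0)) = (\<Sum>x\<in>V. if x = y then \<pi> x else 0)"
    by (intro sum.cong) auto
  then show ?case using 0 finV by simp
next
  case (Suc n)
  have "(\<Sum>x\<in>V. \<pi> x * (\<Sum>z\<in>V. p x z * steps V p n z y)) =
      (\<Sum>z\<in>V. (\<Sum>x\<in>V. \<pi> x * p x z) * steps V p n z y)"
    unfolding sum_distrib_left sum_distrib_right by (subst sum.swap) (simp add: mult.assoc)
  then show ?case using Suc pi_stat by simp
qed

sublocale pair: finite_kernel "V \<times> V" "pairK p"
proof
  fix x y assume "x \<in> V \<times> V" "y \<in> V \<times> V"
  then show "0 \<le> pairK p x y" by (auto simp: pairK_def intro!: mult_nonneg_nonneg p_nonneg)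
next
  fix x assume "x \<in> V \<times> V"
  then show "(\<Sum>y\<in>V \<times> V. pairK p x y) = 1"
    by (auto simp: pairK_def sum.cartesian_product' p_sum simp flip: sum_distrib_left)
qed (use finV in simp)

lemma finite_kernel_prodK: "finite_kernel (tuples k V) (prodK k p)"
proof
  fix x y assume "x \<in> tuples k V" "y \<in> tuples k V"
  then show "0 \<le> prodK k p x y"
    unfolding prodK_def by (intro prod_nonneg p_nonneg) auto
next
  fix x assume "x \<in> tuples k V"
  then show "(\<Sum>y\<in>tuples k V. prodK k p x y) = 1"
    unfolding prodK_def using finV p_sum by (subst prod_sum_PiE[symmetric]) (auto intro!: prod.neutral)
qed (use finV in \<open>auto intro!: finite_PiE\<close>)

lemma kop_pow_prodK:
  "x \<in> tuples k V \<Longrightarrow> (kop (tuples k V) (prodK k p) ^^ n) F x = (\<Sum>y\<in>tuples k V. prodK k (steps V p n) x y * F y)"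
proof (induction n arbitrary: x)
  case 0
  have "prodK k (steps V p 0) x y = (if x = y then 1 else 0)" if "y \<in> tuples k V" for y
  proof (cases "x = y")
    case False
    have "\<exists>i<k. x i \<noteq> y i" using PiE_ext[OF 0 that] False by auto
    then obtain i where "i < k" "x i \<noteq> y i" by auto
    then show ?thesis using False by (auto simp: prodK_def intro!: prod_zero)
  qed (simp add: prodK_def)
  then have "(\<Sum>y\<in>tuples k V. prodK k (steps V p 0) x y * F y) =
      (\<Sum>y\<in>tuples k V. if x = y then F y else 0)"
    by (intro sum.cong) auto
  also have "\<dots> = F x" using 0 finite_kernel.fin[OF finite_kernel_prodK] by simp
  finally show ?case by (simp del: steps.simps)
next
  case (Suc n)
  have eq: "(\<Sum>y\<in>tuples k V. prodK k p x y * prodK k (steps V p n) y z) = prodK k (steps V p (Suc n)) x z"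
    for z
    unfolding prodK_def steps.simps using finV
    by (subst prod_sum_PiE) (auto simp: prod.distrib)
  have "(kop (tuples k V) (prodK k p) ^^ Suc n) F x =
     (\<Sum>y\<in>tuples k V. prodK k p x y * (\<Sum>z\<in>tuples k V. prodK k (steps V p n) y z * F z))"
    using Suc by (simp add: kop_def[where F="(kop (tuples k V) (prodK k p) ^^ n) F"])
  also have "\<dots> = (\<Sum>z\<in>tuples k V. (\<Sum>y\<in>tuples k V. prodK k p x y * prodK k (steps V p n) y z) * F z)"
    unfolding sum_distrib_left sum_distrib_right by (subst sum.swap) (simp add: mult.assoc)
  finally show ?case unfolding eq .
qed

lemma kop_pow_pairK:
  "x \<in> V \<times> V \<Longrightarrow> (kop (V \<times> V) (pairK p) ^^ n) F x = (\<Sum>y\<in>V \<times> V. pairK (steps V p n) x y * F y)"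
proof (induction n arbitrary: x)
  case 0
  have "(\<Sum>y\<in>V \<times> V. pairK (steps V p 0) x y * F y) = (\<Sum>y\<in>V \<times> V. if x = y then F y else 0)"
    by (intro sum.cong) (auto simp: pairK_def)
  also have "\<dots> = F x" using 0 finV by simp
  finally show ?case by (simp del: steps.simps)
next
  case (Suc n)
  have eq: "(\<Sum>y\<in>V \<times> V. pairK p x y * pairK (steps V p n) y z) = pairK (steps V p (Suc n)) x z"
    for z
    unfolding pairK_def steps.simps sum_product
    by (simp add: sum.cartesian_product' mult_ac)
  have "(kop (V \<times> V) (pairK p) ^^ Suc n) F x =
     (\<Sum>y\<in>V \<times> V. pairK p x y * (\<Sum>z\<in>V \<times> V. pairK (steps V p n) y z * F z))"
    using Suc by (simp add: kop_def[where F="(kop (V \<times> V) (pairK p) ^^ n) F"])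
  also have "\<dots> = (\<Sum>z\<in>V \<times> V. (\<Sum>y\<in>V \<times> V. pairK p x y * pairK (steps V p n) y z) * F z)"
    unfolding sum_distrib_left sum_distrib_right by (subst sum.swap) (simp add: mult.assoc)
  finally show ?case unfolding eq .
qed

text \<open>Supplies the mixing hypothesis of \<open>surv_mix_upper\<close> and
  \<open>surv_mix_lower\<close> for \<open>k\<close> independent chains. The factor \<open>k\<close>
  appears because the errors of the coordinates add up, by \<open>prod_L1\<close>.\<close>

lemma prodK_mix:
  assumes d: "\<And>x. x \<in> V \<Longrightarrow> (\<Sum>v\<in>V. \<bar>steps V p n x v - \<pi> v\<bar>) \<le> d"
    and y: "y \<in> tuples k V" and F: "\<And>z. z \<in> tuples k V \<Longrightarrow> 0 \<le> F z \<and> F z \<le> 1"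
  shows "\<bar>(kop (tuples k V) (prodK k p) ^^ n) F y - (\<Sum>z\<in>tuples k V. (\<Prod>i<k. \<pi> (z i)) * F z)\<bar> \<le> real k * d"
proof -
  have yV: "y i \<in> V" if "i < k" for i using y that by auto
  have "\<bar>(kop (tuples k V) (prodK k p) ^^ n) F y - (\<Sum>z\<in>tuples k V. (\<Prod>i<k. \<pi> (z i)) * F z)\<bar> =
     \<bar>\<Sum>z\<in>tuples k V. (prodK k (steps V p n) y z - (\<Prod>i<k. \<pi> (z i))) * F z\<bar>"
    by (simp add: kop_pow_prodK[OF y] sum_subtractf left_diff_distrib)
  also have "\<dots> \<le> (\<Sum>z\<in>tuples k V. \<bar>prodK k (steps V p n) y z - (\<Prod>i<k. \<pi> (z i))\<bar>)"
    using F by (intro order.trans[OF sum_abs] sum_mono) (auto simp: abs_mult intro!: mult_left_le)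
  also have "\<dots> \<le> (\<Sum>i<k. \<Sum>v\<in>V. \<bar>steps V p n (y i) v - \<pi> v\<bar>)"
    unfolding prodK_def
    by (rule prod_L1) (use finV yV steps_nonneg steps_sum pi_nonneg pi_sum in auto)
  also have "\<dots> \<le> (\<Sum>i<k. d)" using d yV by (intro sum_mono) auto
  finally show ?thesis by simp
qed

lemma sum_prod_marginal:
  assumes "i < k" "j < k" "i \<noteq> j" and a: "\<And>l. l < k \<Longrightarrow> (\<Sum>v\<in>V. a l v) = 1"
  shows "(\<Sum>y\<in>tuples k V. (\<Prod>l<k. a l (y l)) * G (y i, y j)) =
    (\<Sum>z\<in>V \<times> V. (a i (fst z) * a j (snd z)) * (G z :: real))"
proof -
  define I where "I = {..<k} - {i, j}"
  have k: "{..<k} = insert i (insert j I)" using assms by (auto simp: I_def)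
  have fI: "finite I" by (simp add: I_def)
  have ij: "i \<notin> insert j I" "j \<notin> I" using assms by (auto simp: I_def)
  have eq: "(\<Prod>l\<in>insert i (insert j I). a l ((y(j := v, i := u)) l)) * G ((y(j := v, i := u)) i, (y(j := v, i := u)) j)
      = (a i u * a j v * G (u, v)) * (\<Prod>l\<in>I. a l (y l))" for y u v
  proof -
    have "(\<Prod>l\<in>I. a l ((y(j := v, i := u)) l)) = (\<Prod>l\<in>I. a l (y l))"
      using ij by (intro prod.cong) auto
    then show ?thesis using ij fI by (simp add: mult_ac)
  qed
  have 1: "(\<Sum>y\<in>I \<rightarrow>\<^sub>E V. \<Prod>l\<in>I. a l (y l)) = 1"
    using finV a fI k by (subst prod_sum_PiE[symmetric]) (auto intro!: prod.neutral)
  show ?thesis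
    unfolding k sum_PiE_insert[OF ij(1)] sum_PiE_insert[OF ij(2)] eq
    by (simp add: 1 sum.cartesian_product' flip: sum_distrib_left)
qed

text \<open>Lumping: two coordinates of the product chain evolve autonomously, and whether they
  collide depends on them alone.\<close>

lemma surv_coll:
  assumes "i < k" "j < k" "i \<noteq> j" "x \<in> tuples k V"
  shows "surv (tuples k V) (prodK k p) (coll (i, j)) n x = surv (V \<times> V) (pairK p) diag n (x i, x j)"
  using assms(4)
proof (induction n arbitrary: x)
  case (Suc n)
  have "kop (tuples k V) (prodK k p) (surv (tuples k V) (prodK k p) (coll (i, j)) n) x =
      (\<Sum>y\<in>tuples k V. (\<Prod>l<k. p (x l) (y l)) * surv (V \<times> V) (pairK p) diag n (y i, y j))"
    unfolding kop_def by (intro sum.cong refl) (simp add: Suc.IH prodK_def[of k p x])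
  also have "\<dots> = kop (V \<times> V) (pairK p) (surv (V \<times> V) (pairK p) diag n) (x i, x j)"
    using Suc.prems by (subst sum_prod_marginal) (auto simp: assms kop_def pairK_def intro!: p_sum)
  finally show ?case by (simp add: coll_def diag_def)
qed simp

definition phit :: "nat \<Rightarrow> real" where
  "phit n = (\<Sum>z\<in>V \<times> V. \<pi> (fst z) * \<pi> (snd z) * hit (V \<times> V) (pairK p) diag n z)"

lemma mean_hit_coll:
  assumes "i < k" "j < k" "i \<noteq> j"
  shows "(\<Sum>x\<in>tuples k V. (\<Prod>l<k. \<pi> (x l)) * hit (tuples k V) (prodK k p) (coll (i, j)) n x) = phit n"
proof -
  have "(\<Sum>x\<in>tuples k V. (\<Prod>l<k. \<pi> (x l)) * hit (tuples k V) (prodK k p) (coll (i, j)) n x) =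
     (\<Sum>x\<in>tuples k V. (\<Prod>l<k. \<pi> (x l)) * hit (V \<times> V) (pairK p) diag n (x i, x j))"
    by (intro sum.cong refl) (simp add: surv_coll[OF assms])
  also have "\<dots> = phit n"
    unfolding phit_def using assms pi_sum by (subst sum_prod_marginal) auto
  finally show ?thesis .
qed

section \<open>Resampling one coordinate from the stationary law\<close>

lemma tuples_fun_upd: "x \<in> tuples k V \<Longrightarrow> b < k \<Longrightarrow> v \<in> V \<Longrightarrow> x(b := v) \<in> tuples k V"
  by (auto simp: PiE_iff extensional_def)

text \<open>Coordinate \<open>b\<close> moves independently of the others and \<pi> is invariant for
  it, so sampling it from \<pi> before the step or after the step gives the same law. On the right,
  the step out of the old value \<open>x b\<close> sums to 1.\<close>

lemma kop_avg:
  assumes x: "x \<in> tuples k V" and b: "b < k"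
  shows "(\<Sum>v\<in>V. \<pi> v * kop (tuples k V) (prodK k p) F (x(b := v))) =
    kop (tuples k V) (prodK k p) (\<lambda>y. \<Sum>v\<in>V. \<pi> v * F (y(b := v))) x"
proof -
  define I where "I = {..<k} - {b}"
  have fI: "finite I" by (simp add: I_def)
  let ?P = "\<lambda>y. \<Prod>i\<in>I. p (x i) (y i)"
  have k: "{..<k} = insert b I" and bI: "b \<notin> I" using b by (auto simp: I_def)
  have K: "prodK k p (x(b := v)) (y(b := u)) = p v u * ?P y" for u v y
  proof -
    have "(\<Prod>i\<in>I. p ((x(b := v)) i) ((y(b := u)) i)) = ?P y"
      using bI by (intro prod.cong) auto
    then show ?thesis unfolding prodK_def k using bI fI by simp
  qed
  have K': "prodK k p x (y(b := u)) = p (x b) u * ?P y" for u y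
    using K[of "x b" y u] by simp
  have "(\<Sum>v\<in>V. \<pi> v * kop (tuples k V) (prodK k p) F (x(b := v))) =
      (\<Sum>v\<in>V. \<Sum>u\<in>V. \<Sum>y\<in>I \<rightarrow>\<^sub>E V. (\<pi> v * p v u) * (?P y * F (y(b := u))))"
    unfolding kop_def k by (subst sum_PiE_insert[OF bI]) (simp add: K sum_distrib_left mult_ac)
  also have "\<dots> = (\<Sum>u\<in>V. (\<Sum>v\<in>V. \<pi> v * p v u) * (\<Sum>y\<in>I \<rightarrow>\<^sub>E V. ?P y * F (y(b := u))))"
    by (subst sum.swap) (simp only: sum_product)
  also have "\<dots> = (\<Sum>u\<in>V. \<pi> u * (\<Sum>y\<in>I \<rightarrow>\<^sub>E V. ?P y * F (y(b := u))))"
    using pi_stat by (intro sum.cong) auto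
  finally have 1: "(\<Sum>v\<in>V. \<pi> v * kop (tuples k V) (prodK k p) F (x(b := v))) =
    (\<Sum>u\<in>V. \<pi> u * (\<Sum>y\<in>I \<rightarrow>\<^sub>E V. ?P y * F (y(b := u))))" .
  have "kop (tuples k V) (prodK k p) (\<lambda>y. \<Sum>v\<in>V. \<pi> v * F (y(b := v))) x =
      (\<Sum>u\<in>V. \<Sum>y\<in>I \<rightarrow>\<^sub>E V. p (x b) u * (?P y * (\<Sum>v\<in>V. \<pi> v * F (y(b := v)))))"
    unfolding kop_def k by (subst sum_PiE_insert[OF bI]) (simp add: K' mult_ac)
  also have "\<dots> = (\<Sum>u\<in>V. p (x b) u) * (\<Sum>y\<in>I \<rightarrow>\<^sub>E V. ?P y * (\<Sum>v\<in>V. \<pi> v * F (y(b := v))))"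
    by (simp only: sum_product)
  also have "\<dots> = (\<Sum>y\<in>I \<rightarrow>\<^sub>E V. \<Sum>v\<in>V. \<pi> v * (?P y * F (y(b := v))))"
    using p_sum x b by (simp add: PiE_iff sum_distrib_left mult_ac)
  also have "\<dots> = (\<Sum>u\<in>V. \<pi> u * (\<Sum>y\<in>I \<rightarrow>\<^sub>E V. ?P y * F (y(b := u))))"
    by (subst sum.swap) (simp add: sum_distrib_left)
  finally show ?thesis using 1 by simp
qed

text \<open>Under the product law coordinate \<open>b\<close> has law \<pi> and is independent of
  the others, so a fresh sample in its place changes no expectation.\<close>

lemma mean_avg:
  assumes b: "b < k"
  shows "(\<Sum>x\<in>tuples k V. (\<Prod>l<k. \<pi> (x l)) * (\<Sum>v\<in>V. \<pi> v * F (x(b := v)))) =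
    (\<Sum>x\<in>tuples k V. (\<Prod>l<k. \<pi> (x l)) * (F x :: real))"
proof -
  define I where "I = {..<k} - {b}"
  have fI: "finite I" by (simp add: I_def)
  let ?P = "\<lambda>y. \<Prod>i\<in>I. \<pi> (y i)"
  have k: "{..<k} = insert b I" and bI: "b \<notin> I" using b by (auto simp: I_def)
  have K: "(\<Prod>l<k. \<pi> ((y(b := u)) l)) = \<pi> u * ?P y" for u y
  proof -
    have "(\<Prod>i\<in>I. \<pi> ((y(b := u)) i)) = ?P y"
      using bI by (intro prod.cong) auto
    then show ?thesis using bI fI by (simp add: k)
  qed
  have set: "tuples k V = insert b I \<rightarrow>\<^sub>E V" by (simp add: k)
  have "(\<Sum>x\<in>tuples k V. (\<Prod>l<k. \<pi> (x l)) * (\<Sum>v\<in>V. \<pi> v * F (x(b := v)))) =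
      (\<Sum>u\<in>V. \<Sum>y\<in>I \<rightarrow>\<^sub>E V. \<pi> u * (?P y * (\<Sum>v\<in>V. \<pi> v * F (y(b := v)))))"
    unfolding set sum_PiE_insert[OF bI] K by (simp add: mult_ac)
  also have "\<dots> = (\<Sum>u\<in>V. \<pi> u) * (\<Sum>y\<in>I \<rightarrow>\<^sub>E V. ?P y * (\<Sum>v\<in>V. \<pi> v * F (y(b := v))))"
    by (simp only: sum_product)
  also have "\<dots> = (\<Sum>y\<in>I \<rightarrow>\<^sub>E V. \<Sum>v\<in>V. (\<pi> v * ?P y) * F (y(b := v)))"
    by (simp add: pi_sum sum_distrib_left mult_ac)
  also have "\<dots> = (\<Sum>x\<in>tuples k V. (\<Prod>l<k. \<pi> (x l)) * F x)"
    unfolding set sum_PiE_insert[OF bI] K by (subst sum.swap) simp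
  finally show ?thesis .
qed

text \<open>Up to the first collision of the pair \<open>a\<close>, the coordinate \<open>b\<close> outside \<open>a\<close> stays stationary
  and independent of all other coordinates.\<close>

lemma avg_hit_before:
  assumes a: "fst a < k" "snd a < k" "fst a \<noteq> snd a" and b: "b < k" "c < k" "b \<noteq> c" "b \<noteq> fst a" "b \<noteq> snd a"
    and H: "\<And>u. u \<in> V \<Longrightarrow> (\<Sum>v\<in>V. \<pi> v * hit (V \<times> V) (pairK p) diag N (u, v)) \<le> H"
    and "n \<le> N" "x \<in> tuples k V"
  shows "(\<Sum>v\<in>V. \<pi> v * hit_before (tuples k V) (prodK k p) (coll a) (coll (c, b)) n (x(b := v)))
    \<le> hit (tuples k V) (prodK k p) (coll a) n x * H"
  using assms(10,11)
proof (induction n arbitrary: x)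
  case (Suc n)
  interpret T: finite_kernel "tuples k V" "prodK k p" by (rule finite_kernel_prodK)
  have ca: "x(b := v) \<in> coll a \<longleftrightarrow> x \<in> coll a" for v :: 'v using b by (auto simp: coll_def)
  show ?case
  proof (cases "x \<in> coll a")
    \<comment> \<open>At the collision of \<open>a\<close> only the pair \<open>(c, b)\<close>
      matters from now on. Its coordinate \<open>b\<close> is still distributed as \<pi> and at most
      \<open>N\<close> times are left, so \<open>H\<close> applies wherever \<open>c\<close>
      is.\<close>
    case True
    have "(\<Sum>v\<in>V. \<pi> v * hit_before (tuples k V) (prodK k p) (coll a) (coll (c, b)) (Suc n) (x(b := v))) =
        (\<Sum>v\<in>V. \<pi> v * hit (V \<times> V) (pairK p) diag (Suc n) (x c, v))"
      using True ca b surv_coll[of c k b "x(b := _)" "Suc n"] tuples_fun_upd[OF Suc.prems(2) b(1)]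
      by (intro sum.cong refl) (simp del: surv.simps)
    also have "\<dots> \<le> (\<Sum>v\<in>V. \<pi> v * hit (V \<times> V) (pairK p) diag N (x c, v))"
      using Suc.prems b pi_nonneg pair.surv_antimono[of "(x c, _)" "Suc n" N]
      by (intro sum_mono mult_left_mono diff_left_mono) (auto simp del: surv.simps)
    also have "\<dots> \<le> H" using Suc.prems b by (intro H) auto
    finally have "(\<Sum>v\<in>V. \<pi> v * hit_before (tuples k V) (prodK k p) (coll a) (coll (c, b)) (Suc n) (x(b := v))) \<le> H" .
    moreover have "hit (tuples k V) (prodK k p) (coll a) (Suc n) x = 1" using True by simp
    ultimately show ?thesis by (simp only: mult_1)
  next
    case False
    have "(\<Sum>v\<in>V. \<pi> v * hit_before (tuples k V) (prodK k p) (coll a) (coll (c, b)) (Suc n) (x(b := v))) =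
       (\<Sum>v\<in>V. \<pi> v * kop (tuples k V) (prodK k p) (hit_before (tuples k V) (prodK k p) (coll a) (coll (c, b)) n) (x(b := v)))"
      using False ca by simp
    also have "\<dots> = kop (tuples k V) (prodK k p) (\<lambda>y. \<Sum>v\<in>V. \<pi> v * hit_before (tuples k V) (prodK k p) (coll a) (coll (c, b)) n (y(b := v))) x"
      by (rule kop_avg[OF Suc.prems(2) b(1)])
    also have "\<dots> \<le> kop (tuples k V) (prodK k p) (\<lambda>y. H * hit (tuples k V) (prodK k p) (coll a) n y + 0 * 0) x"
      using Suc.IH[OF Suc_leD[OF Suc.prems(1)]] Suc.prems(2)
      by (intro T.kop_mono) (simp_all only: mult.commute[of H] mult_zero_left add_0_right)
    also have "\<dots> = H * kop (tuples k V) (prodK k p) (\<lambda>y. hit (tuples k V) (prodK k p) (coll a) n y) x"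
      unfolding kop_lin by simp
    also have "\<dots> = hit (tuples k V) (prodK k p) (coll a) (Suc n) x * H"
      unfolding T.hit_Suc[OF Suc.prems(2)] using False by simp
    finally show ?thesis .
  qed
qed simp

text \<open>Distinct pairs share at most one index, so \<open>a'\<close> has an index
  \<open>b\<close> outside \<open>a\<close>. Coordinate \<open>b\<close> is still stationary and
  independent at the first collision of \<open>a\<close>, hence the product of the two
  bounds.\<close>

lemma mean_hit_before:
  assumes a: "a \<in> index_pairs k" and a': "a' \<in> index_pairs k" "a \<noteq> a'"
    and H: "\<And>u. u \<in> V \<Longrightarrow> (\<Sum>v\<in>V. \<pi> v * hit (V \<times> V) (pairK p) diag n (u, v)) \<le> H"
  shows "(\<Sum>x\<in>tuples k V. (\<Prod>l<k. \<pi> (x l)) * hit_before (tuples k V) (prodK k p) (coll a) (coll a') n x)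
    \<le> phit n * H"
proof -
  obtain b c where bc: "b < k" "c < k" "b \<noteq> c" "b \<noteq> fst a" "b \<noteq> snd a"
    and ca: "coll a' = (coll (c, b) :: (nat \<Rightarrow> 'v) set)"
  proof -
    have sym: "coll (snd a', fst a') = (coll a' :: (nat \<Rightarrow> 'v) set)" by (auto simp: coll_def)
    show ?thesis
    proof (cases "fst a' = fst a \<or> fst a' = snd a")
    case True
    then show ?thesis using a a' that[of "snd a'" "fst a'"]
      by (cases a; cases a') (auto simp: index_pairs_def)
  next
    case False
    then show ?thesis using a a' that[of "fst a'" "snd a'"] sym
      by (cases a; cases a') (auto simp: index_pairs_def)
    qed
  qed
  have a2: "fst a < k" "snd a < k" "fst a \<noteq> snd a" using a by (auto simp: index_pairs_def)
  have "(\<Sum>x\<in>tuples k V. (\<Prod>l<k. \<pi> (x l)) * hit_before (tuples k V) (prodK k p) (coll a) (coll a') n x)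
     = (\<Sum>x\<in>tuples k V. (\<Prod>l<k. \<pi> (x l)) *
         (\<Sum>v\<in>V. \<pi> v * hit_before (tuples k V) (prodK k p) (coll a) (coll (c, b)) n (x(b := v))))"
    unfolding ca by (rule mean_avg[OF bc(1), symmetric])
  also have "\<dots> \<le> (\<Sum>x\<in>tuples k V. (\<Prod>l<k. \<pi> (x l)) * (hit (tuples k V) (prodK k p) (coll a) n x * H))"
    using pi_nonneg by (intro sum_mono mult_left_mono avg_hit_before[OF a2 bc H order.refl] prod_nonneg) auto
  also have "\<dots> = phit n * H"
    using mean_hit_coll[OF a2, of n] by (simp flip: sum_distrib_right mult.assoc)
  finally show ?thesis .
qed

lemma phit_nonneg: "0 \<le> phit n"
  unfolding phit_def using pair.surv_bounds pi_nonneg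
  by (intro sum_nonneg mult_nonneg_nonneg) auto

lemma mean_hit_bounds:
  fixes k n :: nat
  assumes H: "\<And>u. u \<in> V \<Longrightarrow> (\<Sum>v\<in>V. \<pi> v * hit (V \<times> V) (pairK p) diag n (u, v)) \<le> H"
  defines "l \<equiv> real (k choose 2)"
  defines "P \<equiv> (\<Sum>x\<in>tuples k V. (\<Prod>l<k. \<pi> (x l)) * hit (tuples k V) (prodK k p) (meet_set k) n x)"
  shows "P \<le> l * phit n" and "l * phit n - l\<^sup>2 * (phit n * H) \<le> P"
proof -
  interpret T: finite_kernel "tuples k V" "prodK k p" by (rule finite_kernel_prodK)
  let ?m = "\<lambda>x. \<Prod>l<k. \<pi> (x l)"
  let ?I = "index_pairs k"
  let ?h = "\<lambda>a x. hit (tuples k V) (prodK k p) (coll a) n x"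
  let ?r = "\<lambda>a a' x. hit_before (tuples k V) (prodK k p) (coll a) (coll a') n x"
  have m: "0 \<le> ?m x" if "x \<in> tuples k V" for x using that pi_nonneg by (intro prod_nonneg) auto
  have "(\<Sum>x\<in>tuples k V. ?m x * (\<Sum>a\<in>?I. ?h a x)) = (\<Sum>a\<in>?I. \<Sum>x\<in>tuples k V. ?m x * ?h a x)"
    unfolding sum_distrib_left by (rule sum.swap)
  also have "\<dots> = (\<Sum>a\<in>?I. phit n)"
  proof (intro sum.cong refl)
    fix a assume "a \<in> ?I"
    then show "(\<Sum>x\<in>tuples k V. ?m x * ?h a x) = phit n"
      using mean_hit_coll[of "fst a" k "snd a" n] by (auto simp: index_pairs_def)
  qed
  finally have 1: "(\<Sum>x\<in>tuples k V. ?m x * (\<Sum>a\<in>?I. ?h a x)) = l * phit n"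
    by (simp add: card_index_pairs l_def)
  have "P \<le> (\<Sum>x\<in>tuples k V. ?m x * (\<Sum>a\<in>?I. ?h a x))"
    unfolding P_def meet_set_def
    by (intro sum_mono mult_left_mono T.hit_Union_le m finite_index_pairs)
  then show "P \<le> l * phit n" using 1 by simp
  \<comment> \<open>Nonnegativity allows the terms with \<open>a' = a\<close> to be added, which
    turns the count \<open>l * (l - 1)\<close> into the simpler \<open>l\<^sup>2\<close>.\<close>
  have H0: "0 \<le> phit n * H"
  proof -
    obtain u where "u \<in> V" using pi_sum by fastforce
    then have "0 \<le> (\<Sum>v\<in>V. \<pi> v * hit (V \<times> V) (pairK p) diag n (u, v))"
      using pair.surv_bounds pi_nonneg by (intro sum_nonneg mult_nonneg_nonneg) auto
    then show ?thesis using H[OF \<open>u \<in> V\<close>] phit_nonneg by simp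
  qed
  have "l * phit n - P = (\<Sum>x\<in>tuples k V. ?m x * ((\<Sum>a\<in>?I. ?h a x) - hit (tuples k V) (prodK k p) (meet_set k) n x))"
    unfolding 1[symmetric] P_def by (simp only: right_diff_distrib sum_subtractf)
  also have "\<dots> \<le> (\<Sum>x\<in>tuples k V. ?m x * (\<Sum>a\<in>?I. \<Sum>a'\<in>?I - {a}. ?r a a' x))"
    unfolding meet_set_def
    by (intro sum_mono mult_left_mono T.hit_Union_ge m finite_index_pairs)
  also have "\<dots> = (\<Sum>a\<in>?I. \<Sum>a'\<in>?I - {a}. \<Sum>x\<in>tuples k V. ?m x * ?r a a' x)"
    unfolding sum_distrib_left by (subst sum.swap, rule sum.cong[OF refl], rule sum.swap)
  also have "\<dots> \<le> (\<Sum>a\<in>?I. \<Sum>a'\<in>?I - {a}. phit n * H)"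
    using H by (intro sum_mono mean_hit_before) auto
  also have "\<dots> \<le> (\<Sum>a\<in>?I. \<Sum>a'\<in>?I. phit n * H)"
    using H0 finite_index_pairs by (intro sum_mono sum_mono2) auto
  also have "\<dots> = l\<^sup>2 * (phit n * H)"
    by (simp add: card_index_pairs l_def power2_eq_square)
  finally show "l * phit n - l\<^sup>2 * (phit n * H) \<le> P" by simp
qed

text \<open>After \<open>m\<close> steps the chain from \<open>u\<close> is nearly stationary, while
  its partner is exactly stationary all along. So the mixing error enters only once, and the
  remaining \<open>n\<close> steps cost \<open>phit n\<close>. This extends a bound for one window
  to a block of many windows.\<close>

lemma avg_hit_pair_add:
  assumes d: "\<And>x. x \<in> V \<Longrightarrow> (\<Sum>v\<in>V. \<bar>steps V p m x v - \<pi> v\<bar>) \<le> d" and u: "u \<in> V"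
  shows "(\<Sum>v\<in>V. \<pi> v * hit (V \<times> V) (pairK p) diag (m + n) (u, v))
    \<le> (\<Sum>v\<in>V. \<pi> v * hit (V \<times> V) (pairK p) diag m (u, v)) + phit n + d"
proof -
  let ?c = "\<lambda>n z. hit (V \<times> V) (pairK p) diag n z"
  let ?g = "\<lambda>a. \<Sum>b\<in>V. \<pi> b * ?c n (a, b)"
  have c: "0 \<le> ?c n z \<and> ?c n z \<le> 1" if "z \<in> V \<times> V" for n z
    using pair.surv_bounds[OF that] by auto
  have "?c (m + n) (u, v) \<le> ?c m (u, v) + (\<Sum>a\<in>V. \<Sum>b\<in>V. steps V p m u a * (steps V p m v b * ?c n (a, b)))"
    if "v \<in> V" for v
    using pair.hit_add_le[of "(u, v)" diag m n] u that
    by (simp add: kop_pow_pairK pairK_def sum.cartesian_product' mult.assoc)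
  then have "(\<Sum>v\<in>V. \<pi> v * ?c (m + n) (u, v)) \<le>
      (\<Sum>v\<in>V. \<pi> v * (?c m (u, v) + (\<Sum>a\<in>V. \<Sum>b\<in>V. steps V p m u a * (steps V p m v b * ?c n (a, b)))))"
    using pi_nonneg by (intro sum_mono mult_left_mono) auto
  also have "\<dots> = (\<Sum>v\<in>V. \<pi> v * ?c m (u, v)) +
      (\<Sum>v\<in>V. \<Sum>a\<in>V. \<Sum>b\<in>V. steps V p m u a * ((\<pi> v * steps V p m v b) * ?c n (a, b)))"
    by (simp add: distrib_left sum.distrib sum_distrib_left mult_ac)
  also have "(\<Sum>v\<in>V. \<Sum>a\<in>V. \<Sum>b\<in>V. steps V p m u a * ((\<pi> v * steps V p m v b) * ?c n (a, b))) =
     (\<Sum>a\<in>V. \<Sum>b\<in>V. steps V p m u a * ((\<Sum>v\<in>V. \<pi> v * steps V p m v b) * ?c n (a, b)))"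
    by (subst sum.swap, rule sum.cong[OF refl], subst sum.swap)
      (simp only: sum_distrib_left sum_distrib_right)
  also have "\<dots> = (\<Sum>a\<in>V. steps V p m u a * ?g a)"
    by (simp add: steps_stat sum_distrib_left)
  also have "\<dots> = (\<Sum>a\<in>V. \<pi> a * ?g a) + (\<Sum>a\<in>V. (steps V p m u a - \<pi> a) * ?g a)"
    by (simp add: left_diff_distrib sum_subtractf)
  also have "(\<Sum>a\<in>V. \<pi> a * ?g a) = phit n"
    unfolding phit_def by (simp add: sum.cartesian_product' sum_distrib_left mult_ac)
  also have "(\<Sum>a\<in>V. (steps V p m u a - \<pi> a) * ?g a) \<le> (\<Sum>a\<in>V. \<bar>steps V p m u a - \<pi> a\<bar>)"
  proof (intro sum_mono)
    fix a assume a: "a \<in> V"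
    have "0 \<le> ?g a" using a c pi_nonneg by (intro sum_nonneg mult_nonneg_nonneg) auto
    moreover have "?g a \<le> (\<Sum>b\<in>V. \<pi> b * 1)" using a c pi_nonneg by (intro sum_mono mult_left_mono) auto
    ultimately have "\<bar>?g a\<bar> \<le> 1" using pi_sum by simp
    then have "\<bar>(steps V p m u a - \<pi> a) * ?g a\<bar> \<le> \<bar>steps V p m u a - \<pi> a\<bar>"
      unfolding abs_mult by (intro mult_left_le) auto
    then show "(steps V p m u a - \<pi> a) * ?g a \<le> \<bar>steps V p m u a - \<pi> a\<bar>" by linarith
  qed
  also have "\<dots> \<le> d" by (rule d[OF u])
  finally show ?thesis by simp
qed

text \<open>Once the two chains have met, both stay put for about \<open>w\<close> steps with probability at least
  \<open>1 / 2\<close>; so hitting the diagonal forces \<open>w / 2\<close> expected coincidences, whereas at each time a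
  stationary chain coincides with an independent one with probability at most \<open>max \<pi>\<close>.\<close>

lemma avg_hit_pair_le:
  assumes stay: "\<And>j z. j < w \<Longrightarrow> z \<in> V \<Longrightarrow> 1 / 2 \<le> (steps V p j z z)\<^sup>2"
    and M: "\<And>v. v \<in> V \<Longrightarrow> \<pi> v \<le> M" and u: "u \<in> V"
  shows "(\<Sum>v\<in>V. \<pi> v * hit (V \<times> V) (pairK p) diag n (u, v)) * (real w / 2) \<le> real (n + w) * M"
proof -
  let ?c = "\<lambda>n z. hit (V \<times> V) (pairK p) diag n z"
  \<comment> \<open>Coincidence at the single time \<open>j\<close>. Unlike a first meeting, it can
    be averaged exactly over a stationary second coordinate, and its sum over \<open>j\<close> is
    the expected number of coincidences.\<close>
  define co where "co j x = (\<Sum>z\<in>V. steps V p j (fst x) z * steps V p j (snd x) z)" for j x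
  have co_nonneg: "0 \<le> co j x" if "x \<in> V \<times> V" for j x
    using that unfolding co_def by (intro sum_nonneg mult_nonneg_nonneg steps_nonneg) auto
  have co_Suc: "co (Suc j) x = kop (V \<times> V) (pairK p) (co j) x" for j x
  proof -
    have "co (Suc j) x = (\<Sum>z\<in>V. \<Sum>a\<in>V. \<Sum>b\<in>V. (p (fst x) a * p (snd x) b) * (steps V p j a z * steps V p j b z))"
      by (simp add: co_def sum_product mult_ac)
    also have "\<dots> = (\<Sum>a\<in>V. \<Sum>b\<in>V. \<Sum>z\<in>V. (p (fst x) a * p (snd x) b) * (steps V p j a z * steps V p j b z))"
      by (subst sum.swap, rule sum.cong[OF refl], rule sum.swap)
    finally show ?thesis
      by (simp add: kop_def pairK_def sum.cartesian_product' co_def sum_distrib_left)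
  qed
  \<comment> \<open>A visit to the diagonal at one of the first \<open>n\<close> times is followed
    by \<open>w\<close> times that count at least 1/2 each; hence the sum runs to
    \<open>n + w\<close>.\<close>
  have count: "?c n x * (real w / 2) \<le> (\<Sum>j<n + w. co j x)" if "x \<in> V \<times> V" for x
    using that
  proof (induction n arbitrary: x)
    case 0 then show ?case using co_nonneg by (auto intro!: sum_nonneg)
  next
    case (Suc n)
    show ?case
    proof (cases "x \<in> diag")
      case True
      then obtain z where x: "x = (z, z)" "z \<in> V" using Suc.prems by (auto simp: diag_def)
      have "real w / 2 = (\<Sum>j<w. 1 / 2)" by simp
      also have "\<dots> \<le> (\<Sum>j<w. co j x)"
      proof (intro sum_mono)
        fix j assume "j \<in> {..<w}"
        then have "1 / 2 \<le> (steps V p j z z)\<^sup>2" using stay x by auto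
        also have "\<dots> = (\<Sum>v\<in>{z}. steps V p j z v * steps V p j z v)" by (simp add: power2_eq_square)
        also have "\<dots> \<le> co j x"
          unfolding co_def x fst_conv snd_conv using x finV by (intro sum_mono2) auto
        finally show "1 / 2 \<le> co j x" .
      qed
      also have "\<dots> \<le> (\<Sum>j<Suc n + w. co j x)"
        using co_nonneg Suc.prems by (intro sum_mono2) auto
      finally show ?thesis using True by simp
    next
      case False
      have "?c (Suc n) x * (real w / 2) = kop (V \<times> V) (pairK p) (\<lambda>y. (real w / 2) * ?c n y + 0 * 0) x"
        unfolding kop_lin pair.hit_Suc[OF Suc.prems] using False by simp
      also have "\<dots> \<le> kop (V \<times> V) (pairK p) (\<lambda>y. \<Sum>j<n + w. co j y) x"
        using Suc by (intro pair.kop_mono) (auto simp: mult.commute)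
      also have "\<dots> = (\<Sum>j<n + w. co (Suc j) x)" by (simp add: kop_sum co_Suc)
      also have "\<dots> \<le> (\<Sum>j<Suc n + w. co j x)"
        unfolding add_Suc sum.lessThan_Suc_shift using co_nonneg[OF Suc.prems] by simp
      finally show ?thesis .
    qed
  qed
  have avg: "(\<Sum>v\<in>V. \<pi> v * co j (u, v)) \<le> M" for j
  proof -
    have "(\<Sum>v\<in>V. \<pi> v * co j (u, v)) = (\<Sum>z\<in>V. \<Sum>v\<in>V. steps V p j u z * (\<pi> v * steps V p j v z))"
      unfolding co_def sum_distrib_left by (subst sum.swap) (simp add: mult_ac)
    also have "\<dots> = (\<Sum>z\<in>V. steps V p j u z * \<pi> z)"
      by (simp add: steps_stat flip: sum_distrib_left)
    also have "\<dots> \<le> (\<Sum>z\<in>V. steps V p j u z * M)"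
      using M u by (intro sum_mono mult_left_mono steps_nonneg) auto
    also have "\<dots> = M" using u by (simp add: steps_sum flip: sum_distrib_right)
    finally show ?thesis .
  qed
  have "(\<Sum>v\<in>V. \<pi> v * ?c n (u, v)) * (real w / 2) = (\<Sum>v\<in>V. \<pi> v * (?c n (u, v) * (real w / 2)))"
    by (simp add: sum_distrib_right mult.assoc)
  also have "\<dots> \<le> (\<Sum>v\<in>V. \<pi> v * (\<Sum>j<n + w. co j (u, v)))"
    using u pi_nonneg by (intro sum_mono mult_left_mono count) auto
  also have "\<dots> = (\<Sum>j<n + w. \<Sum>v\<in>V. \<pi> v * co j (u, v))"
    unfolding sum_distrib_left by (rule sum.swap)
  also have "\<dots> \<le> (\<Sum>j<n + w. M)" by (intro sum_mono avg)
  finally show ?thesis by simp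
qed

end

subsection \<open>The transition semigroup and mixing\<close>

lemma space_path_space: "space (path_space V) =
    ({0..} \<rightarrow>\<^sub>E V) \<inter> {\<omega>. \<forall>t\<ge>0. eventually (\<lambda>u. \<omega> u = \<omega> t) (at_right t)}"
  by (auto simp: path_space_def space_restrict_space space_PiM)

lemma measurable_path_space [measurable]:
  "0 \<le> t \<Longrightarrow> (\<lambda>\<omega>. \<omega> t) \<in> measurable (path_space V) (count_space V)"
  unfolding path_space_def
  by (rule measurable_restrict_space1) (simp add: measurable_component_singleton)

lemma gen_pow_invariant:
  assumes "finite V" "\<phi> permutes V" "\<And>u v. u \<in> V \<Longrightarrow> v \<in> V \<Longrightarrow> u \<noteq> v \<Longrightarrow> q (\<phi> u) (\<phi> v) = q u v"
    and "x \<in> V" "y \<in> V"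
  shows "gen_pow V q n (\<phi> x) (\<phi> y) = gen_pow V q n x y"
  using assms(4)
proof (induction n arbitrary: x)
  case 0
  then show ?case using permutes_inj[OF assms(2)] by (auto simp: inj_eq)
next
  case (Suc n)
  have inj: "\<phi> u = \<phi> v \<longleftrightarrow> u = v" for u v using permutes_inj[OF assms(2)] by (auto simp: inj_eq)
  have g: "gen V q (\<phi> x) (\<phi> z) = gen V q x z" if z: "z \<in> V" for z
  proof (cases "x = z")
    case True
    have "\<phi> ` (V - {x}) = V - {\<phi> x}"
      using permutes_image[OF assms(2)] inj by auto
    then have "(\<Sum>w\<in>V - {\<phi> x}. q (\<phi> x) w) = (\<Sum>w\<in>V - {x}. q (\<phi> x) (\<phi> w))"
      using sum.reindex[of \<phi> "V - {x}" "q (\<phi> x)"] permutes_inj[OF assms(2)]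
      by (metis comp_apply inj_on_subset subset_UNIV sum.cong)
    also have "\<dots> = (\<Sum>w\<in>V - {x}. q x w)" using assms(3) Suc.prems by (intro sum.cong) auto
    finally show ?thesis using True by (simp add: gen_def)
  next
    case False
    then show ?thesis using assms(3) Suc.prems z inj by (simp add: gen_def)
  qed
  have "(\<Sum>z\<in>V. gen V q (\<phi> x) z * gen_pow V q n z (\<phi> y)) =
      (\<Sum>z\<in>V. gen V q (\<phi> x) (\<phi> z) * gen_pow V q n (\<phi> z) (\<phi> y))"
    using sum.permute[OF assms(2), of "\<lambda>z. gen V q (\<phi> x) z * gen_pow V q n z (\<phi> y)"] by (simp add: comp_def)
  also have "\<dots> = (\<Sum>z\<in>V. gen V q x z * gen_pow V q n z y)"
    using g Suc by (intro sum.cong) auto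
  finally show ?case by simp
qed

lemma gen_pow_bound:
  assumes "finite V" "x \<in> V" "\<And>x. x \<in> V \<Longrightarrow> (\<Sum>z\<in>V. \<bar>gen V q x z\<bar>) \<le> B"
  shows "\<bar>gen_pow V q n x y\<bar> \<le> B ^ n"
  using assms(2)
proof (induction n arbitrary: x)
  case (Suc n)
  have B: "0 \<le> B" by (rule order.trans[OF sum_nonneg assms(3)[OF Suc.prems]]) auto
  have "\<bar>gen_pow V q (Suc n) x y\<bar> \<le> (\<Sum>z\<in>V. \<bar>gen V q x z\<bar> * B ^ n)"
    using Suc by (auto simp: abs_mult intro!: order.trans[OF sum_abs] sum_mono mult_left_mono)
  also have "\<dots> \<le> B * B ^ n"
    using assms(3)[OF Suc.prems] B by (simp flip: sum_distrib_right add: mult_right_mono)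
  finally show ?case by simp
qed auto

text \<open>Coefficients come before powers of \<open>t\<close>: in this form the theory of power
  series yields continuity and the derivative at 0.\<close>

lemma trans_prob_power_series:
  assumes "finite V" "x \<in> V"
  shows "summable (\<lambda>n. (gen_pow V q n x y / fact n) * t ^ n)"
    and "trans_prob V q t x y = (\<Sum>n. (gen_pow V q n x y / fact n) * t ^ n)"
proof -
  define B where "B = (\<Sum>x\<in>V. \<Sum>z\<in>V. \<bar>gen V q x z\<bar>)"
  have B: "(\<Sum>z\<in>V. \<bar>gen V q x z\<bar>) \<le> B" if "x \<in> V" for x
    unfolding B_def using assms(1) that by (intro member_le_sum sum_nonneg) auto
  have "summable (\<lambda>n. (B * \<bar>t\<bar>) ^ n / fact n)"
    using summable_exp_generic[of "B * \<bar>t\<bar>"] by (simp add: divide_inverse mult.commute)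
  then show "summable (\<lambda>n. (gen_pow V q n x y / fact n) * t ^ n)"
  proof (rule summable_comparison_test')
    fix n
    have "\<bar>gen_pow V q n x y\<bar> * \<bar>t\<bar> ^ n \<le> B ^ n * \<bar>t\<bar> ^ n"
      using gen_pow_bound[OF assms B] by (intro mult_right_mono) auto
    then show "norm ((gen_pow V q n x y / fact n) * t ^ n) \<le> (B * \<bar>t\<bar>) ^ n / fact n"
      by (simp add: abs_mult power_abs power_mult_distrib divide_right_mono)
  qed
  show "trans_prob V q t x y = (\<Sum>n. (gen_pow V q n x y / fact n) * t ^ n)"
    by (simp add: trans_prob_def mult.commute)
qed

lemma continuous_trans_prob:
  assumes "finite V" "x \<in> V"
  shows "isCont (\<lambda>t. trans_prob V q t x y) t"
  unfolding trans_prob_power_series(2)[OF assms]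
  using trans_prob_power_series(1)[OF assms] by (intro isCont_powser_converges_everywhere) auto

lemma trans_prob_0:
  assumes "finite V" "x \<in> V"
  shows "trans_prob V q 0 x y = (if x = y then 1 else 0)"
  unfolding trans_prob_power_series(2)[OF assms] powser_zero by simp

lemma trans_prob_deriv_0:
  assumes "finite V" "x \<in> V"
  shows "((\<lambda>t. trans_prob V q t x x) has_real_derivative gen V q x x) (at 0)"
proof -
  have "((\<lambda>t. trans_prob V q t x x) has_real_derivative
      (\<Sum>n. diffs (\<lambda>n. gen_pow V q n x x / fact n) n * 0 ^ n)) (at 0)"
    unfolding trans_prob_power_series(2)[OF assms]
    using trans_prob_power_series(1)[OF assms] by (intro termdiffs_strong_converges_everywhere) auto
  moreover have "gen_pow V q 1 x x = gen V q x x"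
  proof -
    have "gen_pow V q 1 x x = (\<Sum>z\<in>V. if z = x then gen V q x z else 0)"
      by (auto intro!: sum.cong)
    then show ?thesis using assms by simp
  qed
  ultimately show ?thesis unfolding powser_zero by (simp add: diffs_def)
qed

locale mixing_chain =
  fixes V :: "'v set" and q \<pi> P
  assumes finV: "finite V" and cardV: "2 \<le> card V" and rates: "rates V q"
    and mixing: "mixing V q \<pi>" and markov: "markov_chain V q P"
begin

abbreviation "tp \<equiv> trans_prob V q"

lemma V_ne: "V \<noteq> {}" using cardV by auto

lemma prob_space_P: "x \<in> V \<Longrightarrow> prob_space (P x)"
  and sets_P: "x \<in> V \<Longrightarrow> sets (P x) = sets (path_space V)"
  using markov by (auto simp: markov_chain_def)

lemma measurable_P [measurable]:
  "x \<in> V \<Longrightarrow> 0 \<le> t \<Longrightarrow> (\<lambda>\<omega>. \<omega> t) \<in> measurable (P x) (count_space V)"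
  using measurable_cong_sets[OF sets_P refl] measurable_path_space by blast

lemma path_in_V: "x \<in> V \<Longrightarrow> \<omega> \<in> space (P x) \<Longrightarrow> 0 \<le> t \<Longrightarrow> \<omega> t \<in> V"
  using measurable_space[OF measurable_P] by fastforce

lemma fdd:
  assumes "x \<in> V" "t 0 = 0" "mono t" "s 0 = x" "\<And>j. j \<le> n \<Longrightarrow> s j \<in> V"
  shows "measure (P x) {\<omega> \<in> space (P x). \<forall>j\<le>n. \<omega> (t j) = s j} =
     (\<Prod>j<n. tp (t (Suc j) - t j) (s j) (s (Suc j)))"
  using markov assms by (auto simp: markov_chain_def)

lemma fdd0: "x \<in> V \<Longrightarrow> measure (P x) {\<omega> \<in> space (P x). \<omega> 0 = x} = 1"
  using fdd[of x "\<lambda>j. real j" "\<lambda>_. x" 0] by (auto simp: mono_def)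

text \<open>The condition at time 0 stays in the event because the finite-dimensional laws are
  prescribed for time sequences that begin at 0, and a path in the space of \<open>P x\<close>
  starts at \<open>x\<close> only almost surely.\<close>

lemma fdd1:
  assumes "x \<in> V" "y \<in> V" "0 \<le> t"
  shows "measure (P x) {\<omega> \<in> space (P x). \<omega> 0 = x \<and> \<omega> t = y} = tp t x y"
proof -
  have "{\<omega> \<in> space (P x). \<omega> 0 = x \<and> \<omega> t = y} =
      {\<omega> \<in> space (P x). \<forall>j\<le>1. \<omega> (if j = (0::nat) then 0 else t) = (if j = 0 then x else y)}"
    by (auto simp: le_Suc_eq split: if_splits)
  then show ?thesis
    using fdd[of x "\<lambda>j. if j = 0 then 0 else t" "\<lambda>j. if j = 0 then x else y" 1] assms
    by (auto simp: mono_def)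
qed

lemma fdd2:
  assumes "x \<in> V" "y \<in> V" "z \<in> V" "0 \<le> t" "0 \<le> u"
  shows "measure (P x) {\<omega> \<in> space (P x). \<omega> 0 = x \<and> \<omega> t = y \<and> \<omega> (t + u) = z} = tp t x y * tp u y z"
proof -
  have all2: "(\<forall>j\<le>2. Q j) \<longleftrightarrow> Q 0 \<and> Q 1 \<and> Q 2" for Q :: "nat \<Rightarrow> bool"
    by (auto simp: numeral_2_eq_2 le_Suc_eq)
  have "{\<omega> \<in> space (P x). \<omega> 0 = x \<and> \<omega> t = y \<and> \<omega> (t + u) = z} =
      {\<omega> \<in> space (P x). \<forall>j\<le>2. \<omega> (if j = (0::nat) then 0 else if j = 1 then t else t + u) =
          (if j = 0 then x else if j = 1 then y else z)}"
    unfolding all2 by simp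
  then show ?thesis
    using fdd[of x "\<lambda>j. if j = 0 then 0 else if j = 1 then t else t + u" "\<lambda>j. if j = 0 then x else if j = 1 then y else z" 2] assms
    by (simp add: mono_def lessThan_Suc numeral_2_eq_2)
qed

text \<open>Nonnegativity, row sums (\<open>tp_sum\<close>) and the semigroup identity
  (\<open>tp_add\<close>) are read off from the path law rather than from the exponential series:
  \<open>tp\<close> is the probability of an event, and events split according to the position at a
  given time.\<close>

lemma tp_nonneg: "x \<in> V \<Longrightarrow> y \<in> V \<Longrightarrow> 0 \<le> t \<Longrightarrow> 0 \<le> tp t x y"
  by (simp flip: fdd1)

lemma measure_split:
  assumes "x \<in> V" "0 \<le> t" and [measurable]: "A \<in> sets (P x)"
  shows "measure (P x) A = (\<Sum>y\<in>V. measure (P x) {\<omega> \<in> A. \<omega> t = y})"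
proof -
  interpret prob_space "P x" using prob_space_P assms by auto
  note [measurable] = measurable_P[OF assms(1,2)]
  have A: "A \<subseteq> space (P x)" using sets.sets_into_space[OF assms(3)] .
  have "A = (\<Union>y\<in>V. {\<omega> \<in> A. \<omega> t = y})"
    using path_in_V[OF assms(1) _ assms(2)] A by auto
  moreover have "{\<omega> \<in> A. \<omega> t = y} \<in> sets (P x)" if "y \<in> V" for y
  proof -
    have "{\<omega> \<in> A. \<omega> t = y} = A \<inter> ((\<lambda>\<omega>. \<omega> t) -` {y} \<inter> space (P x))" using A by auto
    then show ?thesis using that by simp
  qed
  then have "measure (P x) (\<Union>y\<in>V. {\<omega> \<in> A. \<omega> t = y}) = (\<Sum>y\<in>V. measure (P x) {\<omega> \<in> A. \<omega> t = y})"
    by (intro finite_measure_finite_Union[OF finV]) (auto simp: disjoint_family_on_def)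
  ultimately show ?thesis by simp
qed

lemma coord_sets: "x \<in> V \<Longrightarrow> 0 \<le> t \<Longrightarrow> {\<omega> \<in> space (P x). \<omega> t = y} \<in> sets (P x)"
proof -
  assume *: "x \<in> V" "0 \<le> t"
  have "{\<omega> \<in> space (P x). \<omega> t = y} = (\<lambda>\<omega>. \<omega> t) -` ({y} \<inter> V) \<inter> space (P x)"
    using path_in_V[OF *(1) _ *(2)] by auto
  then show ?thesis using measurable_sets[OF measurable_P[OF *], of "{y} \<inter> V"] by simp
qed

lemma tp_sum:
  assumes "x \<in> V" "0 \<le> t"
  shows "(\<Sum>y\<in>V. tp t x y) = 1"
proof -
  have "(\<Sum>y\<in>V. tp t x y) = (\<Sum>y\<in>V. measure (P x) {\<omega> \<in> {\<omega> \<in> space (P x). \<omega> 0 = x}. \<omega> t = y})"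
    using assms by (intro sum.cong) (auto simp: fdd1[symmetric])
  also have "\<dots> = 1"
    using assms by (subst measure_split[symmetric]) (auto simp: fdd0 intro!: coord_sets)
  finally show ?thesis .
qed

lemma tp_add:
  assumes "x \<in> V" "z \<in> V" "0 \<le> t" "0 \<le> u"
  shows "tp (t + u) x z = (\<Sum>y\<in>V. tp t x y * tp u y z)"
proof -
  let ?A = "{\<omega> \<in> space (P x). \<omega> 0 = x} \<inter> {\<omega> \<in> space (P x). \<omega> (t + u) = z}"
  have A: "?A \<in> sets (P x)" using assms by (intro sets.Int coord_sets) auto
  have "tp (t + u) x z = measure (P x) ?A"
    using assms by (subst fdd1[symmetric]) (auto intro!: arg_cong[where f="measure (P x)"])
  also have "\<dots> = (\<Sum>y\<in>V. measure (P x) {\<omega> \<in> ?A. \<omega> t = y})"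
    using assms A by (intro measure_split) auto
  also have "\<dots> = (\<Sum>y\<in>V. tp t x y * tp u y z)"
    using assms by (intro sum.cong) (auto simp: fdd2[symmetric] intro!: arg_cong[where f="measure (P x)"])
  finally show ?thesis .
qed

lemma pi_nonneg: "x \<in> V \<Longrightarrow> 0 \<le> \<pi> x" and pi_sum: "(\<Sum>x\<in>V. \<pi> x) = 1"
  and pi_stat: "0 \<le> t \<Longrightarrow> y \<in> V \<Longrightarrow> (\<Sum>x\<in>V. \<pi> x * tp t x y) = \<pi> y"
  and tp_lim: "x \<in> V \<Longrightarrow> y \<in> V \<Longrightarrow> ((\<lambda>t. tp t x y) \<longlongrightarrow> \<pi> y) at_top"
  using mixing by (auto simp: mixing_def stationary_def)

lemma step_kernel: "0 \<le> h \<Longrightarrow> step_kernel V (tp h) \<pi>"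
  by unfold_locales (auto simp: finV tp_nonneg tp_sum pi_nonneg pi_sum pi_stat)

lemma steps_tp: "0 \<le> h \<Longrightarrow> x \<in> V \<Longrightarrow> y \<in> V \<Longrightarrow> steps V (tp h) n x y = tp (real n * h) x y"
proof (induction n arbitrary: x)
  case (Suc n)
  then show ?case using tp_add[of x y h "real n * h"] by (simp add: algebra_simps)
qed (simp add: trans_prob_0 finV)

lemma q_max_ge: "x \<in> V \<Longrightarrow> (\<Sum>y\<in>V - {x}. q x y) \<le> q_max V q"
  unfolding q_max_def using finV by (intro Max_ge) auto

lemma q_max_nonneg: "0 \<le> q_max V q"
proof -
  obtain x where x: "x \<in> V" using V_ne by auto
  have "0 \<le> (\<Sum>y\<in>V - {x}. q x y)" using rates x by (intro sum_nonneg) (auto simp: rates_def)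
  then show ?thesis using q_max_ge[OF x] by linarith
qed

lemma tp_le_1: "x \<in> V \<Longrightarrow> y \<in> V \<Longrightarrow> 0 \<le> t \<Longrightarrow> tp t x y \<le> 1"
  using tp_sum[of x t] member_le_sum[of y V "tp t x"] finV tp_nonneg by auto

text \<open>Staying is supermultiplicative in time, so the defect from 1 is subadditive. Cutting
  \<open>t\<close> into \<open>n\<close> equal pieces and letting \<open>n\<close> grow, the
  derivative at 0 bounds the defect by \<open>t\<close> times the exit rate of
  \<open>z\<close>.\<close>

lemma tp_stay:
  assumes z: "z \<in> V" and t: "0 \<le> t"
  shows "1 - q_max V q * t \<le> tp t z z"
proof (cases "t = 0")
  case False
  have sub: "1 - tp (real n * u) z z \<le> real n * (1 - tp u z z)" if "0 \<le> u" for n u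
  proof (induction n)
    case (Suc n)
    have "tp u z z * tp (real n * u) z z \<le> tp (u + real n * u) z z"
      using z finV that tp_nonneg by (subst tp_add) (auto intro!: member_le_sum)
    moreover have "0 \<le> (1 - tp u z z) * (1 - tp (real n * u) z z)"
      using z that tp_le_1 by (intro mult_nonneg_nonneg) auto
    ultimately show ?case using Suc by (simp add: algebra_simps)
  qed (simp add: trans_prob_0 finV z)
  have "((\<lambda>u. (tp u z z - tp 0 z z) / (u - 0)) \<longlongrightarrow> gen V q z z) (at 0)"
    using trans_prob_deriv_0[OF finV z] by (simp add: has_field_derivative_iff)
  moreover have "filterlim (\<lambda>n. t / real (Suc n)) (at 0) sequentially"
    unfolding filterlim_at using False t LIMSEQ_Suc[OF lim_const_over_n[of t]]
    by (auto intro!: always_eventually)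
  ultimately have "(\<lambda>n. (tp (t / real (Suc n)) z z - tp 0 z z) / (t / real (Suc n) - 0)) \<longlonglongrightarrow> gen V q z z"
    by (rule filterlim_compose)
  then have lim: "(\<lambda>n. t * ((tp (t / real (Suc n)) z z - tp 0 z z) / (t / real (Suc n) - 0))) \<longlonglongrightarrow> t * gen V q z z"
    by (intro tendsto_mult_left)
  have "t * gen V q z z \<le> tp t z z - 1"
  proof (rule LIMSEQ_le_const2[OF lim], intro exI allI impI)
    fix n
    have "t * ((tp (t / real (Suc n)) z z - tp 0 z z) / (t / real (Suc n) - 0)) =
        - (real (Suc n) * (1 - tp (t / real (Suc n)) z z))"
      using False z by (simp add: trans_prob_0 finV field_simps)
    then show "t * ((tp (t / real (Suc n)) z z - tp 0 z z) / (t / real (Suc n) - 0)) \<le> tp t z z - 1"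
      using sub[of "t / real (Suc n)" "Suc n"] t by simp
  qed
  moreover have "t * - gen V q z z \<le> t * q_max V q"
    using q_max_ge[OF z] t by (intro mult_left_mono) (auto simp: gen_def)
  ultimately show ?thesis by (simp add: mult.commute)
qed (simp add: trans_prob_0 finV z)

text \<open>The full L1 distance, which is twice \<open>d_TV\<close>: in this norm the bounds
  multiply without extra constants (\<open>mixed_add\<close>), and accuracy 1/4 becomes a
  contraction factor 1/2.\<close>

definition mixed :: "real \<Rightarrow> real \<Rightarrow> bool" where
  "mixed t d \<longleftrightarrow> (\<forall>x\<in>V. (\<Sum>v\<in>V. \<bar>tp t x v - \<pi> v\<bar>) \<le> d)"

text \<open>The matrix with all rows equal to \<pi> absorbs transition matrices on both sides. So
  the deviation from it at time \<open>t + u\<close> is the matrix product of the deviations at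
  \<open>t\<close> and at \<open>u\<close>, and row sums of absolute values are
  submultiplicative.\<close>

lemma mixed_add:
  assumes "0 \<le> t" "0 \<le> u" "mixed t d" "mixed u d'" "0 \<le> d'"
  shows "mixed (t + u) (d * d')"
  unfolding mixed_def
proof
  fix x assume x: "x \<in> V"
  have eq: "tp (t + u) x v - \<pi> v = (\<Sum>y\<in>V. (tp t x y - \<pi> y) * (tp u y v - \<pi> v))" if v: "v \<in> V" for v
  proof -
    have "(\<Sum>y\<in>V. (tp t x y - \<pi> y) * (tp u y v - \<pi> v)) =
        (\<Sum>y\<in>V. tp t x y * tp u y v) - (\<Sum>y\<in>V. \<pi> y * tp u y v)
          - ((\<Sum>y\<in>V. tp t x y) - (\<Sum>y\<in>V. \<pi> y)) * \<pi> v"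
      by (simp add: algebra_simps sum.distrib sum_subtractf sum_distrib_left sum_distrib_right)
    then show ?thesis using assms x v by (simp add: tp_add pi_stat tp_sum pi_sum)
  qed
  have "(\<Sum>v\<in>V. \<bar>tp (t + u) x v - \<pi> v\<bar>) \<le> (\<Sum>v\<in>V. \<Sum>y\<in>V. \<bar>tp t x y - \<pi> y\<bar> * \<bar>tp u y v - \<pi> v\<bar>)"
    using eq by (intro sum_mono) (auto intro!: order.trans[OF sum_abs] simp: abs_mult)
  also have "\<dots> = (\<Sum>y\<in>V. \<bar>tp t x y - \<pi> y\<bar> * (\<Sum>v\<in>V. \<bar>tp u y v - \<pi> v\<bar>))"
    unfolding sum_distrib_left by (rule sum.swap)
  also have "\<dots> \<le> (\<Sum>y\<in>V. \<bar>tp t x y - \<pi> y\<bar> * d')"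
    using assms by (intro sum_mono mult_left_mono) (auto simp: mixed_def)
  also have "\<dots> \<le> d * d'"
    using assms x by (auto simp: mixed_def simp flip: sum_distrib_right intro!: mult_right_mono)
  finally show "(\<Sum>v\<in>V. \<bar>tp (t + u) x v - \<pi> v\<bar>) \<le> d * d'" .
qed

lemma mixed_mult:
  assumes "0 \<le> t" "mixed t d" "0 \<le> d"
  shows "mixed (real (Suc n) * t) (d ^ Suc n)"
proof (induction n)
  case (Suc n)
  then show ?case using mixed_add[of "real (Suc n) * t" t "d ^ Suc n" d] assms
    by (simp add: algebra_simps)
qed (use assms in simp)

lemma eventually_mixed: "0 < d \<Longrightarrow> eventually (\<lambda>t. mixed t d) at_top"
proof -
  assume d: "0 < d"
  have "((\<lambda>t. \<Sum>v\<in>V. \<bar>tp t x v - \<pi> v\<bar>) \<longlongrightarrow> (\<Sum>v\<in>V. \<bar>\<pi> v - \<pi> v\<bar>)) at_top" if "x \<in> V" for x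
    using that by (intro tendsto_intros tp_lim) auto
  then have lt: "eventually (\<lambda>t. (\<Sum>v\<in>V. \<bar>tp t x v - \<pi> v\<bar>) < d) at_top" if "x \<in> V" for x
    using d that by (intro order_tendstoD(2)[where y="\<Sum>v\<in>V. \<bar>\<pi> v - \<pi> v\<bar>"]) auto
  have "eventually (\<lambda>t. (\<Sum>v\<in>V. \<bar>tp t x v - \<pi> v\<bar>) \<le> d) at_top" if "x \<in> V" for x
    by (rule eventually_mono[OF lt[OF that]]) auto
  then show ?thesis
    unfolding mixed_def using finV by (intro eventually_ball_finite ballI)
qed

lemma Max_d_TV_le_iff: "Max ((\<lambda>x. d_TV V (tp t x) \<pi>) ` V) \<le> a \<longleftrightarrow> mixed t (2 * a)"
  using finV V_ne by (auto simp: d_TV_def mixed_def)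

text \<open>The least element named in \<open>t_mix\<close> exists: the admissible times form a set
  that is closed by continuity of \<open>tp\<close>, nonempty by convergence to \<pi>, and bounded
  below by 0.\<close>

lemma t_mix_props:
  assumes "0 < a"
  shows "0 \<le> t_mix V q \<pi> a" "mixed (t_mix V q \<pi> a) (2 * a)"
    "\<And>T. 0 \<le> T \<Longrightarrow> mixed T (2 * a) \<Longrightarrow> t_mix V q \<pi> a \<le> T"
proof -
  let ?Z = "{T. 0 \<le> T \<and> mixed T (2 * a)}"
  obtain T0 where "0 \<le> T0" "mixed T0 (2 * a)"
    using eventually_conj[OF eventually_ge_at_top[of 0] eventually_mixed[of "2 * a"]] assms
    by (auto simp: eventually_at_top_linorder)
  then have ne: "?Z \<noteq> {}" by auto
  have Z: "?Z = {0..} \<inter> (\<Inter>x\<in>V. {T. (\<Sum>v\<in>V. \<bar>tp T x v - \<pi> v\<bar>) \<le> 2 * a})"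
    by (auto simp: mixed_def)
  have cl: "closed ?Z"
    unfolding Z using finV
    by (intro closed_Int closed_INT ballI closed_Collect_le continuous_intros)
      (auto intro!: continuous_at_imp_continuous_on continuous_trans_prob)
  have "bdd_below ?Z" by (auto intro: bdd_belowI[of _ 0])
  then have mem: "Inf ?Z \<in> ?Z" and le: "\<And>T. T \<in> ?Z \<Longrightarrow> Inf ?Z \<le> T"
    using closed_contains_Inf[OF ne _ cl] by (auto intro: cInf_lower)
  have "t_mix V q \<pi> a = Inf ?Z"
    unfolding t_mix_def Max_d_TV_le_iff using mem le by (intro Least_equality) auto
  then show "0 \<le> t_mix V q \<pi> a" "mixed (t_mix V q \<pi> a) (2 * a)"
    "\<And>T. 0 \<le> T \<Longrightarrow> mixed T (2 * a) \<Longrightarrow> t_mix V q \<pi> a \<le> T"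
    using mem le by auto
qed

text \<open>At time 0 the distance to \<pi> from \<open>x\<close> is 1 - \<pi> x. Were it at most
  \<open>a\<close> for all \<open>x\<close>, two states would already carry mass 2 (1 - a) >
  1.\<close>

lemma t_mix_pos:
  assumes "0 < a" "a < 1 / 2"
  shows "0 < t_mix V q \<pi> a"
proof (rule ccontr)
  assume "\<not> ?thesis"
  then have "t_mix V q \<pi> a = 0" using t_mix_props(1)[OF assms(1)] by simp
  then have m: "mixed 0 (2 * a)" using t_mix_props(2)[OF assms(1)] by simp
  have *: "2 * (1 - \<pi> x) \<le> 2 * a" if x: "x \<in> V" for x
  proof -
    have "(\<Sum>v\<in>V - {x}. \<bar>tp 0 x v - \<pi> v\<bar>) = (\<Sum>v\<in>V - {x}. \<bar>\<pi> v\<bar>)"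
      using x finV by (intro sum.cong) (auto simp: trans_prob_0)
    then have "(\<Sum>v\<in>V. \<bar>tp 0 x v - \<pi> v\<bar>) = \<bar>1 - \<pi> x\<bar> + (\<Sum>v\<in>V - {x}. \<bar>\<pi> v\<bar>)"
      using x finV by (subst sum.remove[OF finV x]) (simp add: trans_prob_0)
    also have "(\<Sum>v\<in>V - {x}. \<bar>\<pi> v\<bar>) = 1 - \<pi> x"
      using pi_sum sum.remove[OF finV x, of \<pi>] sum.cong[OF refl, of "V - {x}" "\<lambda>v. \<bar>\<pi> v\<bar>" \<pi>] pi_nonneg
      by simp
    finally have "\<bar>1 - \<pi> x\<bar> + (1 - \<pi> x) \<le> 2 * a" using bspec[OF m[unfolded mixed_def] x] by linarith
    with abs_ge_self[of "1 - \<pi> x"] show ?thesis by (simp only: mult_2)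
  qed
  have "real (card V) * (1 - a) \<le> (\<Sum>x\<in>V. \<pi> x)"
    using * sum_mono[of V "\<lambda>_. 1 - a" \<pi>] by fastforce
  moreover have "2 * (1 - a) \<le> real (card V) * (1 - a)" using cardV assms by (intro mult_right_mono) auto
  ultimately show False using pi_sum assms by simp
qed

lemma t_mix_le_mult:
  assumes "0 < a" "(1 / 2) ^ Suc J \<le> 2 * a"
  shows "t_mix V q \<pi> a \<le> real (Suc J) * t_mix V q \<pi> (1 / 4)"
proof (rule t_mix_props(3)[OF assms(1)])
  show "mixed (real (Suc J) * t_mix V q \<pi> (1 / 4)) (2 * a)"
    using mixed_mult[OF t_mix_props(1,2), of "1 / 4" J] assms(2) by (fastforce simp: mixed_def)
qed (use t_mix_props(1)[of "1/4"] in auto)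

lemma transitive_invariant:
  assumes "transitive V q" "x \<in> V" "y \<in> V"
  obtains \<phi> where "\<phi> permutes V" "\<phi> x = y"
    "\<And>t u v. u \<in> V \<Longrightarrow> v \<in> V \<Longrightarrow> tp t (\<phi> u) (\<phi> v) = tp t u v"
    "\<And>v. v \<in> V \<Longrightarrow> \<pi> (\<phi> v) = \<pi> v"
proof -
  obtain \<phi> where \<phi>: "\<phi> permutes V" "\<phi> x = y"
     "\<And>u v. u \<in> V \<Longrightarrow> v \<in> V \<Longrightarrow> u \<noteq> v \<Longrightarrow> q (\<phi> u) (\<phi> v) = q u v"
    using assms unfolding transitive_def by metis
  have t: "tp t (\<phi> u) (\<phi> v) = tp t u v" if "u \<in> V" "v \<in> V" for t u v
    unfolding trans_prob_def using gen_pow_invariant[where q=q and \<phi>=\<phi>, OF finV \<phi>(1,3) that] by simp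
  \<comment> \<open>\<pi> is the limit of the return probabilities, and these are invariant under
    \<phi>.\<close>
  have "\<pi> (\<phi> v) = \<pi> v" if v: "v \<in> V" for v
  proof -
    have "((\<lambda>t. tp t v v) \<longlongrightarrow> \<pi> (\<phi> v)) at_top"
      using tp_lim[of "\<phi> v" "\<phi> v"] t[OF v v] v \<phi>(1) by (simp add: permutes_in_image)
    then show ?thesis using tp_lim[OF v v] tendsto_unique trivial_limit_at_top_linorder by blast
  qed
  then show thesis using that[OF \<phi>(1,2) t] by blast
qed

end

subsection \<open>Meetings on dyadic grids\<close>

primrec path_wt :: "('a \<Rightarrow> 'a \<Rightarrow> real) \<Rightarrow> 'a \<Rightarrow> 'a list \<Rightarrow> real" where
  "path_wt K x [] = 1"
| "path_wt K x (y # ys) = K x y * path_wt K y ys"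

lemma path_wt_prod:
  "path_wt K x ys = (\<Prod>j<length ys. K ((x # ys) ! j) ((x # ys) ! Suc j))"
proof (induction ys arbitrary: x)
  case (Cons y ys)
  show ?case unfolding length_Cons prod.lessThan_Suc_shift by (simp add: Cons)
qed simp

lemma path_wt_nonneg:
  "(\<And>x y. x \<in> S \<Longrightarrow> y \<in> S \<Longrightarrow> 0 \<le> K x y) \<Longrightarrow> x \<in> S \<Longrightarrow> set ys \<subseteq> S \<Longrightarrow> 0 \<le> path_wt K x ys"
  by (induction ys arbitrary: x) auto

text \<open>The \<open>Suc n\<close> tested states are \<open>x\<close> and the \<open>n\<close>
  entries of \<open>ys\<close>; the step after the last test sums out to 1.\<close>

lemma (in finite_kernel) surv_eq_sum_paths:
  assumes "x \<in> S"
  shows "surv S K B (Suc n) x =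
    (if x \<in> B then 0 else \<Sum>ys | set ys \<subseteq> S - B \<and> length ys = n. path_wt K x ys)"
  using assms
proof (induction n arbitrary: x)
  case 0
  have "{ys. set ys \<subseteq> S - B \<and> length ys = 0} = {[]}" by auto
  then show ?case using 0 by (simp add: kop_def K_sum)
next
  case (Suc n)
  let ?L = "\<lambda>n. {ys. set ys \<subseteq> S - B \<and> length ys = n}"
  have "kop S K (surv S K B (Suc n)) x = (\<Sum>y\<in>S. if y \<in> B then 0 else K x y * (\<Sum>ys\<in>?L n. path_wt K y ys))"
    unfolding kop_def by (intro sum.cong refl) (simp add: Suc.IH del: surv.simps)
  also have "\<dots> = (\<Sum>y\<in>S - B. K x y * (\<Sum>ys\<in>?L n. path_wt K y ys))"
    using fin by (intro sum.mono_neutral_cong_right) auto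
  also have "\<dots> = (\<Sum>y\<in>S - B. \<Sum>ys\<in>?L n. path_wt K x (y # ys))"
    by (simp add: sum_distrib_left)
  also have "\<dots> = (\<Sum>ys\<in>?L (Suc n). path_wt K x ys)"
    unfolding lists_length_Suc_eq
    by (subst sum.reindex) (auto simp: inj_on_def sum.cartesian_product' sum.swap[of _ "S - B"])
  finally show ?case by simp
qed

lemma path_wt_prodK:
  "(\<Prod>i<k. path_wt p (x i) (map (\<lambda>y. y i) ys)) = path_wt (prodK k p) x ys"
  by (induction ys arbitrary: x) (simp_all add: prodK_def prod.distrib)

definition coll_free :: "nat \<Rightarrow> real \<Rightarrow> (nat \<Rightarrow> real \<Rightarrow> 'v) \<Rightarrow> bool" where
  "coll_free k t \<omega> \<longleftrightarrow> (\<forall>i j. i < j \<longrightarrow> j < k \<longrightarrow> \<omega> i t \<noteq> \<omega> j t)"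

lemma coll_free_meet_set: "coll_free k t \<omega> \<longleftrightarrow> (\<lambda>i\<in>{..<k}. \<omega> i t) \<notin> meet_set k"
  by (auto simp: coll_free_def meet_set_def index_pairs_def coll_def)

text \<open>By right continuity a collision persists for a short while, so it is seen on a fine dyadic grid.\<close>

lemma meeting_time_ge_iff:
  assumes path: "\<And>i. i < k \<Longrightarrow> \<omega> i \<in> space (path_space V)" and s: "0 < s"
  shows "y \<le> meeting_time k \<omega> \<longleftrightarrow>
    (\<forall>j n. ennreal (real n * (s / 2 ^ j)) < y \<longrightarrow> coll_free k (real n * (s / 2 ^ j)) \<omega>)"
proof
  assume le: "y \<le> meeting_time k \<omega>"
  show "\<forall>j n. ennreal (real n * (s / 2 ^ j)) < y \<longrightarrow> coll_free k (real n * (s / 2 ^ j)) \<omega>"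
  proof (intro allI impI, rule ccontr)
    fix j n assume lt: "ennreal (real n * (s / 2 ^ j)) < y" and c: "\<not> coll_free k (real n * (s / 2 ^ j)) \<omega>"
    have "0 \<le> real n * (s / 2 ^ j)" using s by simp
    then have "meeting_time k \<omega> \<le> ennreal (real n * (s / 2 ^ j))"
      using c unfolding meeting_time_def coll_free_def by (intro Inf_lower) auto
    then show False using le lt by auto
  qed
next
  assume cf: "\<forall>j n. ennreal (real n * (s / 2 ^ j)) < y \<longrightarrow> coll_free k (real n * (s / 2 ^ j)) \<omega>"
  show "y \<le> meeting_time k \<omega>"
    unfolding meeting_time_def
  proof (rule Inf_greatest, clarify, rule ccontr)
    fix t i i' assume t: "0 \<le> t" "i < i'" "i' < k" "\<omega> i t = \<omega> i' t" "\<not> y \<le> ennreal t"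
    have "eventually (\<lambda>u. \<omega> i u = \<omega> i t) (at_right t)" "eventually (\<lambda>u. \<omega> i' u = \<omega> i' t) (at_right t)"
      using path[of i] path[of i'] t by (auto simp: space_path_space)
    then have "eventually (\<lambda>u. \<omega> i u = \<omega> i' u) (at_right t)"
      by eventually_elim (use t in auto)
    then obtain b where b: "t < b" "\<And>u. t < u \<Longrightarrow> u < b \<Longrightarrow> \<omega> i u = \<omega> i' u"
      unfolding eventually_at_right_field by blast
    obtain b' where b': "t < b'" "\<And>u. t < u \<Longrightarrow> u < b' \<Longrightarrow> ennreal u < y"
    proof (cases y)
      case (real r)
      then have "t < r" using t by (auto simp: not_le)
      moreover have "ennreal u < y" if "t < u" "u < r" for u using that t real by (auto simp: ennreal_less_iff)
      ultimately show ?thesis using that by blast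
    next
      case top then show ?thesis using that[of "t + 1"] by auto
    qed
    define c where "c = min b b'"
    have c: "t < c" using b b' by (simp add: c_def)
    \<comment> \<open>A mesh below \<open>c - t\<close> leaves room for a grid point strictly
      between \<open>t\<close> and \<open>c\<close>; \<open>n\<close> below selects the first grid
      point after \<open>t\<close>.\<close>
    obtain j where j: "s / (c - t) < 2 ^ j" using real_arch_pow[of 2 "s / (c - t)"] by auto
    define h where "h = s / 2 ^ j"
    have h: "0 < h" "h < c - t" using j s c by (auto simp: h_def field_simps)
    define n where "n = nat (\<lfloor>t / h\<rfloor> + 1)"
    have n: "real n = of_int \<lfloor>t / h\<rfloor> + 1" unfolding n_def using t h by simp
    have "t / h < real n" "real n \<le> t / h + 1" unfolding n by linarith+
    then have nh: "t < real n * h" "real n * h < c" using h by (auto simp: field_simps)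
    then have "coll_free k (real n * h) \<omega>" using cf b' by (auto simp: h_def c_def)
    moreover have "\<omega> i (real n * h) = \<omega> i' (real n * h)" using b nh by (auto simp: c_def)
    ultimately show False using t by (auto simp: coll_free_def)
  qed
qed

lemma measurable_coord2 [measurable]:
  assumes "i < k" "0 \<le> t"
  shows "(\<lambda>\<omega>. \<omega> i t) \<in> measurable (Pi\<^sub>M {..<k} (\<lambda>_. path_space V)) (count_space V)"
  using measurable_compose[OF measurable_component_singleton[of i "{..<k}" "\<lambda>_. path_space V"] measurable_path_space] assms
  by auto

lemma sets_coord_eq:
  assumes "finite V" "i < k" "0 \<le> t"
  shows "{\<omega> \<in> space (Pi\<^sub>M {..<k} (\<lambda>_. path_space V)). \<omega> i t = v} \<in> sets (Pi\<^sub>M {..<k} (\<lambda>_. path_space V))"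
proof -
  have "{\<omega> \<in> space (Pi\<^sub>M {..<k} (\<lambda>_. path_space V)). \<omega> i t = v} =
    (\<lambda>\<omega>. \<omega> i t) -` ({v} \<inter> V) \<inter> space (Pi\<^sub>M {..<k} (\<lambda>_. path_space V))"
    using measurable_space[OF measurable_coord2[OF assms(2,3)]] by fastforce
  then show ?thesis using measurable_sets[OF measurable_coord2[OF assms(2,3)], of "{v} \<inter> V"] by simp
qed

lemma sets_coll_free:
  assumes V: "finite V" and t: "0 \<le> t"
  shows "{\<omega> \<in> space (Pi\<^sub>M {..<k} (\<lambda>_. path_space V)). coll_free k t \<omega>} \<in> sets (Pi\<^sub>M {..<k} (\<lambda>_. path_space V))"
proof -
  let ?N = "Pi\<^sub>M {..<k} (\<lambda>_. path_space V)"
  let ?E = "\<lambda>i v. {\<omega> \<in> space ?N. \<omega> i t = v}"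
  have "{\<omega> \<in> space ?N. coll_free k t \<omega>} = space ?N - (\<Union>a\<in>index_pairs k. \<Union>v\<in>V. ?E (fst a) v \<inter> ?E (snd a) v)"
  proof -
    have "\<omega> (fst a) t \<in> V" if "\<omega> \<in> space ?N" "a \<in> index_pairs k" for \<omega> a
      using measurable_space[OF measurable_coord2[of "fst a" k t V] that(1)] that(2) t
      by (auto simp: index_pairs_def)
    moreover have "coll_free k t \<omega> \<longleftrightarrow> (\<forall>a\<in>index_pairs k. \<omega> (fst a) t \<noteq> \<omega> (snd a) t)" for \<omega> :: "nat \<Rightarrow> real \<Rightarrow> 'a"
      by (auto simp: coll_free_def index_pairs_def)
    ultimately show ?thesis by fastforce
  qed
  also have "\<dots> \<in> sets ?N"
    using V t by (intro sets.Diff sets.finite_UN finite_index_pairs sets.Int sets_coord_eq sets.top)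
      (auto simp: index_pairs_def)
  finally show ?thesis .
qed

lemma measurable_meeting_time:
  assumes V: "finite V"
  shows "meeting_time k \<in> borel_measurable (Pi\<^sub>M {..<k} (\<lambda>_. path_space V))"
proof (rule borel_measurableI_ge)
  fix y :: ennreal
  let ?N = "Pi\<^sub>M {..<k} (\<lambda>_. path_space V)"
  have "{\<omega> \<in> space ?N. y \<le> meeting_time k \<omega>} =
     {\<omega> \<in> space ?N. \<forall>j n. ennreal (real n * (1 / 2 ^ j)) < y \<longrightarrow> coll_free k (real n * (1 / 2 ^ j)) \<omega>}"
    using meeting_time_ge_iff[of k _ V 1 y] by (auto simp: space_PiM PiE_iff)
  also have "\<dots> \<in> sets ?N"
    by (intro sets.sets_Collect_countable_All sets.sets_Collect_imp sets.sets_Collect_const sets_coll_free V) auto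
  finally show "{\<omega> \<in> space ?N. y \<le> meeting_time k \<omega>} \<in> sets ?N" .
qed

context mixing_chain
begin

abbreviation PP :: "nat \<Rightarrow> (nat \<Rightarrow> 'v) \<Rightarrow> (nat \<Rightarrow> real \<Rightarrow> 'v) measure" where
  "PP k x \<equiv> Pi\<^sub>M {..<k} (\<lambda>i. P (x i))"

lemma prob_space_PP: "x \<in> tuples k V \<Longrightarrow> prob_space (PP k x)"
  by (intro prob_space_PiM prob_space_P) auto

lemma sets_PP: "x \<in> tuples k V \<Longrightarrow> sets (PP k x) = sets (Pi\<^sub>M {..<k} (\<lambda>_. path_space V))"
  by (intro sets_PiM_cong sets_P) auto

lemma space_PP: "x \<in> tuples k V \<Longrightarrow> space (PP k x) = space (Pi\<^sub>M {..<k} (\<lambda>_. path_space V))"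
  by (rule sets_eq_imp_space_eq[OF sets_PP])

lemma grid_path:
  assumes x: "x \<in> V" and ys: "set ys \<subseteq> V" and h: "0 \<le> h"
  shows "measure (P x) {\<omega> \<in> space (P x). \<forall>j\<le>length ys. \<omega> (real j * h) = (x # ys) ! j} = path_wt (tp h) x ys"
proof -
  have V: "(x # ys) ! j \<in> V" if "j \<le> length ys" for j
    using nth_mem[of j "x # ys"] that x ys by (auto simp del: nth_mem)
  have "measure (P x) {\<omega> \<in> space (P x). \<forall>j\<le>length ys. \<omega> (real j * h) = (x # ys) ! j} =
    (\<Prod>j<length ys. tp (real (Suc j) * h - real j * h) ((x # ys) ! j) ((x # ys) ! Suc j))"
    using fdd[of x "\<lambda>j. real j * h" "\<lambda>j. (x # ys) ! j" "length ys"] x V h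
    by (auto simp: mono_def mult_right_mono)
  then show ?thesis by (simp add: path_wt_prod algebra_simps)
qed

lemma grid_path_PP:
  assumes x: "x \<in> tuples k V" and ys: "set ys \<subseteq> tuples k V" and h: "0 \<le> h"
  shows "measure (PP k x) {\<omega> \<in> space (PP k x). \<forall>j\<le>length ys. \<forall>i<k. \<omega> i (real j * h) = ((x # ys) ! j) i} =
    path_wt (prodK k (tp h)) x ys"
proof -
  let ?E = "\<lambda>i. {\<omega> \<in> space (P (x i)). \<forall>j\<le>length ys. \<omega> (real j * h) = ((x # ys) ! j) i}"
  have xV: "x i \<in> V" if "i < k" for i using x that by auto
  have wt: "0 \<le> path_wt (tp h) (x i) (map (\<lambda>y. y i) ys)" if "i < k" for i
    using xV[OF that] ys that h by (intro path_wt_nonneg[of V] tp_nonneg) auto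
  have nth_map': "(x i # map (\<lambda>y. y i) ys) ! j = ((x # ys) ! j) i" if "j \<le> length ys" for i j
    using nth_map[of j "x # ys" "\<lambda>y. y i"] that by simp
  have E: "?E i \<in> sets (P (x i))" if "i < k" for i
  proof -
    have "?E i = space (P (x i)) \<inter> (\<Inter>j\<in>{..length ys}. {\<omega> \<in> space (P (x i)). \<omega> (real j * h) = ((x # ys) ! j) i})"
      by auto
    also have "\<dots> \<in> sets (P (x i))"
      using xV[OF that] h by (intro sets.Int sets.finite_INT coord_sets) auto
    finally show ?thesis .
  qed
  have "{\<omega> \<in> space (PP k x). \<forall>j\<le>length ys. \<forall>i<k. \<omega> i (real j * h) = ((x # ys) ! j) i} =
     prod_emb {..<k} (\<lambda>i. P (x i)) {..<k} (Pi\<^sub>E {..<k} ?E)"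
    by (subst prod_emb_PiE_same_index, blast) (simp add: set_eq_iff space_PiM PiE_iff, blast)
  then have "emeasure (PP k x) {\<omega> \<in> space (PP k x). \<forall>j\<le>length ys. \<forall>i<k. \<omega> i (real j * h) = ((x # ys) ! j) i} =
     (\<Prod>i<k. emeasure (P (x i)) (?E i))"
    using E prob_space_P xV by (simp only:) (intro emeasure_PiM_emb, auto simp only: lessThan_iff)
  also have "\<dots> = (\<Prod>i<k. ennreal (path_wt (tp h) (x i) (map (\<lambda>y. y i) ys)))"
  proof (intro prod.cong refl)
    fix i assume "i \<in> {..<k}"
    then have i: "i < k" by simp
    interpret prob_space "P (x i)" using prob_space_P xV[OF i] .
    have "measure (P (x i)) (?E i) = path_wt (tp h) (x i) (map (\<lambda>y. y i) ys)"
    proof -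
      have "set (map (\<lambda>y. y i) ys) \<subseteq> V" using ys i by auto
      then show ?thesis
        using grid_path[OF xV[OF i] _ h, of "map (\<lambda>y. y i) ys"] by (simp add: nth_map' cong: imp_cong)
    qed
    then show "emeasure (P (x i)) (?E i) = ennreal (path_wt (tp h) (x i) (map (\<lambda>y. y i) ys))"
      by (simp add: emeasure_eq_measure)
  qed
  also have "\<dots> = ennreal (path_wt (prodK k (tp h)) x ys)"
  proof (subst prod_ennreal)
    fix i assume "i \<in> {..<k}"
    then show "0 \<le> path_wt (tp h) (x i) (map (\<lambda>y. y i) ys)"
      using wt by simp
  qed (simp add: path_wt_prodK)
  finally show ?thesis
  proof (rule measure_eq_emeasure_eq_ennreal[rotated])
    have "0 \<le> (\<Prod>i<k. path_wt (tp h) (x i) (map (\<lambda>y. y i) ys))"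
      using wt by (intro prod_nonneg) simp
    then show "0 \<le> path_wt (prodK k (tp h)) x ys" by (simp add: path_wt_prodK)
  qed
qed

lemma sets_grid:
  assumes h: "0 \<le> h" and x: "x \<in> tuples k V"
  shows "{\<omega> \<in> space (PP k x). \<forall>j<n. coll_free k (real j * h) \<omega>} \<in> sets (PP k x)"
proof -
  have "{\<omega> \<in> space (PP k x). \<forall>j<n. coll_free k (real j * h) \<omega>} =
     space (PP k x) \<inter> (\<Inter>j\<in>{..<n}. space (PP k x) \<inter> {\<omega> \<in> space (PP k x). coll_free k (real j * h) \<omega>})"
    by auto
  also have "\<dots> \<in> sets (PP k x)"
  proof (cases "n = 0")
    case False
    have "{\<omega> \<in> space (PP k x). coll_free k (real j * h) \<omega>} \<in> sets (PP k x)" for j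
      using h sets_coll_free[OF finV, of "real j * h" k] by (simp add: sets_PP[OF x] space_PP[OF x])
    then show ?thesis using False by (intro sets.Int sets.finite_INT sets.top) auto
  qed simp
  finally show ?thesis .
qed

text \<open>Split by the positions of all chains at the grid times: the resulting cylinder events
  are disjoint, have probabilities \<open>path_wt\<close>, and are summed by
  \<open>surv_eq_sum_paths\<close>.\<close>

lemma grid_surv:
  assumes x: "x \<in> tuples k V" and h: "0 \<le> h"
  shows "measure (PP k x) {\<omega> \<in> space (PP k x). \<forall>j<n. coll_free k (real j * h) \<omega>} =
    surv (tuples k V) (prodK k (tp h)) (meet_set k) n x"
proof (cases n)
  case 0
  then show ?thesis using prob_space.prob_space[OF prob_space_PP[OF x]] by simp
next
  case (Suc m)
  interpret prob_space "PP k x" using prob_space_PP[OF x] .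
  let ?S = "tuples k V" and ?B = "meet_set k :: (nat \<Rightarrow> 'v) set"
  define A where "A = {\<omega> \<in> space (PP k x). \<forall>j<n. coll_free k (real j * h) \<omega>}"
  define E where "E ys = {\<omega> \<in> space (PP k x). \<forall>j\<le>length ys. \<forall>i<k. \<omega> i (real j * h) = ((x # ys) ! j) i}" for ys
  have fin: "finite ?S" using finV by (auto intro: finite_PiE)
  have in_V: "\<omega> i t \<in> V" if "\<omega> \<in> space (PP k x)" "i < k" "0 \<le> t" for \<omega> i t
    using that measurable_space[OF measurable_coord2[OF that(2,3)], of \<omega> V] space_PP[OF x] by simp
  have E_sets: "E ys \<in> events" for ys
  proof -
    have "E ys = space (PP k x) \<inter> (\<Inter>j\<in>{..length ys}. space (PP k x) \<inter> (\<Inter>i\<in>{..<k}. {\<omega> \<in> space (PP k x). \<omega> i (real j * h) = ((x # ys) ! j) i}))"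
      by (auto simp: E_def)
    also have "\<dots> \<in> events"
    proof -
      have "{\<omega> \<in> space (PP k x). \<omega> i (real j * h) = v} \<in> events" if "i < k" for i j v
        using sets_coord_eq[OF finV that, of "real j * h" v] h by (simp add: sets_PP[OF x] space_PP[OF x])
      then show ?thesis
        by (cases "k = 0") (auto intro!: sets.Int sets.finite_INT)
    qed
    finally show ?thesis .
  qed
  have A_sets: "A \<in> events" unfolding A_def by (rule sets_grid[OF h x])
  \<comment> \<open>\<open>E []\<close> says that the chains start at \<open>x\<close>. This holds
    only almost surely, so it is intersected with \<open>A\<close> before the decomposition into
    cylinders.\<close>
  have "prob (E []) = 1" unfolding E_def using grid_path_PP[OF x, of "[]" h] h by simp
  then have "AE \<omega> in PP k x. \<omega> \<in> E []" by (rule AE_prob_1)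
  then have "AE \<omega> in PP k x. \<omega> \<in> A \<longleftrightarrow> \<omega> \<in> A \<inter> E []" by eventually_elim blast
  then have 1: "prob A = prob (A \<inter> E [])"
    using A_sets E_sets by (intro finite_measure_eq_AE sets.Int)
  have cf: "coll_free k (real j * h) \<omega> \<longleftrightarrow> (x # ys) ! j \<notin> ?B"
    if "\<omega> \<in> E ys" "j \<le> length ys" "set ys \<subseteq> ?S" for j ys \<omega>
  proof -
    have "(x # ys) ! j \<in> ?S" using nth_mem[of j "x # ys"] that x by (auto simp del: nth_mem)
    then have "(\<lambda>i\<in>{..<k}. \<omega> i (real j * h)) = (x # ys) ! j"
      using that by (intro PiE_ext[of _ "{..<k}" "\<lambda>_. UNIV"]) (auto simp: E_def PiE_iff)
    then show ?thesis by (simp add: coll_free_meet_set)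
  qed
  let ?L = "{ys. set ys \<subseteq> ?S - ?B \<and> length ys = m}"
  have finL: "finite ?L" using fin by (intro finite_lists_length_eq) auto
  show ?thesis
  proof (cases "x \<in> ?B")
    case True
    have "A \<inter> E [] = {}" using cf[of _ "[]" 0] True Suc by (fastforce simp: A_def)
    then show ?thesis using 1 True Suc by (simp add: A_def)
  next
    case False
    have eq: "A \<inter> E [] = (\<Union>ys\<in>?L. E ys)"
    proof (intro equalityI subsetI)
      fix \<omega> assume w: "\<omega> \<in> A \<inter> E []"
      define ys where "ys = map (\<lambda>j. \<lambda>i\<in>{..<k}. \<omega> i (real (Suc j) * h)) [0..<m]"
      have sp: "\<omega> \<in> space (PP k x)" using w by (simp add: A_def)
      have cfw: "\<forall>j<n. coll_free k (real j * h) \<omega>" using w unfolding A_def by (elim IntE CollectE conjE)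
      have w0: "\<omega> i 0 = x i" if "i < k" for i using w that by (simp add: E_def)
      have "set ys \<subseteq> ?S" unfolding ys_def using in_V[OF sp] h by (simp add: image_subset_iff PiE_iff)
      moreover have "\<omega> \<in> E ys"
        unfolding E_def
      proof (intro CollectI conjI allI impI)
        fix j i assume "j \<le> length ys" "i < k"
        then show "\<omega> i (real j * h) = ((x # ys) ! j) i"
          by (cases j) (simp_all add: ys_def w0)
      qed (rule sp)
      moreover have "y \<notin> ?B" if "y \<in> set ys" for y
      proof -
        obtain j where "j < m" "y = (\<lambda>i\<in>{..<k}. \<omega> i (real (Suc j) * h))" using \<open>y \<in> set ys\<close> by (auto simp: ys_def)
        moreover have "coll_free k (real (Suc j) * h) \<omega>" using spec[OF cfw, of "Suc j"] \<open>j < m\<close> Suc by simp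
        ultimately show ?thesis by (simp only: coll_free_meet_set not_False_eq_True)
      qed
      moreover have "length ys = m" by (simp add: ys_def)
      ultimately show "\<omega> \<in> (\<Union>ys\<in>?L. E ys)" by blast
    next
      fix \<omega> assume "\<omega> \<in> (\<Union>ys\<in>?L. E ys)"
      then obtain ys where ys: "\<omega> \<in> E ys" "set ys \<subseteq> ?S - ?B" "length ys = m" by auto
      have "coll_free k (real j * h) \<omega>" if "j < n" for j
      proof -
        have "(x # ys) ! j \<in> insert x (?S - ?B)"
          using nth_mem[of j "x # ys"] that ys Suc by (auto simp del: nth_mem)
        then have nB: "(x # ys) ! j \<notin> ?B" using False by (metis DiffD2 insertE)
        have "j \<le> length ys" using that ys(3) Suc by simp
        moreover have "set ys \<subseteq> ?S" using ys(2) by blast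
        ultimately show ?thesis using cf[OF ys(1)] nB by metis
      qed
      moreover have "\<omega> \<in> space (PP k x)" "\<omega> \<in> E []"
        using ys(1) spec[of _ 0] unfolding E_def by (blast, auto)
      ultimately show "\<omega> \<in> A \<inter> E []" by (simp add: A_def)
    qed
    have disj: "disjoint_family_on E ?L"
      unfolding disjoint_family_on_def
    proof (intro ballI impI)
      fix ys zs assume yz: "ys \<in> ?L" "zs \<in> ?L" "ys \<noteq> zs"
      then have len: "length ys = m" "length zs = m" by blast+
      then obtain j where j: "j < m" "ys ! j \<noteq> zs ! j" using yz(3) by (metis nth_equalityI)
      have "ys ! j \<in> set ys" "zs ! j \<in> set zs" using j len by simp_all
      then have "ys ! j \<in> ?S" "zs ! j \<in> ?S" using yz by blast+
      then obtain i where i: "i < k" "(ys ! j) i \<noteq> (zs ! j) i"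
        using j(2) by (metis PiE_ext lessThan_iff)
      have st: "\<omega> i (real (Suc j) * h) = (ws ! j) i" if "\<omega> \<in> E ws" "ws \<in> ?L" for \<omega> ws
      proof -
        have "\<forall>j\<le>length ws. \<forall>i<k. \<omega> i (real j * h) = ((x # ws) ! j) i"
          using that(1) unfolding E_def mem_Collect_eq by (rule conjunct2)
        from spec[OF this, of "Suc j"] show ?thesis using that(2) i j by simp
      qed
      show "E ys \<inter> E zs = {}"
      proof (rule equals0I, elim IntE)
        fix \<omega> assume w: "\<omega> \<in> E ys" "\<omega> \<in> E zs"
        have "(ys ! j) i = (zs ! j) i" by (rule trans[OF sym[OF st[OF w(1) yz(1)]] st[OF w(2) yz(2)]])
        with i(2) show False by (rule notE)
      qed
    qed
    have "prob A = (\<Sum>ys\<in>?L. prob (E ys))"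
      unfolding 1 eq using E_sets disj by (intro finite_measure_finite_Union finL) auto
    also have "\<dots> = (\<Sum>ys\<in>?L. path_wt (prodK k (tp h)) x ys)"
      unfolding E_def using x h by (intro sum.cong refl grid_path_PP) auto
    finally show ?thesis unfolding A_def using False by (simp only: Suc finite_kernel.surv_eq_sum_paths[OF step_kernel.finite_kernel_prodK[OF step_kernel[OF h]] x] if_False)
  qed
qed

end

subsection \<open>Survival probabilities in continuous time\<close>

context mixing_chain
begin

definition G :: "nat \<Rightarrow> real \<Rightarrow> nat \<Rightarrow> (nat \<Rightarrow> 'v) \<Rightarrow> real" where
  "G k s N x = measure (PP k x) {\<omega> \<in> space (PP k x). ennreal (real N * s) \<le> meeting_time k \<omega>}"

text \<open>A window of length \<open>s\<close> is exactly \<open>2 ^ j\<close> steps at every level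
  \<open>j\<close>, so its mixing error is the same at all levels.\<close>

definition dsurv :: "nat \<Rightarrow> real \<Rightarrow> nat \<Rightarrow> nat \<Rightarrow> (nat \<Rightarrow> 'v) \<Rightarrow> real" where
  "dsurv k s j N = surv (tuples k V) (prodK k (tp (s / 2 ^ j))) (meet_set k) (N * 2 ^ j)"

definition pi_prod :: "nat \<Rightarrow> (nat \<Rightarrow> 'v) \<Rightarrow> real" where
  "pi_prod k x = (\<Prod>l<k. \<pi> (x l))"

definition phi :: "nat \<Rightarrow> real \<Rightarrow> nat \<Rightarrow> real" where
  "phi k s N = (\<Sum>x\<in>tuples k V. pi_prod k x * G k s N x)"

lemma finite_tuples: "finite (tuples k V)"
  using finV by (auto intro: finite_PiE)

lemma pi_prod_nonneg: "x \<in> tuples k V \<Longrightarrow> 0 \<le> pi_prod k x"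
  unfolding pi_prod_def by (intro prod_nonneg pi_nonneg) auto

lemma pi_prod_sum: "(\<Sum>x\<in>tuples k V. pi_prod k x) = 1"
  unfolding pi_prod_def using finV pi_sum by (subst prod_sum_PiE[symmetric]) (auto intro: prod.neutral)

text \<open>Refining the grid tests more times, so the events decrease; by
  \<open>meeting_time_ge_iff\<close> their intersection is the event M >= N s. The discrete survival
  probabilities converge from above.\<close>

lemma G_lim:
  assumes x: "x \<in> tuples k V" and s: "0 < s"
  shows "(\<lambda>j. dsurv k s j N x) \<longlonglongrightarrow> G k s N x" and "G k s N x \<le> dsurv k s j N x"
proof -
  interpret prob_space "PP k x" by (rule prob_space_PP[OF x])
  define E where "E j = {\<omega> \<in> space (PP k x). \<forall>n<N * 2 ^ j. coll_free k (real n * (s / 2 ^ j)) \<omega>}" for j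
  have E_sets: "range E \<subseteq> events"
    unfolding E_def using s by (intro image_subsetI sets_grid x) simp
  have d: "dsurv k s j N x = prob (E j)" for j
    unfolding dsurv_def E_def using s by (intro grid_surv[symmetric] x) simp
  have dec: "decseq E"
  proof (rule decseq_SucI, rule subsetI)
    fix j \<omega> assume w: "\<omega> \<in> E (Suc j)"
    have "coll_free k (real n * (s / 2 ^ j)) \<omega>" if "n < N * 2 ^ j" for n
    proof -
      have "\<forall>n<N * 2 ^ Suc j. coll_free k (real n * (s / 2 ^ Suc j)) \<omega>"
        using w unfolding E_def mem_Collect_eq by (rule conjunct2)
      moreover have "2 * n < N * 2 ^ Suc j" using that by simp
      ultimately have "coll_free k (real (2 * n) * (s / 2 ^ Suc j)) \<omega>" by blast
      moreover have "real (2 * n) * (s / 2 ^ Suc j) = real n * (s / 2 ^ j)" by simp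
      ultimately show ?thesis by (simp only:)
    qed
    then show "\<omega> \<in> E j" using w by (simp add: E_def)
  qed
  have less: "ennreal (real n * (s / 2 ^ j)) < ennreal (real N * s) \<longleftrightarrow> n < N * 2 ^ j" for n j
  proof -
    have "ennreal (real n * (s / 2 ^ j)) < ennreal (real N * s) \<longleftrightarrow> real n * (s / 2 ^ j) < real N * s"
      using s by (intro ennreal_less_iff) simp
    also have "\<dots> \<longleftrightarrow> real n < real N * 2 ^ j"
      using s by (simp add: field_simps)
    also have "\<dots> \<longleftrightarrow> real n < real (N * 2 ^ j)" by simp
    finally show ?thesis unfolding of_nat_less_iff .
  qed
  have "\<omega> i \<in> space (path_space V)" if "\<omega> \<in> space (PP k x)" "i < k" for \<omega> i
    using that unfolding space_PP[OF x] by (auto simp: space_PiM)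
  then have "{\<omega> \<in> space (PP k x). ennreal (real N * s) \<le> meeting_time k \<omega>} =
      {\<omega> \<in> space (PP k x). \<forall>j n. n < N * 2 ^ j \<longrightarrow> coll_free k (real n * (s / 2 ^ j)) \<omega>}"
    using meeting_time_ge_iff[OF _ s, of k _ V "ennreal (real N * s)"] unfolding less by blast
  also have "\<dots> = (\<Inter>j. E j)" unfolding E_def by blast
  finally have G: "G k s N x = prob (\<Inter>j. E j)" unfolding G_def by simp
  show "(\<lambda>j. dsurv k s j N x) \<longlonglongrightarrow> G k s N x"
    unfolding d G by (rule finite_Lim_measure_decseq[OF E_sets dec])
  show "G k s N x \<le> dsurv k s j N x"
    unfolding d G using E_sets by (intro finite_measure_mono) auto
qed

lemma G_bounds:
  assumes "x \<in> tuples k V" shows "0 \<le> G k s N x" "G k s N x \<le> 1"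
  using prob_space.prob_le_1[OF prob_space_PP[OF assms]] unfolding G_def by auto

lemma phi_lim:
  "0 < s \<Longrightarrow> (\<lambda>j. \<Sum>x\<in>tuples k V. pi_prod k x * dsurv k s j N x) \<longlonglongrightarrow> phi k s N"
  unfolding phi_def by (intro tendsto_sum tendsto_mult_left G_lim)

lemma phi_le: "0 < s \<Longrightarrow> phi k s N \<le> (\<Sum>x\<in>tuples k V. pi_prod k x * dsurv k s j N x)"
  unfolding phi_def by (intro sum_mono mult_left_mono G_lim(2) pi_prod_nonneg)

lemma phi_bounds: "0 \<le> phi k s N" "phi k s N \<le> 1"
proof -
  show "0 \<le> phi k s N" unfolding phi_def by (intro sum_nonneg mult_nonneg_nonneg pi_prod_nonneg G_bounds)
  have "phi k s N \<le> (\<Sum>x\<in>tuples k V. pi_prod k x * 1)"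
    unfolding phi_def by (intro sum_mono mult_left_mono pi_prod_nonneg G_bounds)
  then show "phi k s N \<le> 1" by (simp add: pi_prod_sum)
qed

lemma steps_dyadic:
  "0 < s \<Longrightarrow> x \<in> V \<Longrightarrow> y \<in> V \<Longrightarrow> steps V (tp (s / 2 ^ j)) (2 ^ j) x y = tp s x y"
  by (subst steps_tp) auto

lemma mixed_steps:
  assumes "0 < s" "mixed s d" "x \<in> V"
  shows "(\<Sum>v\<in>V. \<bar>steps V (tp (s / 2 ^ j)) (2 ^ j) x v - \<pi> v\<bar>) \<le> d"
proof -
  have "(\<Sum>v\<in>V. \<bar>steps V (tp (s / 2 ^ j)) (2 ^ j) x v - \<pi> v\<bar>) = (\<Sum>v\<in>V. \<bar>tp s x v - \<pi> v\<bar>)"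
    by (intro sum.cong refl) (simp add: steps_dyadic assms)
  then show ?thesis using assms unfolding mixed_def by fastforce
qed

lemma kop_mix:
  assumes s: "0 < s" and d: "mixed s d" and "y \<in> tuples k V" "\<And>z. z \<in> tuples k V \<Longrightarrow> 0 \<le> F z \<and> F z \<le> 1"
  shows "\<bar>(kop (tuples k V) (prodK k (tp (s / 2 ^ j))) ^^ 2 ^ j) F y - (\<Sum>z\<in>tuples k V. pi_prod k z * F z)\<bar> \<le> real k * d"
proof -
  interpret step_kernel V "tp (s / 2 ^ j)" \<pi> using s by (intro step_kernel) simp
  show ?thesis unfolding pi_prod_def by (rule prodK_mix[OF mixed_steps[OF s d] assms(3,4)])
qed

text \<open>Limit of \<open>surv_mix_upper\<close> as the grid is refined; the error
  \<open>real k * d\<close> does not depend on the level.\<close>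

lemma G_upper:
  assumes x: "x \<in> tuples k V" and s: "0 < s" and d: "mixed s d"
  shows "G k s (n + (1 + N)) x \<le> G k s n x * (phi k s N + real k * d)"
proof (rule LIMSEQ_le)
  show "(\<lambda>j. dsurv k s j (n + (1 + N)) x) \<longlonglongrightarrow> G k s (n + (1 + N)) x" by (rule G_lim[OF x s])
  show "(\<lambda>j. dsurv k s j n x * ((\<Sum>x\<in>tuples k V. pi_prod k x * dsurv k s j N x) + real k * d)) \<longlonglongrightarrow>
      G k s n x * (phi k s N + real k * d)"
    by (intro tendsto_intros G_lim[OF x s] phi_lim[OF s])
  have "dsurv k s j (n + (1 + N)) x \<le> dsurv k s j n x * ((\<Sum>x\<in>tuples k V. pi_prod k x * dsurv k s j N x) + real k * d)" for j
  proof -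
    interpret step_kernel V "tp (s / 2 ^ j)" \<pi> using s by (intro step_kernel) simp
    interpret T: finite_kernel "tuples k V" "prodK k (tp (s / 2 ^ j))" by (rule finite_kernel_prodK)
    have e: "(n + (1 + N)) * 2 ^ j = n * 2 ^ j + (2 ^ j + N * 2 ^ j)" by (simp add: algebra_simps)
    show ?thesis
      using T.surv_mix_upper[OF kop_mix[OF s d] x, where B="meet_set k" and n="n * 2 ^ j" and m="N * 2 ^ j"]
      unfolding dsurv_def e .
  qed
  then show "\<exists>M. \<forall>j\<ge>M. dsurv k s j (n + (1 + N)) x \<le>
      dsurv k s j n x * ((\<Sum>x\<in>tuples k V. pi_prod k x * dsurv k s j N x) + real k * d)" by blast
qed

text \<open>Limit of \<open>surv_mix_lower\<close> with two consecutive windows of length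
  \<open>s\<close>; \<open>1 - phi k s 1\<close> is the stationary probability of a collision in the
  second one.\<close>

lemma G_lower:
  assumes x: "x \<in> tuples k V" and s: "0 < s" and d: "mixed s d"
  shows "G k s (n + 1) x * (phi k s N - real k * d) - G k s n x * (1 - phi k s 1 + real k * d)
    \<le> G k s (n + 1 + (1 + N)) x"
proof (rule LIMSEQ_le)
  let ?f = "\<lambda>j N. \<Sum>x\<in>tuples k V. pi_prod k x * dsurv k s j N x"
  show "(\<lambda>j. dsurv k s j (n + 1 + (1 + N)) x) \<longlonglongrightarrow> G k s (n + 1 + (1 + N)) x" by (rule G_lim[OF x s])
  show "(\<lambda>j. dsurv k s j (n + 1) x * (?f j N - real k * d) - dsurv k s j n x * (1 - ?f j 1 + real k * d)) \<longlonglongrightarrow>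
      G k s (n + 1) x * (phi k s N - real k * d) - G k s n x * (1 - phi k s 1 + real k * d)"
    by (intro tendsto_intros G_lim[OF x s] phi_lim[OF s])
  have "dsurv k s j (n + 1) x * (?f j N - real k * d) - dsurv k s j n x * (1 - ?f j 1 + real k * d)
    \<le> dsurv k s j (n + 1 + (1 + N)) x" for j
  proof -
    interpret step_kernel V "tp (s / 2 ^ j)" \<pi> using s by (intro step_kernel) simp
    interpret T: finite_kernel "tuples k V" "prodK k (tp (s / 2 ^ j))" by (rule finite_kernel_prodK)
    have e: "(n + 1) * 2 ^ j = n * 2 ^ j + 2 ^ j" "1 * 2 ^ j = (2 ^ j :: nat)"
      "(n + 1 + (1 + N)) * 2 ^ j = n * 2 ^ j + 2 ^ j + (2 ^ j + N * 2 ^ j)" by (simp_all add: algebra_simps)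
    show ?thesis
      using T.surv_mix_lower[OF kop_mix[OF s d] x, where B="meet_set k" and n="n * 2 ^ j" and m="N * 2 ^ j"]
      unfolding dsurv_def e .
  qed
  then show "\<exists>M. \<forall>j\<ge>M. dsurv k s j (n + 1) x * (?f j N - real k * d) - dsurv k s j n x * (1 - ?f j 1 + real k * d)
    \<le> dsurv k s j (n + 1 + (1 + N)) x" by blast
qed

text \<open>Without jumps the return probabilities stay equal to 1, so convergence gives every one
  of at least two states mass 1.\<close>

lemma q_max_pos: "0 < q_max V q"
proof (rule ccontr)
  assume "\<not> ?thesis"
  then have q: "q_max V q = 0" using q_max_nonneg by simp
  have "1 \<le> \<pi> x" if x: "x \<in> V" for x
  proof (rule tendsto_lowerbound[OF tp_lim[OF x x]])
    show "\<forall>\<^sub>F t in at_top. 1 \<le> tp t x x"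
      using eventually_ge_at_top[of 0] by eventually_elim (use tp_stay[OF x] q in auto)
  qed simp
  then have "(\<Sum>x\<in>V. 1) \<le> (\<Sum>x\<in>V. \<pi> x)" by (intro sum_mono)
  then show False using cardV pi_sum by simp
qed

section \<open>Meetings of two chains, at least one of them stationary\<close>

abbreviation pair_hit :: "real \<Rightarrow> nat \<Rightarrow> 'v \<times> 'v \<Rightarrow> real" where
  "pair_hit h n \<equiv> hit (V \<times> V) (pairK (tp h)) diag n"

abbreviation pmeet :: "real \<Rightarrow> nat \<Rightarrow> real" where
  "pmeet s N \<equiv> 1 - phi 2 s N"

lemma sum_pi_prod_hit:
  "(\<Sum>x\<in>tuples k V. pi_prod k x * (1 - F x)) = 1 - (\<Sum>x\<in>tuples k V. pi_prod k x * F x)"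
  by (simp add: right_diff_distrib sum_subtractf pi_prod_sum)

lemma meet_set_2: "meet_set 2 = coll (0, 1)"
proof -
  have "index_pairs 2 = {(0, 1)}" by (auto simp: index_pairs_def)
  then show ?thesis by (simp add: meet_set_def)
qed

lemma phit_eq:
  assumes s: "0 < s"
  shows "step_kernel.phit V (tp (s / 2 ^ j)) \<pi> (N * 2 ^ j) = 1 - (\<Sum>x\<in>tuples 2 V. pi_prod 2 x * dsurv 2 s j N x)"
proof -
  interpret step_kernel V "tp (s / 2 ^ j)" \<pi> using s by (intro step_kernel) simp
  have "1 - (\<Sum>x\<in>tuples 2 V. pi_prod 2 x * dsurv 2 s j N x) = (\<Sum>x\<in>tuples 2 V. pi_prod 2 x * (1 - dsurv 2 s j N x))"
    by (rule sum_pi_prod_hit[symmetric])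
  also have "\<dots> = phit (N * 2 ^ j)"
    unfolding dsurv_def meet_set_2 pi_prod_def by (rule mean_hit_coll) auto
  finally show ?thesis by (rule sym)
qed

lemma phit_lim:
  assumes s: "0 < s"
  shows "(\<lambda>j. step_kernel.phit V (tp (s / 2 ^ j)) \<pi> (N * 2 ^ j)) \<longlonglongrightarrow> pmeet s N"
  unfolding phit_eq[OF s] by (intro tendsto_intros phi_lim s)

text \<open>\<open>mean_hit_bounds\<close> asks for a bound over all \<open>N\<close> windows,
  whereas \<open>H\<close> covers a single one. By \<open>avg_hit_pair_add\<close> the rest costs
  \<open>pmeet s N + d\<close>, which explains the bracket. As \<open>H\<close> serves all levels
  \<open>j\<close>, both bounds pass to the limit.\<close>

lemma phi_union_bounds:
  fixes k N :: nat
  assumes s: "0 < s" and d: "mixed s d"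
    and H: "\<And>j u. u \<in> V \<Longrightarrow> (\<Sum>v\<in>V. \<pi> v * pair_hit (s / 2 ^ j) (2 ^ j) (u, v)) \<le> H"
  defines "l \<equiv> real (k choose 2)"
  shows "1 - phi k s N \<le> l * pmeet s N"
    and "l * pmeet s N - l\<^sup>2 * (pmeet s N * (H + pmeet s N + d)) \<le> 1 - phi k s N"
proof -
  let ?p = "\<lambda>j. step_kernel.phit V (tp (s / 2 ^ j)) \<pi> (N * 2 ^ j)"
  let ?P = "\<lambda>j. 1 - (\<Sum>x\<in>tuples k V. pi_prod k x * dsurv k s j N x)"
  have main: "?P j \<le> l * ?p j \<and> l * ?p j - l\<^sup>2 * (?p j * (H + ?p j + d)) \<le> ?P j" for j
  proof -
    interpret step_kernel V "tp (s / 2 ^ j)" \<pi> using s by (intro step_kernel) simp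
    have Hj: "(\<Sum>v\<in>V. \<pi> v * pair_hit (s / 2 ^ j) (N * 2 ^ j) (u, v)) \<le> H + ?p j + d" if u: "u \<in> V" for u
    proof -
      have "(\<Sum>v\<in>V. \<pi> v * pair_hit (s / 2 ^ j) (N * 2 ^ j) (u, v)) \<le>
         (\<Sum>v\<in>V. \<pi> v * pair_hit (s / 2 ^ j) (2 ^ j + N * 2 ^ j) (u, v))"
        using u by (intro sum_mono mult_left_mono diff_left_mono pair.surv_antimono pi_nonneg) auto
      also have "\<dots> \<le> (\<Sum>v\<in>V. \<pi> v * pair_hit (s / 2 ^ j) (2 ^ j) (u, v)) + ?p j + d"
        by (rule avg_hit_pair_add[OF mixed_steps[OF s d] u])
      finally show ?thesis using H[OF u, of j] by linarith
    qed
    have "?P j = (\<Sum>x\<in>tuples k V. pi_prod k x * (1 - dsurv k s j N x))"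
      by (rule sum_pi_prod_hit[symmetric])
    then show ?thesis unfolding l_def dsurv_def pi_prod_def
      by (simp only:) (intro conjI mean_hit_bounds[where H="H + ?p j + d"] Hj)
  qed
  have P_lim: "?P \<longlonglongrightarrow> 1 - phi k s N" by (intro tendsto_intros phi_lim s)
  show "1 - phi k s N \<le> l * pmeet s N"
    by (rule LIMSEQ_le[OF P_lim tendsto_mult_left[OF phit_lim[OF s]]]) (use main in blast)
  have "(\<lambda>j. l * ?p j - l\<^sup>2 * (?p j * (H + ?p j + d))) \<longlonglongrightarrow>
      l * pmeet s N - l\<^sup>2 * (pmeet s N * (H + pmeet s N + d))"
    by (intro tendsto_intros phit_lim s)
  then show "l * pmeet s N - l\<^sup>2 * (pmeet s N * (H + pmeet s N + d)) \<le> 1 - phi k s N"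
    by (rule LIMSEQ_le[OF _ P_lim]) (use main in blast)
qed

lemma pmeet_1_le:
  assumes s: "0 < s" and H: "\<And>j u. u \<in> V \<Longrightarrow> (\<Sum>v\<in>V. \<pi> v * pair_hit (s / 2 ^ j) (2 ^ j) (u, v)) \<le> H"
  shows "pmeet s 1 \<le> H"
proof (rule LIMSEQ_le_const2[OF phit_lim[OF s]], intro exI allI impI)
  fix j
  interpret step_kernel V "tp (s / 2 ^ j)" \<pi> using s by (intro step_kernel) simp
  have "phit (1 * 2 ^ j) = (\<Sum>u\<in>V. \<pi> u * (\<Sum>v\<in>V. \<pi> v * pair_hit (s / 2 ^ j) (2 ^ j) (u, v)))"
    unfolding phit_def by (simp add: sum.cartesian_product' sum_distrib_left mult.assoc)
  also have "\<dots> \<le> (\<Sum>u\<in>V. \<pi> u * H)" by (intro sum_mono mult_left_mono H pi_nonneg)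
  also have "\<dots> = H" by (simp add: pi_sum flip: sum_distrib_right)
  finally show "phit (1 * 2 ^ j) \<le> H" .
qed

lemma pi_max_ge: "v \<in> V \<Longrightarrow> \<pi> v \<le> pi_max V \<pi>"
  unfolding pi_max_def using finV by (intro Max_ge) auto

lemma pi_max_pos: "0 < pi_max V \<pi>"
proof -
  obtain v where "v \<in> V" "0 < \<pi> v"
    using pi_sum pi_nonneg by (metis less_eq_real_def sum.neutral zero_neq_one)
  then show ?thesis using pi_max_ge[of v] by linarith
qed

text \<open>\<open>avg_hit_pair_le\<close> with a holding period of about 1 / (4 q_max): the bound
  is twice the ratio of \<open>s\<close> plus the holding period to the holding period, times
  \<open>pi_max\<close>. This ratio is independent of the mesh.\<close>

lemma avg_pair_hit_le_pi_max:
  assumes s: "0 < s" and u: "u \<in> V"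
  shows "(\<Sum>v\<in>V. \<pi> v * pair_hit (s / 2 ^ j) (2 ^ j) (u, v)) \<le> 2 * (1 + 4 * q_max V q * s) * pi_max V \<pi>"
proof -
  define h where "h = s / 2 ^ j"
  have h: "0 < h" using s by (simp add: h_def)
  interpret step_kernel V "tp h" \<pi> using h by (intro step_kernel) simp
  let ?S = "\<Sum>v\<in>V. \<pi> v * pair_hit h (2 ^ j) (u, v)"
  let ?q = "q_max V q"
  have M0: "0 \<le> pi_max V \<pi>" using pi_max_pos by simp
  have S0: "0 \<le> ?S" using u pair.surv_bounds pi_nonneg by (intro sum_nonneg mult_nonneg_nonneg) auto
  have q: "0 < ?q" by (rule q_max_pos)
  \<comment> \<open>The first \<open>w - 1\<close> steps take time at most 1 / (4 q_max). Up to then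
    each chain is at its starting point with probability at least 3/4, and (3/4)^2 >= 1/2.\<close>
  define w where "w = nat (\<lfloor>1 / (4 * ?q * h)\<rfloor> + 1)"
  have rw: "real w = of_int \<lfloor>1 / (4 * ?q * h)\<rfloor> + 1" unfolding w_def using q h by simp
  have w: "1 / (4 * ?q * h) \<le> real w" "real w - 1 \<le> 1 / (4 * ?q * h)" unfolding rw by linarith+
  have w0: "0 < real w" using less_le_trans[OF _ w(1), of 0] q h by simp
  have w1: "4 * ?q * h * (real w - 1) \<le> 1" using w(2) q h by (simp add: field_simps)
  have w2: "2 ^ j \<le> real w * (4 * ?q * s)" using w(1) q s by (simp add: field_simps h_def)
  have stay: "1 / 2 \<le> (steps V (tp h) i z z)\<^sup>2" if "i < w" "z \<in> V" for i z
  proof -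
    have "4 * ?q * h * real i \<le> 4 * ?q * h * (real w - 1)"
      using that h q_max_nonneg by (intro mult_left_mono) auto
    then have "3 / 4 \<le> 1 - ?q * (real i * h)" using w1 by (simp add: mult_ac)
    also have "\<dots> \<le> steps V (tp h) i z z"
      using tp_stay[OF that(2), of "real i * h"] steps_tp[OF _ that(2,2), of h i] h by simp
    finally have "(3 / 4)\<^sup>2 \<le> (steps V (tp h) i z z)\<^sup>2" by (intro power_mono) auto
    then show ?thesis by (simp add: power2_eq_square)
  qed
  have "?S * (real w / 2) \<le> real (2 ^ j + w) * pi_max V \<pi>"
    by (rule avg_hit_pair_le[OF stay pi_max_ge u])
  also have "\<dots> \<le> (real w * (1 + 4 * ?q * s)) * pi_max V \<pi>"
    using w2 M0 by (intro mult_right_mono) (simp_all add: algebra_simps)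
  finally have "real w * ?S \<le> real w * (2 * (1 + 4 * ?q * s) * pi_max V \<pi>)" by (simp add: algebra_simps)
  then show ?thesis unfolding h_def[symmetric] using w0 by simp
qed

text \<open>With probability at least \<open>1 - 2 * q_max * s\<close> neither of the two chains jumps before time \<open>s\<close>.\<close>

lemma phi_2_1_ge:
  assumes s: "0 < s"
  shows "(1 - (\<Sum>x\<in>V. (\<pi> x)\<^sup>2)) - 2 * q_max V q * s \<le> phi 2 s 1"
proof (rule LIMSEQ_le_const[OF phi_lim[OF s]], intro exI allI impI)
  fix j
  define h where "h = s / 2 ^ j"
  have h: "0 < h" using s by (simp add: h_def)
  interpret step_kernel V "tp h" \<pi> using h by (intro step_kernel) simp
  let ?q = "q_max V q"
  have ge: "1 - 2 * ?q * h * real n \<le> surv (V \<times> V) (pairK (tp h)) diag n z" if z: "z \<in> V \<times> V" "z \<notin> diag" for n z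
  proof (induction n)
    case (Suc n)
    let ?s = "surv (V \<times> V) (pairK (tp h)) diag n z"
    have s01: "0 \<le> ?s" "?s \<le> 1" using pair.surv_bounds[OF z(1)] by auto
    have stay: "1 - ?q * h \<le> tp h (fst z) (fst z)" "1 - ?q * h \<le> tp h (snd z) (snd z)"
      "tp h (fst z) (fst z) \<le> 1" "tp h (snd z) (snd z) \<le> 1"
      using z h tp_stay tp_le_1 by (auto simp: mem_Times_iff)
    have "0 \<le> (1 - tp h (fst z) (fst z)) * (1 - tp h (snd z) (snd z))"
      using stay by (intro mult_nonneg_nonneg) auto
    then have pk: "1 - 2 * ?q * h \<le> pairK (tp h) z z"
      using stay unfolding pairK_def by (simp add: algebra_simps)
    have "1 - 2 * ?q * h * real (Suc n) \<le> ?s - (1 - pairK (tp h) z z)"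
      using Suc pk by (simp add: algebra_simps)
    also have "\<dots> \<le> pairK (tp h) z z * ?s"
    proof -
      have "pairK (tp h) z z \<le> 1"
        using member_le_sum[of z "V \<times> V" "pairK (tp h) z"] pair.K_sum[OF z(1)] pair.K_nonneg[OF z(1)] z pair.fin by auto
      then have "0 \<le> (1 - pairK (tp h) z z) * (1 - ?s)" using s01 by (intro mult_nonneg_nonneg) auto
      then show ?thesis by (simp add: algebra_simps)
    qed
    also have "\<dots> \<le> kop (V \<times> V) (pairK (tp h)) (surv (V \<times> V) (pairK (tp h)) diag n) z"
      unfolding kop_def using z pair.fin pair.K_nonneg[OF z(1)] pair.surv_bounds
      by (intro member_le_sum mult_nonneg_nonneg) auto
    finally show ?case using z by simp
  qed simp
  have "phit (2 ^ j) \<le> (\<Sum>z\<in>V \<times> V. \<pi> (fst z) * \<pi> (snd z) * (2 * ?q * s + (if z \<in> diag then 1 else 0)))"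
    unfolding phit_def
  proof (intro sum_mono mult_left_mono)
    fix z assume z: "z \<in> V \<times> V"
    show "pair_hit h (2 ^ j) z \<le> 2 * ?q * s + (if z \<in> diag then 1 else 0)"
    proof (cases "z \<in> diag")
      case True
      have "0 \<le> surv (V \<times> V) (pairK (tp h)) diag (2 ^ j) z" using pair.surv_bounds[OF z] by blast
      moreover have "0 \<le> 2 * ?q * s" using q_max_nonneg s by simp
      ultimately show ?thesis unfolding if_P[OF True] by linarith
    next
      case False
      have "h * real (2 ^ j) = s" by (simp add: h_def)
      then have "2 * ?q * h * real (2 ^ j) = 2 * ?q * s" by (simp only: mult.assoc)
      then show ?thesis using ge[OF z False, of "2 ^ j"] unfolding if_not_P[OF False] by linarith
    qed
    show "0 \<le> \<pi> (fst z) * \<pi> (snd z)" using z pi_nonneg by auto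
  qed
  also have "\<dots> = 2 * ?q * s * (\<Sum>z\<in>V \<times> V. \<pi> (fst z) * \<pi> (snd z)) +
      (\<Sum>z\<in>V \<times> V. \<pi> (fst z) * \<pi> (snd z) * (if z \<in> diag then 1 else 0))"
    by (simp only: distrib_left sum.distrib sum_distrib_left mult_ac)
  also have "(\<Sum>z\<in>V \<times> V. \<pi> (fst z) * \<pi> (snd z)) = 1"
    by (simp add: sum.cartesian_product' pi_sum flip: sum_distrib_left)
  also have "(\<Sum>z\<in>V \<times> V. \<pi> (fst z) * \<pi> (snd z) * (if z \<in> diag then 1 else 0)) =
      (\<Sum>x\<in>V. \<Sum>y\<in>V. if x = y then \<pi> x * \<pi> y else 0)"
    unfolding sum.cartesian_product' by (intro sum.cong refl) (simp add: diag_def)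
  also have "\<dots> = (\<Sum>x\<in>V. (\<pi> x)\<^sup>2)"
    using finV by (intro sum.cong refl) (simp add: power2_eq_square)
  finally show "(1 - (\<Sum>x\<in>V. (\<pi> x)\<^sup>2)) - 2 * q_max V q * s \<le> (\<Sum>x\<in>tuples 2 V. pi_prod 2 x * dsurv 2 s j 1 x)"
    using phit_eq[OF s, of j 1] unfolding h_def by simp
qed

text \<open>Two independent samples from \<pi> agree with probability
  \<open>(\<Sum>x\<in>V. (\<pi> x)\<^sup>2)\<close>, and then the meeting time is 0.\<close>

lemma phi_2_1_le: "0 < s \<Longrightarrow> phi 2 s 1 \<le> 1 - (\<Sum>x\<in>V. (\<pi> x)\<^sup>2)"
proof -
  assume s: "0 < s"
  interpret step_kernel V "tp (s / 2 ^ 0)" \<pi> using s by (intro step_kernel) simp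
  have "(\<Sum>x\<in>V. (\<pi> x)\<^sup>2) = (\<Sum>x\<in>V. \<Sum>y\<in>V. if x = y then \<pi> x * \<pi> y else 0)"
    using finV by (intro sum.cong refl) (simp add: power2_eq_square)
  also have "\<dots> = (\<Sum>z\<in>V \<times> V. \<pi> (fst z) * \<pi> (snd z) * (if z \<in> diag then 1 else 0))"
    unfolding sum.cartesian_product' by (intro sum.cong refl) (simp add: diag_def)
  also have "\<dots> \<le> phit (1 * 2 ^ 0)"
    unfolding phit_def
  proof (intro sum_mono mult_left_mono)
    fix z assume z: "z \<in> V \<times> V"
    show "(if z \<in> diag then 1 else 0) \<le> pair_hit (s / 2 ^ 0) (1 * 2 ^ 0) z"
      using pair.surv_bounds[OF z, of diag 1] by auto
    show "0 \<le> \<pi> (fst z) * \<pi> (snd z)" using z pi_nonneg by auto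
  qed
  finally show ?thesis using phi_le[OF s, of 2 1 0] phit_eq[OF s, of 0 1] by linarith
qed

text \<open>Averaged over a stationary partner, the hitting probability is preserved by the symmetry
  that carries \<open>u\<close> to any other state. Being constant in \<open>u\<close>, it equals
  its own \<pi>-average. The grid misses some collisions, hence an inequality with
  \<open>pmeet\<close>.\<close>

lemma avg_pair_hit_transitive:
  assumes s: "0 < s" and u: "u \<in> V" and tr: "transitive V q"
  shows "(\<Sum>v\<in>V. \<pi> v * pair_hit (s / 2 ^ j) (2 ^ j) (u, v)) \<le> pmeet s 1"
proof -
  define h where "h = s / 2 ^ j"
  have h: "0 < h" using s by (simp add: h_def)
  interpret step_kernel V "tp h" \<pi> using h by (intro step_kernel) simp
  let ?S = "\<lambda>u. \<Sum>v\<in>V. \<pi> v * pair_hit h (2 ^ j) (u, v)"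
  have const: "?S w = ?S u" if w: "w \<in> V" for w
  proof -
    obtain \<phi> where \<phi>: "\<phi> permutes V" "\<phi> u = w"
      "\<And>t a b. a \<in> V \<Longrightarrow> b \<in> V \<Longrightarrow> tp t (\<phi> a) (\<phi> b) = tp t a b"
      "\<And>v. v \<in> V \<Longrightarrow> \<pi> (\<phi> v) = \<pi> v"
      using transitive_invariant[OF tr u w] by blast
    have inv: "surv (V \<times> V) (pairK (tp h)) diag n (\<phi> a, \<phi> b) = surv (V \<times> V) (pairK (tp h)) diag n (a, b)"
      if "a \<in> V" "b \<in> V" for a b n
      using that
    proof (induction n arbitrary: a b)
      case (Suc n)
      let ?f = "surv (V \<times> V) (pairK (tp h)) diag n"
      have "kop (V \<times> V) (pairK (tp h)) ?f (\<phi> a, \<phi> b) = (\<Sum>c\<in>V. \<Sum>d\<in>V. tp h (\<phi> a) c * tp h (\<phi> b) d * ?f (c, d))"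
        by (simp add: kop_def pairK_def sum.cartesian_product')
      also have "\<dots> = (\<Sum>c\<in>V. \<Sum>d\<in>V. tp h (\<phi> a) (\<phi> c) * tp h (\<phi> b) (\<phi> d) * ?f (\<phi> c, \<phi> d))"
        by (subst sum.permute[OF \<phi>(1)], unfold comp_def, subst (2) sum.permute[OF \<phi>(1)], unfold comp_def, rule refl)
      also have "\<dots> = (\<Sum>c\<in>V. \<Sum>d\<in>V. tp h a c * tp h b d * ?f (c, d))"
        using Suc.prems by (intro sum.cong refl) (simp only: \<phi>(3) Suc.IH)
      also have "\<dots> = kop (V \<times> V) (pairK (tp h)) ?f (a, b)"
        by (simp add: kop_def pairK_def sum.cartesian_product')
      finally show ?case using permutes_inj[OF \<phi>(1)] by (simp add: diag_def inj_eq)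
    qed simp
    have "?S w = (\<Sum>v\<in>V. \<pi> (\<phi> v) * pair_hit h (2 ^ j) (w, \<phi> v))"
      by (subst sum.permute[OF \<phi>(1)]) (simp only: comp_def)
    also have "\<dots> = ?S u" using u by (intro sum.cong refl) (simp only: \<phi>(4) \<phi>(2)[symmetric] inv)
    finally show ?thesis .
  qed
  have "phit (1 * 2 ^ j) = (\<Sum>w\<in>V. \<pi> w * ?S w)"
    unfolding phit_def by (simp add: sum.cartesian_product' sum_distrib_left mult.assoc)
  also have "\<dots> = (\<Sum>w\<in>V. \<pi> w * ?S u)" by (intro sum.cong refl) (simp only: const)
  also have "\<dots> = ?S u" by (simp add: pi_sum flip: sum_distrib_right)
  finally have "?S u = 1 - (\<Sum>x\<in>tuples 2 V. pi_prod 2 x * dsurv 2 s j 1 x)"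
    using phit_eq[OF s, of j 1] by (simp add: h_def)
  also have "\<dots> \<le> pmeet s 1" using phi_le[OF s, of 2 1 j] by linarith
  finally show ?thesis by (simp add: h_def)
qed

lemma sum_pi_square_pos: "0 < (\<Sum>x\<in>V. (\<pi> x)\<^sup>2)"
proof -
  obtain x where x: "x \<in> V" "\<pi> x \<noteq> 0" using pi_sum by (metis sum.neutral zero_neq_one)
  then have "0 < (\<pi> x)\<^sup>2" by simp
  also have "\<dots> \<le> (\<Sum>x\<in>V. (\<pi> x)\<^sup>2)" using x finV by (intro member_le_sum) auto
  finally show ?thesis .
qed

text \<open>Transitivity makes \<pi> uniform, so the sum is 1 / |V|.\<close>

lemma sum_pi_square_transitive:
  assumes tr: "transitive V q" shows "(\<Sum>x\<in>V. (\<pi> x)\<^sup>2) < 1"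
proof -
  obtain u where u: "u \<in> V" using V_ne by blast
  have c: "\<pi> x = \<pi> u" if x: "x \<in> V" for x
  proof -
    obtain \<phi> where "\<phi> u = x" "\<And>v. v \<in> V \<Longrightarrow> \<pi> (\<phi> v) = \<pi> v"
      using transitive_invariant[OF tr u x] by blast
    then show ?thesis using u by blast
  qed
  have "(\<Sum>x\<in>V. \<pi> x) = (\<Sum>x\<in>V. \<pi> u)" by (intro sum.cong refl c)
  then have n: "real (card V) * \<pi> u = 1" by (simp add: pi_sum)
  have "(\<Sum>x\<in>V. (\<pi> x)\<^sup>2) = (\<Sum>x\<in>V. (\<pi> u)\<^sup>2)" by (intro sum.cong refl) (simp only: c)
  also have "\<dots> = (real (card V) * \<pi> u) * \<pi> u" by (simp add: power2_eq_square)
  also have "\<dots> = \<pi> u" using n by simp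
  also have "\<dots> < 1"
  proof (rule ccontr)
    assume "\<not> \<pi> u < 1"
    then have "2 * 1 \<le> real (card V) * \<pi> u" using cardV by (intro mult_mono) auto
    then show False using n by simp
  qed
  finally show ?thesis .
qed

end

subsection \<open>Arbitrary initial laws and the mean meeting time\<close>

text \<open>Together with the next lemma it encloses \<open>M\<close> between \<open>s\<close> times
  the number of multiples of \<open>s\<close> in (0, M] and in [0, M]. Integrated, this compares the
  mean meeting time with sums of survival probabilities; it is stated in \<open>ennreal\<close>
  because \<open>M\<close> may be infinite.\<close>

lemma ennreal_sum_indicator_le:
  assumes "0 \<le> s"
  shows "ennreal s * (\<Sum>n<K. indicator {z. ennreal (real (Suc n) * s) \<le> z} M) \<le> M"
proof (induction K)
  case (Suc K)
  show ?case
  proof (cases "ennreal (real (Suc K) * s) \<le> M")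
    case True
    have "(\<Sum>n<Suc K. indicator {z. ennreal (real (Suc n) * s) \<le> z} M) \<le> (\<Sum>n<Suc K. 1 :: ennreal)"
      by (intro sum_mono) (simp add: indicator_def)
    also have "\<dots> = ennreal (real (Suc K))" by (simp add: ennreal_of_nat_eq_real_of_nat)
    finally have "ennreal s * (\<Sum>n<Suc K. indicator {z. ennreal (real (Suc n) * s) \<le> z} M) \<le> ennreal s * ennreal (real (Suc K))"
      by (intro mult_left_mono) auto
    also have "\<dots> = ennreal (real (Suc K) * s)" using assms by (simp add: ennreal_mult' mult.commute)
    finally show ?thesis using True by (rule order.trans)
  qed (use Suc in simp)
qed simp

lemma ennreal_le_sum_indicator:
  assumes "0 < s"
  shows "M \<le> ennreal s * (\<Sum>n. indicator {z. ennreal (real n * s) \<le> z} M)"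
proof -
  let ?R = "ennreal s * (\<Sum>n. indicator {z. ennreal (real n * s) \<le> z} M)"
  have partial: "min M (ennreal (real K * s)) \<le> ennreal s * (\<Sum>n<K. indicator {z. ennreal (real n * s) \<le> z} M)" for K
  proof (induction K)
    case (Suc K)
    show ?case
    proof (cases "ennreal (real K * s) \<le> M")
      case True
      have "ennreal (real n * s) \<le> M" if "n < Suc K" for n
      proof -
        have "real n * s \<le> real K * s" using that assms by (intro mult_right_mono) auto
        then show ?thesis using True ennreal_leI order.trans by blast
      qed
      then have "(\<Sum>n<Suc K. indicator {z. ennreal (real n * s) \<le> z} M) = (\<Sum>n<Suc K. 1 :: ennreal)"
        by (intro sum.cong) auto
      also have "\<dots> = ennreal (real (Suc K))" by (simp add: ennreal_of_nat_eq_real_of_nat)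
      finally have "ennreal s * (\<Sum>n<Suc K. indicator {z. ennreal (real n * s) \<le> z} M) = ennreal (real (Suc K) * s)"
        using assms by (simp add: ennreal_mult' mult.commute del: sum.lessThan_Suc)
      then show ?thesis by (simp del: sum.lessThan_Suc)
    next
      case False
      then have "M \<le> ennreal (real K * s)" by (meson linear)
      then have "min M (ennreal (real (Suc K) * s)) \<le> min M (ennreal (real K * s))"
        by (simp only: min_absorb1 min.cobounded1)
      also note Suc
      also have "ennreal s * (\<Sum>n<K. indicator {z. ennreal (real n * s) \<le> z} M) \<le>
          ennreal s * (\<Sum>n<Suc K. indicator {z. ennreal (real n * s) \<le> z} M)"
        by (intro mult_left_mono) auto
      finally show ?thesis .
    qed
  qed simp
  have le: "min M (ennreal (real K * s)) \<le> ?R" for K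
    by (rule order.trans[OF partial]) (intro mult_left_mono sum_le_suminf, auto)
  show ?thesis
  proof (rule ccontr)
    assume "\<not> ?thesis"
    then have lt: "?R < M" by simp
    then obtain r where r: "?R = ennreal r" "0 \<le> r" by (cases ?R) auto
    obtain K :: nat where "r / s < real K" using reals_Archimedean2 by blast
    then have "r < real K * s" using assms by (simp add: field_simps)
    then have "?R < ennreal (real K * s)" unfolding r(1) using r(2) by (simp add: ennreal_lessI)
    then show False using le[of K] lt by (simp add: min_def split: if_splits)
  qed
qed

context mixing_chain
begin

lemma initial_law_sum:
  assumes "initial_law V k \<Lambda>"
  shows "(\<Sum>x\<in>tuples k V. measure \<Lambda> {x}) = 1"
proof -
  interpret prob_space \<Lambda> using assms by (simp add: initial_law_def)
  have s: "sets \<Lambda> = Pow (tuples k V)" using assms by (simp add: initial_law_def)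
  have sp: "space \<Lambda> = tuples k V" using sets_eq_imp_space_eq[of \<Lambda> "count_space (tuples k V)"] s by simp
  have "(\<Sum>x\<in>tuples k V. prob {x}) = prob (\<Union>x\<in>tuples k V. {x})"
    using s by (intro finite_measure_finite_Union[symmetric] finite_tuples) (auto simp: disjoint_family_on_def)
  also have "(\<Union>x\<in>tuples k V. {x}) = space \<Lambda>" by (simp add: sp)
  finally show ?thesis by (simp add: prob_space)
qed

text \<open>The initial space is finite and carries its full power set, so every kernel on it is
  measurable and \<open>bind\<close> is a finite mixture.\<close>

lemma indep_chains:
  assumes \<Lambda>: "initial_law V k \<Lambda>"
  shows prob_space_indep_chains: "prob_space (indep_chains k P \<Lambda>)"
    and sets_indep_chains: "sets (indep_chains k P \<Lambda>) = sets (Pi\<^sub>M {..<k} (\<lambda>_. path_space V))"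
    and measure_indep_chains: "\<And>A. A \<in> sets (Pi\<^sub>M {..<k} (\<lambda>_. path_space V)) \<Longrightarrow>
      measure (indep_chains k P \<Lambda>) A = (\<Sum>x\<in>tuples k V. measure \<Lambda> {x} * measure (PP k x) A)"
proof -
  interpret prob_space \<Lambda> using \<Lambda> by (simp add: initial_law_def)
  have s: "sets \<Lambda> = sets (count_space (tuples k V))" using \<Lambda> by (simp add: initial_law_def)
  have sp: "space \<Lambda> = tuples k V" using sets_eq_imp_space_eq[OF s] by simp
  let ?N = "Pi\<^sub>M {..<k} (\<lambda>_. path_space V)"
  have K: "PP k \<in> measurable \<Lambda> (subprob_algebra ?N)"
    unfolding measurable_cong_sets[OF s refl] measurable_count_space_eq1
    using prob_space_PP sets_PP by (auto simp: space_subprob_algebra prob_space_imp_subprob_space)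
  show "prob_space (indep_chains k P \<Lambda>)"
    unfolding indep_chains_def
    by (rule prob_space_bind[OF _ K]) (use sp prob_space_PP in \<open>auto intro!: AE_I2\<close>)
  then interpret L: prob_space "indep_chains k P \<Lambda>" .
  show "sets (indep_chains k P \<Lambda>) = sets ?N"
    unfolding indep_chains_def using not_empty sets_PP sp by (intro sets_bind) auto
  fix A assume A: "A \<in> sets ?N"
  have "emeasure (indep_chains k P \<Lambda>) A = (\<integral>\<^sup>+ x. emeasure (PP k x) A \<partial>\<Lambda>)"
    unfolding indep_chains_def by (rule emeasure_bind[OF not_empty K A])
  also have "\<dots> = (\<integral>\<^sup>+ x. (\<Sum>y\<in>tuples k V. ennreal (measure (PP k y) A) * indicator {y} x) \<partial>\<Lambda>)"
  proof (intro nn_integral_cong)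
    fix x assume "x \<in> space \<Lambda>"
    then have x: "x \<in> tuples k V" by (simp add: sp)
    interpret X: prob_space "PP k x" by (rule prob_space_PP[OF x])
    have "(\<Sum>y\<in>tuples k V. ennreal (measure (PP k y) A) * indicator {y} x) =
      (\<Sum>y\<in>tuples k V. if y = x then ennreal (measure (PP k y) A) else 0)"
      by (intro sum.cong) (auto simp: indicator_def)
    also have "\<dots> = emeasure (PP k x) A" using x finite_tuples by (simp add: X.emeasure_eq_measure)
    finally show "emeasure (PP k x) A = (\<Sum>y\<in>tuples k V. ennreal (measure (PP k y) A) * indicator {y} x)" by simp
  qed
  also have "\<dots> = (\<Sum>y\<in>tuples k V. \<integral>\<^sup>+ x. ennreal (measure (PP k y) A) * indicator {y} x \<partial>\<Lambda>)"
    by (rule nn_integral_sum) (simp add: measurable_cong_sets[OF s refl])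
  also have "\<dots> = (\<Sum>y\<in>tuples k V. ennreal (measure (PP k y) A) * emeasure \<Lambda> {y})"
    by (intro sum.cong refl nn_integral_cmult_indicator) (simp add: s)
  also have "\<dots> = (\<Sum>y\<in>tuples k V. ennreal (measure \<Lambda> {y} * measure (PP k y) A))"
    by (intro sum.cong refl) (simp only: emeasure_eq_measure ennreal_mult[OF measure_nonneg measure_nonneg] mult.commute)
  also have "\<dots> = ennreal (\<Sum>x\<in>tuples k V. measure \<Lambda> {x} * measure (PP k x) A)"
    by (intro sum_ennreal mult_nonneg_nonneg measure_nonneg)
  finally show "measure (indep_chains k P \<Lambda>) A = (\<Sum>x\<in>tuples k V. measure \<Lambda> {x} * measure (PP k x) A)"
    by (intro measure_eq_emeasure_eq_ennreal sum_nonneg) auto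
qed

lemma measurable_meeting_time_indep:
  assumes "initial_law V k \<Lambda>"
  shows "meeting_time k \<in> borel_measurable (indep_chains k P \<Lambda>)"
  using measurable_meeting_time[OF finV, of k]
  unfolding measurable_cong_sets[OF sets_indep_chains[OF assms] refl] .

lemma measure_meeting_ge:
  assumes "initial_law V k \<Lambda>"
  shows "measure (indep_chains k P \<Lambda>) {\<omega> \<in> space (indep_chains k P \<Lambda>). ennreal (real N * s) \<le> meeting_time k \<omega>} =
    (\<Sum>x\<in>tuples k V. measure \<Lambda> {x} * G k s N x)"
proof -
  let ?N = "Pi\<^sub>M {..<k} (\<lambda>_. path_space V)"
  have sp: "space (indep_chains k P \<Lambda>) = space ?N" by (rule sets_eq_imp_space_eq[OF sets_indep_chains[OF assms]])
  have A: "{\<omega> \<in> space ?N. ennreal (real N * s) \<le> meeting_time k \<omega>} \<in> sets ?N"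
    using measurable_meeting_time[OF finV, of k] by measurable
  show ?thesis unfolding sp measure_indep_chains[OF assms A] G_def
    by (intro sum.cong refl) (simp only: space_PP)
qed

lemma pi_prod_2: "pi_prod 2 x = \<pi> (x 0) * \<pi> (x 1)"
  by (simp add: pi_prod_def numeral_2_eq_2)

lemma initial_law_stationary_pair: "initial_law V 2 (stationary_pair V \<pi>)"
  and measure_stationary_pair: "x \<in> tuples 2 V \<Longrightarrow> measure (stationary_pair V \<pi>) {x} = pi_prod 2 x"
proof -
  have eq: "stationary_pair V \<pi> = point_measure (tuples 2 V) (\<lambda>x. ennreal (pi_prod 2 x))"
    by (simp add: stationary_pair_def pi_prod_2)
  show "initial_law V 2 (stationary_pair V \<pi>)"
    unfolding initial_law_def
  proof
    show "prob_space (stationary_pair V \<pi>)"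
    proof
      have "(\<Sum>x\<in>tuples 2 V. ennreal (pi_prod 2 x)) = ennreal (\<Sum>x\<in>tuples 2 V. pi_prod 2 x)"
        using pi_prod_nonneg by (intro sum_ennreal) auto
      then show "emeasure (stationary_pair V \<pi>) (space (stationary_pair V \<pi>)) = 1"
        unfolding eq space_point_measure by (subst emeasure_point_measure_finite[OF finite_tuples]) (auto simp: pi_prod_sum)
    qed
  qed (simp add: stationary_pair_def sets_point_measure)
  assume x: "x \<in> tuples 2 V"
  then have "emeasure (stationary_pair V \<pi>) {x} = ennreal (pi_prod 2 x)"
    unfolding eq by (subst emeasure_point_measure_finite[OF finite_tuples]) auto
  then show "measure (stationary_pair V \<pi>) {x} = pi_prod 2 x"
    using pi_prod_nonneg[OF x] by (rule measure_eq_emeasure_eq_ennreal[rotated])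
qed

section \<open>The mean meeting time as a sum of survival probabilities\<close>

abbreviation "mean_int \<equiv> \<integral>\<^sup>+ \<omega>. meeting_time 2 \<omega> \<partial>indep_chains 2 P (stationary_pair V \<pi>)"

lemma mean_int_indicator:
  "(\<integral>\<^sup>+ \<omega>. indicator {z. ennreal (real N * s) \<le> z} (meeting_time 2 \<omega>) \<partial>indep_chains 2 P (stationary_pair V \<pi>)) = ennreal (phi 2 s N)"
proof -
  let ?L = "indep_chains 2 P (stationary_pair V \<pi>)"
  note il = initial_law_stationary_pair
  interpret L: prob_space ?L by (rule prob_space_indep_chains[OF il])
  note [measurable] = measurable_meeting_time_indep[OF il]
  let ?A = "{\<omega> \<in> space ?L. ennreal (real N * s) \<le> meeting_time 2 \<omega>}"
  have "(\<integral>\<^sup>+ \<omega>. indicator {z. ennreal (real N * s) \<le> z} (meeting_time 2 \<omega>) \<partial>?L) = (\<integral>\<^sup>+ \<omega>. indicator ?A \<omega> \<partial>?L)"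
    by (intro nn_integral_cong) (simp add: indicator_def)
  also have "\<dots> = emeasure ?L ?A" by (intro nn_integral_indicator) measurable
  also have "\<dots> = ennreal (phi 2 s N)"
    unfolding L.emeasure_eq_measure measure_meeting_ge[OF il] phi_def
    by (intro arg_cong[where f=ennreal] sum.cong refl) (simp only: measure_stationary_pair)
  finally show ?thesis .
qed

lemma mean_int_ge: "0 \<le> s \<Longrightarrow> ennreal (s * (\<Sum>n<K. phi 2 s (Suc n))) \<le> mean_int"
proof -
  assume s: "0 \<le> s"
  let ?L = "indep_chains 2 P (stationary_pair V \<pi>)"
  note [measurable] = measurable_meeting_time_indep[OF initial_law_stationary_pair]
  have "ennreal (s * (\<Sum>n<K. phi 2 s (Suc n))) = ennreal s * (\<Sum>n<K. ennreal (phi 2 s (Suc n)))"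
    using s phi_bounds by (simp add: ennreal_mult' sum_ennreal)
  also have "\<dots> = ennreal s * (\<Sum>n<K. \<integral>\<^sup>+ \<omega>. indicator {z. ennreal (real (Suc n) * s) \<le> z} (meeting_time 2 \<omega>) \<partial>?L)"
    by (simp only: mean_int_indicator)
  also have "\<dots> = (\<integral>\<^sup>+ \<omega>. ennreal s * (\<Sum>n<K. indicator {z. ennreal (real (Suc n) * s) \<le> z} (meeting_time 2 \<omega>)) \<partial>?L)"
    by (subst nn_integral_cmult, measurable) (subst nn_integral_sum, measurable)
  also have "\<dots> \<le> mean_int"
    by (intro nn_integral_mono ennreal_sum_indicator_le s)
  finally show ?thesis .
qed

lemma mean_int_le:
  assumes s: "0 < s" and sm: "summable (phi 2 s)"
  shows "mean_int \<le> ennreal (s * (\<Sum>n. phi 2 s n))"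
proof -
  let ?L = "indep_chains 2 P (stationary_pair V \<pi>)"
  note [measurable] = measurable_meeting_time_indep[OF initial_law_stationary_pair]
  have "mean_int \<le> (\<integral>\<^sup>+ \<omega>. ennreal s * (\<Sum>n. indicator {z. ennreal (real n * s) \<le> z} (meeting_time 2 \<omega>)) \<partial>?L)"
    by (intro nn_integral_mono ennreal_le_sum_indicator s)
  also have "\<dots> = ennreal s * (\<Sum>n. \<integral>\<^sup>+ \<omega>. indicator {z. ennreal (real n * s) \<le> z} (meeting_time 2 \<omega>) \<partial>?L)"
    by (subst nn_integral_cmult, measurable) (subst nn_integral_suminf, measurable)
  also have "\<dots> = ennreal s * (\<Sum>n. ennreal (phi 2 s n))" by (simp only: mean_int_indicator)
  also have "\<dots> = ennreal (s * (\<Sum>n. phi 2 s n))"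
    unfolding suminf_ennreal2[OF phi_bounds(1) sm] using s by (intro ennreal_mult'[symmetric]) simp
  finally show ?thesis .
qed

lemma phi_upper: "0 < s \<Longrightarrow> mixed s d \<Longrightarrow> phi k s (n + (1 + N)) \<le> phi k s n * (phi k s N + real k * d)"
proof -
  assume s: "0 < s" and d: "mixed s d"
  have "phi k s (n + (1 + N)) \<le> (\<Sum>x\<in>tuples k V. pi_prod k x * (G k s n x * (phi k s N + real k * d)))"
    unfolding phi_def[of k s "n + (1 + N)"] by (intro sum_mono mult_left_mono G_upper pi_prod_nonneg s d)
  then show ?thesis by (simp add: phi_def[of k s n] sum_distrib_right mult.assoc)
qed

lemma phi_lower:
  assumes s: "0 < s" and d: "mixed s d"
  shows "phi k s (n + 1) * (phi k s N - real k * d) - phi k s n * (1 - phi k s 1 + real k * d)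
    \<le> phi k s (n + 1 + (1 + N))"
proof -
  have "(\<Sum>x\<in>tuples k V. pi_prod k x * (G k s (n + 1) x * (phi k s N - real k * d) - G k s n x * (1 - phi k s 1 + real k * d)))
     \<le> phi k s (n + 1 + (1 + N))"
    unfolding phi_def[of k s "n + 1 + (1 + N)"] by (intro sum_mono mult_left_mono G_lower pi_prod_nonneg s d)
  then show ?thesis
    by (simp only: phi_def[of k s "n + 1"] phi_def[of k s n] right_diff_distrib sum_subtractf
        sum_distrib_right mult.assoc)
qed

lemma G_0: "x \<in> tuples k V \<Longrightarrow> G k s 0 x = 1"
  unfolding G_def using prob_space.prob_space[OF prob_space_PP] by simp

lemma phi_0: "phi k s 0 = 1"
  unfolding phi_def using pi_prod_sum[of k] by (simp add: G_0)

lemma G_antimono: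
  assumes x: "x \<in> tuples k V" and "0 \<le> s" "m \<le> n"
  shows "G k s n x \<le> G k s m x"
proof -
  interpret prob_space "PP k x" by (rule prob_space_PP[OF x])
  have "real m * s \<le> real n * s" using assms by (intro mult_right_mono) auto
  then have "ennreal (real m * s) \<le> ennreal (real n * s)" by (rule ennreal_leI)
  moreover have "{\<omega> \<in> space (PP k x). ennreal (real m * s) \<le> meeting_time k \<omega>} \<in> events"
    using measurable_meeting_time[OF finV, of k] unfolding measurable_cong_sets[OF sets_PP[OF x, symmetric] refl]
    by measurable
  ultimately show ?thesis
    unfolding G_def by (intro finite_measure_mono) auto
qed

lemma phi_antimono: "0 \<le> s \<Longrightarrow> m \<le> n \<Longrightarrow> phi k s n \<le> phi k s m"
  unfolding phi_def by (intro sum_mono mult_left_mono G_antimono pi_prod_nonneg)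

text \<open>Two windows cost a fixed proportion of the survival probability:
  \<open>phi_2_1_le\<close> takes away \<open>c\<close>, and the mixing error of two chains gives
  back only \<open>c / 2\<close>. Without finiteness \<open>enn2real\<close> would report an
  infinite mean as 0.\<close>

lemma mean_int_finite: "mean_int < \<infinity>"
proof -
  define c where "c = (\<Sum>x\<in>V. (\<pi> x)\<^sup>2)"
  have c: "0 < c" unfolding c_def by (rule sum_pi_square_pos)
  obtain s where s: "0 < s" "mixed s (c / 4)"
    using eventually_conj[OF eventually_gt_at_top[of 0] eventually_mixed[of "c / 4"]] c
    by (auto simp: eventually_at_top_linorder)
  define x where "x = phi 2 s 1 + 2 * (c / 4)"
  have x: "x \<le> 1 - c / 2" unfolding x_def using phi_2_1_le[OF s(1)] by (simp add: c_def)
  have x0: "0 \<le> x" unfolding x_def using phi_bounds[of 2 s 1] c by simp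
  have step: "phi 2 s (n + 2) \<le> phi 2 s n * x" for n
    using phi_upper[OF s, of 2 n 1] by (simp add: x_def numeral_2_eq_2)
  \<comment> \<open>The partial sums satisfy S(K) <= S(K + 2) <= 2 + (1 - c/2) S(K), which is solved
    for S(K).\<close>
  have bound: "(\<Sum>n<K. phi 2 s n) \<le> 4 / c" for K
  proof -
    let ?S = "\<lambda>K. \<Sum>n<K. phi 2 s n"
    have "?S (K + 2) = phi 2 s 0 + phi 2 s 1 + (\<Sum>n<K. phi 2 s (n + 2))"
      by (simp add: sum.lessThan_Suc_shift numeral_2_eq_2 del: sum.lessThan_Suc)
    also have "\<dots> \<le> 2 + (\<Sum>n<K. phi 2 s n * x)"
      using step phi_bounds[of 2 s 0] phi_bounds[of 2 s 1] by (intro add_mono sum_mono) auto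
    also have "\<dots> = 2 + x * ?S K" by (simp add: sum_distrib_left mult.commute)
    also have "\<dots> \<le> 2 + (1 - c / 2) * ?S K"
      using x phi_bounds by (intro add_left_mono mult_right_mono sum_nonneg) auto
    finally have "?S (K + 2) \<le> 2 + (1 - c / 2) * ?S K" .
    moreover have "?S K \<le> ?S (K + 2)" using phi_bounds by (intro sum_mono2) auto
    ultimately have "(c / 2) * ?S K \<le> 2" by (simp add: algebra_simps)
    then show ?thesis using c by (simp add: field_simps)
  qed
  have "summable (phi 2 s)"
    by (rule summableI_nonneg_bounded[OF _ bound]) (rule phi_bounds)
  then show ?thesis using mean_int_le[OF s(1)] by (simp add: le_less_trans)
qed

abbreviation "m_Q \<equiv> mean_meeting V \<pi> P"

lemma m_Q_nonneg: "0 \<le> m_Q" and mean_int_eq: "mean_int = ennreal m_Q"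
  using mean_int_finite by (simp_all add: mean_meeting_def)

lemma m_Q_ge: "0 \<le> s \<Longrightarrow> s * (\<Sum>n<K. phi 2 s (Suc n)) \<le> m_Q"
  using mean_int_ge[of s K] m_Q_nonneg unfolding mean_int_eq by (simp only: ennreal_le_iff)

lemma summable_phi:
  assumes s: "0 < s" shows "summable (phi 2 s)"
proof -
  have "summable (\<lambda>n. phi 2 s (Suc n))"
  proof (rule summableI_nonneg_bounded)
    fix K show "(\<Sum>n<K. phi 2 s (Suc n)) \<le> m_Q / s"
      using m_Q_ge[of s K] s by (simp add: field_simps)
  qed (rule phi_bounds)
  then show ?thesis by (simp only: summable_Suc_iff)
qed

lemma m_Q_le: "0 < s \<Longrightarrow> m_Q \<le> s * (\<Sum>n. phi 2 s n)"
proof -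
  assume s: "0 < s"
  have "0 \<le> s * (\<Sum>n. phi 2 s n)" using s phi_bounds by (intro mult_nonneg_nonneg suminf_nonneg summable_phi) auto
  then show ?thesis
    using mean_int_le[OF s summable_phi[OF s]] unfolding mean_int_eq by (simp only: ennreal_le_iff)
qed

lemma suminf_phi_le:
  assumes s: "0 < s" shows "s * ((\<Sum>n. phi 2 s n) - 1) \<le> m_Q"
proof -
  have "(\<Sum>n. phi 2 s (Suc n)) \<le> m_Q / s"
  proof (rule suminf_le_const)
    show "summable (\<lambda>n. phi 2 s (Suc n))" using summable_phi[OF s] by (simp only: summable_Suc_iff)
    fix K show "(\<Sum>n<K. phi 2 s (Suc n)) \<le> m_Q / s"
      using m_Q_ge[of s K] s by (simp add: field_simps)
  qed
  then have "(\<Sum>n. phi 2 s n) - 1 \<le> m_Q / s" using suminf_split_head[OF summable_phi[OF s]] by (simp add: phi_0)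
  then show ?thesis using s by (simp add: field_simps)
qed

text \<open>The chains start apart with probability \<open>c\<close>, and for the chosen
  \<open>s\<close> some chain jumps before \<open>s\<close> with probability at most
  \<open>c / 2\<close>.\<close>

lemma m_Q_pos:
  assumes "(\<Sum>x\<in>V. (\<pi> x)\<^sup>2) < 1"
  shows "0 < m_Q"
proof -
  define c where "c = 1 - (\<Sum>x\<in>V. (\<pi> x)\<^sup>2)"
  have c: "0 < c" using assms by (simp add: c_def)
  define s where "s = c / (4 * q_max V q)"
  have s: "0 < s" using c q_max_pos by (simp add: s_def)
  have "2 * q_max V q * s = c / 2" using q_max_pos by (simp add: s_def)
  then have "c / 2 \<le> phi 2 s 1" using phi_2_1_ge[OF s] by (simp add: c_def)
  moreover have "s * phi 2 s 1 \<le> m_Q" using m_Q_ge[of s 1] s by simp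
  moreover have "0 < s * (c / 2)" using s c by simp
  ultimately show ?thesis using s mult_left_mono[of "c / 2" "phi 2 s 1" s] by linarith
qed

end

subsection \<open>Approximately exponential tails\<close>

text \<open>Used with \<open>z = s / m\<close>, \<open>y = N * z\<close>, and \<open>p\<close>, \<open>P\<close>, \<open>P1\<close> the probabilities that two stationary chains
  meet before \<open>N * s\<close>, and that \<open>k\<close> stationary chains meet before \<open>N * s\<close> and before \<open>s\<close>. Survival of
  a block has probability between \<open>1 - w\<close> and \<open>1 - a\<close>.\<close>

lemma block_estimates:
  fixes e k l y z p H P P1 :: real
  assumes e: "0 < e" and k: "2 \<le> k" and l: "2 * l = k * (k - 1)"
    and small: "k\<^sup>2 * e \<le> 1 / 1000"
    and y: "e \<le> y" "y \<le> e + e\<^sup>2" and z: "0 \<le> z" "z \<le> e\<^sup>2"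
    and p: "p \<le> y * (1 + 5 * e)" "y * (1 - 16 * e) \<le> p"
    and H: "H \<le> 6 * e\<^sup>2" and P: "P \<le> l * p" "l * p - l\<^sup>2 * (p * (H + p + 2 * e\<^sup>2)) \<le> P"
    and P1: "0 \<le> P" "0 \<le> P1" "P1 \<le> l * (6 * e\<^sup>2)"
  defines "b \<equiv> 20 * (k\<^sup>2 * e)"
  defines "a \<equiv> P - k * (2 * e\<^sup>2)" and "w \<equiv> P + 3 * (k * (2 * e\<^sup>2) + P1)"
  shows "l * (y + z) \<le> a * (1 + b)" "0 \<le> a" "2 * a \<le> b" "a \<le> 1"
    and "0 \<le> w" "w \<le> 1 / 2" "(w + 2 * w\<^sup>2) * (1 - b) \<le> l * y" "w + 2 * w\<^sup>2 \<le> b"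
    and "3 * (k * (2 * e\<^sup>2) + P1) \<le> 1 / 2"
proof -
  define \<kappa> where "\<kappa> = k\<^sup>2 * e"
  have \<kappa>: "0 < \<kappa>" "\<kappa> \<le> 1 / 1000" using e k small by (auto simp: \<kappa>_def)
  have k2: "4 \<le> k\<^sup>2" using power_mono[OF k, of 2] by simp
  have e\<kappa>: "4 * e \<le> \<kappa>" using k2 e by (simp add: \<kappa>_def mult_right_mono)
  have "2 * 1 \<le> k * (k - 1)" using k by (intro mult_mono) auto
  then have l1: "1 \<le> l" using l by simp
  have kl: "k \<le> 2 * l" using k l mult_left_mono[of 1 "k - 1" k] by simp
  have "2 * l \<le> k\<^sup>2" using l k by (simp add: power2_eq_square algebra_simps)
  then have le: "2 * (l * e) \<le> \<kappa>" using mult_right_mono[of "2 * l" "k\<^sup>2" e] e by (simp add: \<kappa>_def)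
  have ee: "e\<^sup>2 \<le> e / 4000" using e\<kappa> \<kappa> e by (simp add: power2_eq_square mult_left_mono)
  have y0: "0 < y" using y e by linarith
  have ly0: "0 < l * y" using l1 y0 by simp
  have ey: "e\<^sup>2 \<le> y * e" using y e by (simp add: power2_eq_square mult_right_mono)
  have ly: "l * y \<le> (51 / 100) * \<kappa>"
  proof -
    have "l * y \<le> l * ((101 / 100) * e)" using y ee e l1 by (intro mult_left_mono) auto
    also have "\<dots> = (101 / 100) * (l * e)" by simp
    finally show ?thesis using le \<kappa>(1) by linarith
  qed
  have p11: "p \<le> (11 / 10) * e"
  proof -
    have "y * (1 + 5 * e) \<le> ((101 / 100) * e) * (101 / 100)" using y ee e e\<kappa> \<kappa> by (intro mult_mono) auto
    then show ?thesis using p e by simp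
  qed
  have p0: "0 \<le> p"
  proof -
    have "0 \<le> y * (1 - 16 * e)" using y0 e\<kappa> \<kappa> by (intro mult_nonneg_nonneg) auto
    then show ?thesis using p by linarith
  qed
  have "l * (H + p + 2 * e\<^sup>2) \<le> l * ((12 / 10) * e)" using H p11 ee e l1 by (intro mult_left_mono) auto
  also have "\<dots> = (12 / 10) * (l * e)" by simp
  finally have lH: "l * (H + p + 2 * e\<^sup>2) \<le> (6 / 10) * \<kappa>" using le by linarith
  have Pge: "l * y * (1 - (46 / 10) * \<kappa>) \<le> P"
  proof -
    \<comment> \<open>16 e <= 4 \<kappa>, and the Bonferroni term adds 6/10 \<kappa>. The mixing
      error \<open>kd\<close> raises 46/10 to 56/10 below.\<close>
    have "1 - (46 / 10) * \<kappa> \<le> (1 - 16 * e) * (1 - (6 / 10) * \<kappa>)"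
    proof -
      have "0 \<le> 16 * e * ((6 / 10) * \<kappa>)" using e \<kappa> by simp
      moreover have "(1 - 16 * e) * (1 - (6 / 10) * \<kappa>) = 1 - 16 * e - (6 / 10) * \<kappa> + 16 * e * ((6 / 10) * \<kappa>)"
        by (simp add: field_simps)
      ultimately show ?thesis using e\<kappa> by linarith
    qed
    then have "l * y * (1 - (46 / 10) * \<kappa>) \<le> l * y * ((1 - 16 * e) * (1 - (6 / 10) * \<kappa>))"
      using ly0 l1 y0 by (intro mult_left_mono) auto
    also have "\<dots> = l * (y * (1 - 16 * e)) * (1 - (6 / 10) * \<kappa>)" by (simp only: mult.assoc)
    also have "\<dots> \<le> l * p * (1 - (6 / 10) * \<kappa>)" using p l1 \<kappa> by (intro mult_mono mult_left_mono mult_nonneg_nonneg) (auto intro: p0)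
    also have "\<dots> \<le> l * p * (1 - l * (H + p + 2 * e\<^sup>2))" using lH p0 l1 by (intro mult_left_mono mult_nonneg_nonneg) auto
    also have "\<dots> = l * p - l\<^sup>2 * (p * (H + p + 2 * e\<^sup>2))" by (simp add: power2_eq_square algebra_simps)
    finally show ?thesis using P by linarith
  qed
  have kd: "k * (2 * e\<^sup>2) \<le> l * y * \<kappa>"
  proof -
    have "2 * 1 \<le> k * l" using k l1 by (intro mult_mono) auto
    then have "2 * (k * e\<^sup>2) \<le> (k * l) * (k * e\<^sup>2)" using k e by (intro mult_right_mono) auto
    also have "\<dots> = l * e * \<kappa>" by (simp add: \<kappa>_def power2_eq_square algebra_simps)
    also have "\<dots> \<le> l * y * \<kappa>" using y l1 \<kappa> by (intro mult_right_mono mult_left_mono) auto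
    finally show ?thesis by simp
  qed
  have age: "l * y * (1 - (56 / 10) * \<kappa>) \<le> a" using Pge kd unfolding a_def by (simp add: algebra_simps)
  have b: "b = 20 * \<kappa>" by (simp add: b_def \<kappa>_def)
  have "l * (y + z) \<le> l * y * (1 + \<kappa>)"
  proof -
    have "z \<le> y * e" using z ey by linarith
    also have "\<dots> \<le> y * \<kappa>" using e\<kappa> y0 e by (intro mult_left_mono) auto
    finally show ?thesis using l1 by (simp add: algebra_simps)
  qed
  \<comment> \<open>To first order the right side gains 20 - 5.6 = 14.4, against 1 on the left; the
    quadratic loss 112 \<kappa>^2 is at most 0.112 \<kappa>.\<close>
  also have "\<dots> \<le> l * y * ((1 - (56 / 10) * \<kappa>) * (1 + 20 * \<kappa>))"
    using ly0 l1 y0 \<kappa> mult_left_mono[OF \<kappa>(2), of \<kappa>] by (intro mult_left_mono) (auto simp: algebra_simps)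
  also have "\<dots> = l * y * (1 - (56 / 10) * \<kappa>) * (1 + 20 * \<kappa>)" by (simp only: mult.assoc)
  also have "\<dots> \<le> a * (1 + b)" unfolding b using age \<kappa> by (intro mult_right_mono) auto
  finally show "l * (y + z) \<le> a * (1 + b)" .
  have "0 \<le> l * y * (1 - (56 / 10) * \<kappa>)" using ly0 l1 y0 \<kappa> by (intro mult_nonneg_nonneg) auto
  then show "0 \<le> a" using age by linarith
  have Ple: "P \<le> l * y * (1 + 5 * e)"
    unfolding mult.assoc by (rule order.trans[OF P(1) mult_left_mono[OF p(1)]]) (use l1 in simp)
  have "l * y * (1 + 5 * e) \<le> ((51 / 100) * \<kappa>) * (101 / 100)" by (rule mult_mono[OF ly]) (use e e\<kappa> \<kappa> ly0 l1 y0 in auto)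
  then have P5: "P \<le> (52 / 100) * \<kappa>" using Ple \<kappa> by linarith
  have "0 \<le> k * (2 * e\<^sup>2)" using k by simp
  then have "a \<le> (52 / 100) * \<kappa>" using P5 unfolding a_def by linarith
  then show "2 * a \<le> b" "a \<le> 1" using \<kappa> unfolding b by linarith+
  have "k * (2 * e\<^sup>2) \<le> 2 * l * (2 * e\<^sup>2)" using kl by (intro mult_right_mono) auto
  \<comment> \<open>In units of l e^2, mixing contributes 4 because k <= 2 l, and \<open>P1\<close>
    contributes 6; the factor 3 makes 30.\<close>
  then have eta: "3 * (k * (2 * e\<^sup>2) + P1) \<le> 30 * (l * e\<^sup>2)" using P1 by (simp add: algebra_simps)
  have "l * e\<^sup>2 \<le> l * (y * e)" using ey l1 by (intro mult_left_mono) auto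
  then have wle: "w \<le> l * y * (1 + 35 * e)" using eta Ple unfolding w_def by (simp add: algebra_simps)
  have "l * y * (1 + 35 * e) \<le> ((51 / 100) * \<kappa>) * (101 / 100)" by (rule mult_mono[OF ly]) (use e e\<kappa> \<kappa> ly0 l1 y0 in auto)
  then have w52: "w \<le> (52 / 100) * \<kappa>" using wle \<kappa> by linarith
  show w0: "0 \<le> w" using P1 k unfolding w_def by simp
  show "w \<le> 1 / 2" using w52 \<kappa> by linarith
  have "3 * (k * (2 * e\<^sup>2) + P1) \<le> w" using P1 unfolding w_def by simp
  then show "3 * (k * (2 * e\<^sup>2) + P1) \<le> 1 / 2" using w52 \<kappa> by linarith
  have v: "w + 2 * w\<^sup>2 = w * (1 + 2 * w)" by (simp add: power2_eq_square algebra_simps)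
  also have "\<dots> \<le> (l * y * (1 + 35 * e)) * (1 + (104 / 100) * \<kappa>)"
    by (rule mult_mono[OF wle]) (use w52 w0 wle in auto)
  \<comment> \<open>35 e <= 8.75 \<kappa>, again from 4 e <= \<kappa>.\<close>
  also have "\<dots> \<le> l * y * ((1 + (875 / 100) * \<kappa>) * (1 + (104 / 100) * \<kappa>))"
    unfolding mult.assoc[of "l * y"] using e\<kappa> ly0 l1 y0 \<kappa> by (intro mult_left_mono mult_right_mono) auto
  also have "\<dots> \<le> l * y * (1 + 10 * \<kappa>)"
  proof -
    have "\<kappa> * \<kappa> \<le> \<kappa> / 1000" using mult_left_mono[OF \<kappa>(2), of \<kappa>] \<kappa> by simp
    moreover have "(1 + (875 / 100) * \<kappa>) * (1 + (104 / 100) * \<kappa>) = 1 + (979 / 100) * \<kappa> + (91 / 10) * (\<kappa> * \<kappa>)"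
      by (simp add: field_simps)
    ultimately have "(1 + (875 / 100) * \<kappa>) * (1 + (104 / 100) * \<kappa>) \<le> 1 + 10 * \<kappa>" using \<kappa> by linarith
    then show ?thesis using ly0 by (intro mult_left_mono) (auto intro: less_imp_le)
  qed
  finally have vle: "w + 2 * w\<^sup>2 \<le> l * y * (1 + 10 * \<kappa>)" .
  have "(w + 2 * w\<^sup>2) * (1 - b) \<le> l * y * (1 + 10 * \<kappa>) * (1 - b)"
    using vle \<kappa> b by (intro mult_right_mono) auto
  also have "\<dots> = l * y * ((1 + 10 * \<kappa>) * (1 - 20 * \<kappa>))" by (simp only: b mult.assoc)
  also have "\<dots> \<le> l * y * 1" using ly0 l1 y0 \<kappa> by (intro mult_left_mono) (auto simp: algebra_simps)
  finally show "(w + 2 * w\<^sup>2) * (1 - b) \<le> l * y" by simp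
  have "l * y * (1 + 10 * \<kappa>) \<le> ((51 / 100) * \<kappa>) * 2" by (rule mult_mono[OF ly]) (use \<kappa> ly0 l1 y0 in auto)
  then show "w + 2 * w\<^sup>2 \<le> b" using vle \<kappa> unfolding b by linarith
qed

text \<open>Rounding \<open>t\<close> down to a multiple of the block length loses at most one
  block, which costs the factor exp a; within blocks 1 - a <= exp (-a).\<close>

lemma geometric_decay_upper:
  fixes g F :: "_ \<Rightarrow> real"
  assumes T: "0 < T" and s: "0 < s" and a: "0 \<le> a" "a \<le> 1" and g0: "g 0 \<le> 1"
    and step: "\<And>n. g (n + T) \<le> g n * (1 - a)"
    and F: "\<And>n. real n * s \<le> t \<Longrightarrow> F t \<le> g n" and t: "0 \<le> t"
  shows "F t \<le> exp a * exp (- (t * (a / (real T * s))))"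
proof -
  define i where "i = nat \<lfloor>t / (real T * s)\<rfloor>"
  have Ts: "0 < real T * s" using T s by simp
  have ri: "real i = of_int \<lfloor>t / (real T * s)\<rfloor>" unfolding i_def using t Ts by simp
  have i: "real i \<le> t / (real T * s)" "t / (real T * s) - 1 \<le> real i" unfolding ri by linarith+
  have gi: "g (i * T) \<le> (1 - a) ^ i" for i
  proof (induction i)
    case (Suc i)
    have "g (Suc i * T) \<le> g (i * T) * (1 - a)" using step[of "i * T"] by (simp add: add.commute)
    also have "\<dots> \<le> (1 - a) ^ i * (1 - a)" using Suc a by (intro mult_right_mono) auto
    finally show ?case by (simp add: mult.commute)
  qed (use g0 in simp)
  have "real (i * T) * s \<le> t" using i(1) Ts by (simp add: field_simps)
  then have "F t \<le> g (i * T)" by (rule F)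
  also have "\<dots> \<le> (1 - a) ^ i" by (rule gi)
  also have "\<dots> \<le> exp (- a) ^ i"
    using exp_ge_add_one_self[of "- a"] a by (intro power_mono) auto
  also have "\<dots> = exp (- (real i * a))" by (simp add: exp_of_nat_mult[symmetric])
  also have "\<dots> \<le> exp (- ((t / (real T * s) - 1) * a))" using i(2) a by (simp add: mult_right_mono)
  also have "\<dots> = exp a * exp (- (t * (a / (real T * s))))" by (simp add: algebra_simps flip: exp_add)
  finally show ?thesis .
qed

text \<open>Rounding \<open>t\<close> up to whole blocks costs one factor exp (-v). The recursion
  starts at index 1: from an arbitrary initial law the first window is controlled only through
  \<open>r\<close>. The extra window is harmless, as it only makes the time reached later than
  \<open>t\<close>.\<close>

lemma geometric_decay_lower:
  fixes g F :: "_ \<Rightarrow> real"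
  assumes T: "0 < T" and s: "0 < s" and x: "0 \<le> x" "x \<le> 1" "exp (- v) \<le> x" and v: "0 \<le> v"
    and r: "r \<le> 1" "1 - r \<le> g 1"
    and step: "\<And>n. g (Suc n) * x \<le> g (Suc n + T)"
    and F: "\<And>n. t \<le> real n * s \<Longrightarrow> g n \<le> F t" and t: "0 \<le> t"
  shows "(1 - r) * (exp (- v) * exp (- (t * (v / (real T * s))))) \<le> F t"
proof -
  define i where "i = nat \<lceil>t / (real T * s)\<rceil>"
  have Ts: "0 < real T * s" using T s by simp
  have ri: "real i = of_int \<lceil>t / (real T * s)\<rceil>" unfolding i_def using t Ts by simp
  have i: "t / (real T * s) \<le> real i" "real i \<le> t / (real T * s) + 1" unfolding ri by linarith+
  have gi: "(1 - r) * x ^ i \<le> g (Suc (i * T))" for i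
  proof (induction i)
    case (Suc i)
    have "(1 - r) * x ^ i * x \<le> g (Suc (i * T)) * x" using Suc x by (intro mult_right_mono) auto
    also have "\<dots> \<le> g (Suc (i * T) + T)" by (rule step)
    finally show ?case by (simp add: algebra_simps)
  qed (use r in simp)
  have "exp (- v) * exp (- (t * (v / (real T * s)))) = exp (- ((t / (real T * s) + 1) * v))"
    by (simp add: algebra_simps flip: exp_add)
  also have "\<dots> \<le> exp (- (real i * v))" using i(2) v by (simp add: mult_right_mono)
  also have "\<dots> = exp (- v) ^ i" by (simp add: exp_of_nat_mult[symmetric])
  also have "\<dots> \<le> x ^ i" using x by (intro power_mono) auto
  finally have "(1 - r) * (exp (- v) * exp (- (t * (v / (real T * s))))) \<le> (1 - r) * x ^ i"
    using r by (intro mult_left_mono) auto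
  also have "\<dots> \<le> g (Suc (i * T))" by (rule gi)
  also have "\<dots> \<le> F t"
  proof (rule F)
    have "t \<le> real (i * T) * s" using i(1) Ts by (simp add: field_simps)
    also have "\<dots> \<le> real (Suc (i * T)) * s" using s by (intro mult_right_mono) auto
    finally show "t \<le> real (Suc (i * T)) * s" .
  qed
  finally show ?thesis .
qed

section \<open>The meeting probability of a stationary pair in terms of the mean\<close>

context mixing_chain
begin

text \<open>\<open>phi_upper\<close> is summed over \<open>n\<close>. The shifted series lacks
  \<open>N + 1\<close> terms of size at most 1, so the total sum S satisfies S (pmeet - 2 d) <= N +
  1, and S >= m / s.\<close>

lemma pmeet_upper:
  assumes s: "0 < s" and d: "mixed s d" and m: "0 < m_Q"
  shows "pmeet s N \<le> 2 * d + real (N + 1) * (s / m_Q)"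
proof (cases "pmeet s N \<le> 2 * d")
  case True
  moreover have "0 \<le> real (N + 1) * (s / m_Q)" using s m by simp
  ultimately show ?thesis by linarith
next
  case False
  let ?S = "\<Sum>n. phi 2 s n"
  note sm = summable_phi[OF s]
  have "(\<Sum>n. phi 2 s (n + (1 + N))) \<le> (\<Sum>n. phi 2 s n * (phi 2 s N + 2 * d))"
    using phi_upper[OF s d, of 2] sm
    by (intro suminf_le summable_mult2 summable_ignore_initial_segment) auto
  also have "\<dots> = ?S * (phi 2 s N + 2 * d)" by (rule suminf_mult2[symmetric, OF sm])
  finally have "?S - (\<Sum>n<1 + N. phi 2 s n) \<le> ?S * (phi 2 s N + 2 * d)"
    unfolding suminf_minus_initial_segment[OF sm] .
  moreover have "(\<Sum>n<1 + N. phi 2 s n) \<le> (\<Sum>n<1 + N. 1)" using phi_bounds by (intro sum_mono)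
  ultimately have 1: "?S * (pmeet s N - 2 * d) \<le> real (N + 1)" by (simp add: algebra_simps)
  have "m_Q / s \<le> ?S" using m_Q_le[OF s] s by (simp add: field_simps)
  then have "m_Q / s * (pmeet s N - 2 * d) \<le> real (N + 1)"
    using mult_right_mono[of "m_Q / s" ?S "pmeet s N - 2 * d"] False 1 by linarith
  then have "pmeet s N - 2 * d \<le> real (N + 1) * (s / m_Q)" using s m by (simp add: field_simps)
  then show ?thesis by linarith
qed

text \<open>The same summation for \<open>phi_lower\<close>. Now the \<open>N + 2\<close> missing
  terms are bounded below by \<open>phi 2 s (N + 1)\<close>, and S <= m / s + 1 is used.\<close>

lemma pmeet_lower:
  assumes s: "0 < s" and d: "mixed s d" "0 \<le> d" and m: "0 < m_Q"
  shows "real N * (s / m_Q) * (1 - pmeet s (N + 1)) \<le>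
    (1 + s / m_Q) * (pmeet s N + 4 * d + pmeet s 1) + s / m_Q * (2 * pmeet s (N + 1) - 1)"
proof -
  let ?S = "\<Sum>n. phi 2 s n" and ?\<sigma> = "s / m_Q"
  note sm = summable_phi[OF s]
  have sm1: "summable (\<lambda>n. phi 2 s (n + 1))" by (rule summable_ignore_initial_segment[OF sm])
  have shift: "(\<Sum>n. phi 2 s (n + 1)) = ?S - 1"
    using suminf_minus_initial_segment[OF sm, of 1] by (simp add: phi_0)
  have "(\<Sum>n. phi 2 s (n + 1) * (phi 2 s N - 2 * d) - phi 2 s n * (1 - phi 2 s 1 + 2 * d)) \<le>
      (\<Sum>n. phi 2 s (n + (1 + (1 + N))))"
  proof (rule suminf_le)
    show "summable (\<lambda>n. phi 2 s (n + 1) * (phi 2 s N - 2 * d) - phi 2 s n * (1 - phi 2 s 1 + 2 * d))"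
      by (intro summable_diff summable_mult2 sm sm1)
    show "summable (\<lambda>n. phi 2 s (n + (1 + (1 + N))))" by (rule summable_ignore_initial_segment[OF sm])
    fix n show "phi 2 s (n + 1) * (phi 2 s N - 2 * d) - phi 2 s n * (1 - phi 2 s 1 + 2 * d) \<le> phi 2 s (n + (1 + (1 + N)))"
      using phi_lower[OF s d(1), of 2 n N] by (simp add: add.assoc)
  qed
  also have "(\<Sum>n. phi 2 s (n + 1) * (phi 2 s N - 2 * d) - phi 2 s n * (1 - phi 2 s 1 + 2 * d)) =
     (?S - 1) * (phi 2 s N - 2 * d) - ?S * (1 - phi 2 s 1 + 2 * d)"
    using suminf_diff[OF summable_mult2[OF sm1] summable_mult2[OF sm], of "phi 2 s N - 2 * d" "1 - phi 2 s 1 + 2 * d"]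
      suminf_mult2[OF sm1, of "phi 2 s N - 2 * d"] suminf_mult2[OF sm, of "1 - phi 2 s 1 + 2 * d"] shift by simp
  also have "(\<Sum>n. phi 2 s (n + (1 + (1 + N)))) = ?S - (\<Sum>n<1 + (1 + N). phi 2 s n)"
    by (rule suminf_minus_initial_segment[OF sm])
  finally have 1: "(?S - 1) * (phi 2 s N - 2 * d) - ?S * (1 - phi 2 s 1 + 2 * d) \<le> ?S - (\<Sum>n<1 + (1 + N). phi 2 s n)" .
  have "(\<Sum>n<1 + (1 + N). phi 2 s (N + 1)) \<le> (\<Sum>n<1 + (1 + N). phi 2 s n)"
    using s by (intro sum_mono phi_antimono) auto
  then have 2: "(real N + 2) * phi 2 s (N + 1) \<le> (\<Sum>n<1 + (1 + N). phi 2 s n)" by (simp add: add.commute)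
  have S1: "1 \<le> ?S" using suminf_nonneg[OF sm1] phi_bounds shift by fastforce
  have 3: "(real N + 2) * phi 2 s (N + 1) \<le> ?S * (pmeet s N + 4 * d + pmeet s 1) + 1"
    using 1 2 phi_bounds[of 2 s N] d(2) by (simp add: algebra_simps)
  have \<sigma>: "0 < ?\<sigma>" using s m by simp
  have "?\<sigma> * ?S \<le> 1 + ?\<sigma>" using suminf_phi_le[OF s] m by (simp add: field_simps)
  moreover have "0 \<le> pmeet s N + 4 * d + pmeet s 1" using phi_bounds[of 2 s N] phi_bounds[of 2 s 1] d(2) by linarith
  ultimately have 4: "?\<sigma> * ?S * (pmeet s N + 4 * d + pmeet s 1) \<le> (1 + ?\<sigma>) * (pmeet s N + 4 * d + pmeet s 1)"
    by (intro mult_right_mono)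
  have "?\<sigma> * ((real N + 2) * phi 2 s (N + 1)) \<le> ?\<sigma> * (?S * (pmeet s N + 4 * d + pmeet s 1) + 1)"
    using 3 \<sigma> by (intro mult_left_mono) auto
  then have "?\<sigma> * ((real N + 2) * phi 2 s (N + 1)) \<le> (1 + ?\<sigma>) * (pmeet s N + 4 * d + pmeet s 1) + ?\<sigma>"
    using 4 unfolding distrib_left[of ?\<sigma>] mult_1_right mult.assoc[of ?\<sigma>, symmetric] by linarith
  moreover have "?\<sigma> * ((real N + 2) * phi 2 s (N + 1)) =
      real N * ?\<sigma> * (1 - pmeet s (N + 1)) - ?\<sigma> * (2 * pmeet s (N + 1) - 1) + ?\<sigma>"
    by (simp add: algebra_simps add_divide_distrib)
  ultimately show ?thesis by linarith
qed

text \<open>All errors are O(e^2), hence O(e) relative to y = N s / m, because y >= e. The 5 is 4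
  from \<open>2 * d\<close> plus 1 from the extra window; 16 rounds up 1.1 + 14.1.\<close>

lemma pmeet_bounds:
  assumes s: "0 < s" and m: "0 < m_Q" and e: "0 < e" "e \<le> 1 / 4000"
    and d: "mixed s (2 * e\<^sup>2)" and \<sigma>: "s / m_Q \<le> e\<^sup>2" and p1: "pmeet s 1 \<le> 6 * e\<^sup>2"
    and N: "e \<le> real N * (s / m_Q)" "real N * (s / m_Q) \<le> e + e\<^sup>2"
  shows "pmeet s N \<le> real N * (s / m_Q) * (1 + 5 * e)" "real N * (s / m_Q) * (1 - 16 * e) \<le> pmeet s N"
proof -
  define y where "y = real N * (s / m_Q)"
  define z where "z = s / m_Q"
  have ee: "e\<^sup>2 \<le> e / 4000" using e by (simp add: power2_eq_square mult_left_mono)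
  have z: "0 < z" "z \<le> e\<^sup>2" using s m \<sigma> by (auto simp: z_def)
  have y: "e \<le> y" "y \<le> e + e\<^sup>2" using N by (auto simp: y_def)
  have ey: "e\<^sup>2 \<le> y * e" using y e by (simp add: power2_eq_square mult_right_mono)
  have "pmeet s N \<le> 4 * e\<^sup>2 + (y + z)"
    using pmeet_upper[OF s d m, of N] by (simp add: y_def z_def algebra_simps add_divide_distrib)
  then show "pmeet s N \<le> real N * (s / m_Q) * (1 + 5 * e)"
    using z ey unfolding y_def[symmetric] by (simp add: algebra_simps)
  have "pmeet s (N + 1) \<le> 4 * e\<^sup>2 + (y + 2 * z)"
    using pmeet_upper[OF s d m, of "N + 1"] by (simp add: y_def z_def algebra_simps add_divide_distrib)
  then have q: "pmeet s (N + 1) \<le> 1.1 * e" using z y ee by linarith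
  have "y * (1 - pmeet s (N + 1)) \<le> (1 + z) * (pmeet s N + 8 * e\<^sup>2 + pmeet s 1) + z * (2 * pmeet s (N + 1) - 1)"
    using pmeet_lower[OF s d _ m, of N] e by (simp add: y_def z_def)
  moreover have "z * (2 * pmeet s (N + 1) - 1) \<le> 0"
    using z q e by (intro mult_nonneg_nonpos) auto
  moreover have "y * (1 - 1.1 * e) \<le> y * (1 - pmeet s (N + 1))" using q y e by (intro mult_left_mono) auto
  moreover have "(1 + z) * (pmeet s N + 8 * e\<^sup>2 + pmeet s 1) \<le> (1 + z) * (pmeet s N + 14 * e\<^sup>2)"
    using z p1 by (intro mult_left_mono) auto
  moreover have "(1 + z) * (pmeet s N + 14 * e\<^sup>2) \<le> pmeet s N + 14 * e\<^sup>2 + e\<^sup>2 * (pmeet s N + 14 * e\<^sup>2)"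
  proof -
    have "z * (pmeet s N + 14 * e\<^sup>2) \<le> e\<^sup>2 * (pmeet s N + 14 * e\<^sup>2)"
      using z phi_bounds[of 2 s N] by (intro mult_right_mono) auto
    then show ?thesis by (simp add: algebra_simps)
  qed
  moreover have "e\<^sup>2 * (pmeet s N + 14 * e\<^sup>2) \<le> 0.1 * e\<^sup>2"
  proof -
    have "pmeet s N + 14 * e\<^sup>2 \<le> 0.1" using \<open>pmeet s N \<le> 4 * e\<^sup>2 + (y + z)\<close> z y ee e by linarith
    from mult_left_mono[OF this zero_le_power2[of e]] show ?thesis by (simp only: mult.commute[of "0.1"])
  qed
  ultimately have "y * (1 - 1.1 * e) \<le> pmeet s N + 14.1 * e\<^sup>2" by linarith
  then show "real N * (s / m_Q) * (1 - 16 * e) \<le> pmeet s N"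
    using ey e y unfolding y_def[symmetric] by (simp add: algebra_simps)
qed

end

lemma two_choose_2: "2 * real (k choose 2) = real k * (real k - 1)"
proof -
  have "2 * (k choose 2) = k * (k - 1)"
    unfolding choose_two by (rule dvd_mult_div_cancel) (cases k; auto)
  then have "2 * real (k choose 2) = real k * real (k - 1)" by (metis of_nat_mult of_nat_numeral)
  then show ?thesis by (cases k) auto
qed

section \<open>From the block recursion to the exponential law\<close>

context mixing_chain
begin

text \<open>The two cases of \<open>err\<close> meet here: each of them has to provide positivity of
  the mean, the bound on \<open>s / m_Q\<close> and a bound \<open>H\<close> of order e^2.\<close>

lemma approx_exp_meeting_time:
  fixes k :: nat and e H s :: real
  assumes k: "2 \<le> k" and e: "0 < e" and small: "(real k)\<^sup>2 * e \<le> 1 / 1000"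
    and s: "0 < s" and m: "0 < m_Q" and d: "mixed s (2 * e\<^sup>2)" and sm: "s / m_Q \<le> e\<^sup>2"
    and H: "\<And>j u. u \<in> V \<Longrightarrow> (\<Sum>v\<in>V. \<pi> v * pair_hit (s / 2 ^ j) (2 ^ j) (u, v)) \<le> H" "H \<le> 6 * e\<^sup>2"
    and \<Lambda>: "initial_law V k \<Lambda>"
  defines "L \<equiv> indep_chains k P \<Lambda>"
  defines "r \<equiv> measure L {\<omega> \<in> space L. meeting_time k \<omega> \<le> ennreal s}"
  shows "approx_exp (distr L borel (meeting_time k)) (m_Q / real (k choose 2))
    (20 * (real k)\<^sup>2 * e + 2 * r) (20 * (real k)\<^sup>2 * e)"
proof -
  interpret L: prob_space L unfolding L_def by (rule prob_space_indep_chains[OF \<Lambda>])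
  have meas [measurable]: "meeting_time k \<in> borel_measurable L"
    unfolding L_def by (rule measurable_meeting_time_indep[OF \<Lambda>])
  define z where "z = s / m_Q"
  have z: "0 < z" "z \<le> e\<^sup>2" using s m sm by (simp_all add: z_def)
  \<comment> \<open>The least number of windows with N s / m >= e; as s / m <= e^2, it overshoots by
    at most e^2.\<close>
  define N where "N = nat \<lceil>e / z\<rceil>"
  have "real N = of_int \<lceil>e / z\<rceil>" unfolding N_def using e z by simp
  then have "e / z \<le> real N" "real N \<le> e / z + 1" by linarith+
  then have Nz: "e \<le> real N * z" "real N * z \<le> e + z" using z by (auto simp: field_simps)
  define y where "y = real N * z"
  have y: "e \<le> y" "y \<le> e + e\<^sup>2" using Nz z by (auto simp: y_def)
  have k2: "2 \<le> real k" using k by simp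
  have "4 * e \<le> (real k)\<^sup>2 * e" using power_mono[OF k2, of 2] e by (intro mult_right_mono) auto
  then have e4: "e \<le> 1 / 4000" using small by linarith
  have p1: "pmeet s 1 \<le> 6 * e\<^sup>2" using pmeet_1_le[OF s H(1)] H(2) by linarith
  define p where "p = pmeet s N"
  have p: "p \<le> y * (1 + 5 * e)" "y * (1 - 16 * e) \<le> p"
    unfolding p_def y_def z_def
    by (rule pmeet_bounds[OF s m e e4 d sm p1]; use Nz z in \<open>simp add: z_def\<close>)+
  define l where "l = real (k choose 2)"
  have l: "2 * l = real k * (real k - 1)" unfolding l_def by (rule two_choose_2)
  have "2 * 1 \<le> real k * (real k - 1)" using k2 by (intro mult_mono) auto
  then have l1: "1 \<le> l" using l by simp
  define Pb where "Pb = 1 - phi k s N"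
  define P1 where "P1 = 1 - phi k s 1"
  have Pb: "Pb \<le> l * p" "l * p - l\<^sup>2 * (p * (H + p + 2 * e\<^sup>2)) \<le> Pb"
    unfolding Pb_def l_def p_def by (rule phi_union_bounds[OF s d H(1)], assumption)+
  have "P1 \<le> l * pmeet s 1"
    unfolding P1_def l_def by (rule phi_union_bounds[OF s d H(1)])
  also have "\<dots> \<le> l * (6 * e\<^sup>2)" using p1 l1 by (intro mult_left_mono) auto
  finally have P1: "0 \<le> Pb" "0 \<le> P1" "P1 \<le> l * (6 * e\<^sup>2)"
    using phi_bounds unfolding Pb_def P1_def by auto
  define b where "b = 20 * ((real k)\<^sup>2 * e)"
  define kd where "kd = real k * (2 * e\<^sup>2)"
  define a where "a = Pb - kd"
  define w where "w = Pb + 3 * (kd + P1)"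
  note est = block_estimates[OF e k2 l small y less_imp_le[OF z(1)] z(2) p H(2) Pb P1,
      folded kd_def, folded b_def, folded a_def w_def]
  have b: "0 < b" "b < 1" using small e k2 by (auto simp: b_def)
  have div_le: "n / D \<le> n' / D'" if "0 < D" "0 < D'" "n * D' \<le> n' * D" for n n' D D' :: real
    using that by (simp add: pos_divide_le_eq pos_le_divide_eq)
  have kd0: "0 \<le> kd" by (simp add: kd_def)
  define g where "g n = (\<Sum>x\<in>tuples k V. measure \<Lambda> {x} * G k s n x)" for n
  define F where "F t = measure L {\<omega> \<in> space L. ennreal t \<le> meeting_time k \<omega>}" for t
  have gF: "g n = F (real n * s)" for n
    unfolding g_def F_def L_def by (rule measure_meeting_ge[OF \<Lambda>, symmetric])
  have F_anti: "F t' \<le> F t" if "t \<le> t'" for t t'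
    unfolding F_def using ennreal_leI[OF that] by (intro L.finite_measure_mono) (auto intro: order.trans)
  have g0: "g 0 = 1" unfolding g_def using initial_law_sum[OF \<Lambda>] by (simp add: G_0)
  have g_nn: "0 \<le> g n" for n unfolding gF F_def by simp
  have g_up: "g (n + (1 + N)) \<le> g n * (1 - a)" for n
  proof -
    have "g (n + (1 + N)) \<le> (\<Sum>x\<in>tuples k V. measure \<Lambda> {x} * (G k s n x * (phi k s N + real k * (2 * e\<^sup>2))))"
      unfolding g_def by (intro sum_mono mult_left_mono G_upper s d measure_nonneg)
    also have "\<dots> = g n * (1 - a)"
      by (simp add: g_def a_def Pb_def kd_def sum_distrib_right mult.assoc)
    finally show ?thesis .
  qed
  have g_lo: "g (n + 1) * (phi k s M - kd) - g n * (kd + P1) \<le> g (n + 1 + (1 + M))" for n M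
  proof -
    have "g (n + 1) * (phi k s M - kd) - g n * (kd + P1) =
      (\<Sum>x\<in>tuples k V. measure \<Lambda> {x} * (G k s (n + 1) x * (phi k s M - real k * (2 * e\<^sup>2)) -
        G k s n x * (1 - phi k s 1 + real k * (2 * e\<^sup>2))))"
      by (simp only: g_def kd_def P1_def right_diff_distrib sum_subtractf sum_distrib_right mult.assoc add.commute)
    also have "\<dots> \<le> g (n + 1 + (1 + M))"
      unfolding g_def by (intro sum_mono mult_left_mono G_lower s d measure_nonneg)
    finally show ?thesis .
  qed
  have r0: "0 \<le> r" unfolding r_def by simp
  have g1: "1 - r \<le> g 1"
  proof -
    have "L.prob (space L) \<le> L.prob ({\<omega> \<in> space L. meeting_time k \<omega> \<le> ennreal s} \<union> {\<omega> \<in> space L. ennreal s \<le> meeting_time k \<omega>})"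
      by (intro L.finite_measure_mono) auto
    also have "\<dots> \<le> r + F s"
      unfolding r_def F_def by (intro measure_Un_le) measurable
    finally show ?thesis by (simp add: gF L.prob_space)
  qed
  have upper: "F t \<le> (1 + (b + 2 * r)) * exp (- t / ((1 + b) * (m_Q / l)))" if t: "0 < t" for t
  proof -
    have "F t \<le> exp a * exp (- (t * (a / (real (1 + N) * s))))"
      using g_up F_anti g0 est(2,4) s t
      by (intro geometric_decay_upper[where g=g]) (auto simp: gF)
    also have "\<dots> \<le> (1 + (b + 2 * r)) * exp (- t / ((1 + b) * (m_Q / l)))"
    proof (rule mult_mono)
      have "exp a \<le> 1 + a + a\<^sup>2" using est(2,4) by (rule exp_bound)
      also have "\<dots> \<le> 1 + a + a" using est(2,4) by (simp add: power2_eq_square mult_left_le)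
      also have "\<dots> \<le> 1 + (b + 2 * r)" using est(3) r0 by linarith
      finally show "exp a \<le> 1 + (b + 2 * r)" .
      have "l / ((1 + b) * m_Q) \<le> a / (real (1 + N) * s)"
      proof -
        have "l * (real (1 + N) * s) = l * (y + z) * m_Q"
          using m by (simp add: y_def z_def field_simps)
        also have "\<dots> \<le> a * (1 + b) * m_Q" using est(1) m by (intro mult_right_mono) auto
        finally show ?thesis using b m s by (intro div_le) (simp_all add: mult.assoc)
      qed
      then have "t * (l / ((1 + b) * m_Q)) \<le> t * (a / (real (1 + N) * s))" using t by (intro mult_left_mono) auto
      then show "exp (- (t * (a / (real (1 + N) * s)))) \<le> exp (- t / ((1 + b) * (m_Q / l)))" by simp
    qed (use b r0 in auto)
    finally show ?thesis .
  qed
  have lower: "(1 - (b + 2 * r)) * exp (- t / ((1 - b) * (m_Q / l))) \<le> F t" if t: "0 < t" for t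
  proof (cases "r < 1 / 2")
    \<comment> \<open>For r >= 1/2 the left side is at most 0.\<close>
    case False
    then have "(1 - (b + 2 * r)) * exp (- t / ((1 - b) * (m_Q / l))) \<le> 0"
      using b by (intro mult_nonpos_nonneg) auto
    also have "0 \<le> F t" by (simp add: F_def)
    finally show ?thesis .
  next
    case True
    \<comment> \<open>\<open>g_lo\<close> subtracts a multiple of \<open>g n\<close>, which has to
      be expressed by \<open>g (n + 1)\<close> before the bound can be iterated. The factor 2
      propagates through \<open>g_lo\<close> with an empty block, since kd + 2 (kd + P1) <= 3 (kd +
      P1) <= 1/2; this is the 3 in \<open>w\<close>.\<close>
    have half: "g n \<le> 2 * g (n + 1)" for n
    proof (induction n)
      case 0 then show ?case using g1 g0 True by simp
    next
      case (Suc n)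
      have "g n * (kd + P1) \<le> 2 * g (n + 1) * (kd + P1)"
        using Suc kd0 P1 by (intro mult_right_mono) auto
      moreover have "g (n + 1) * (1 - kd) - g n * (kd + P1) \<le> g (n + 2)"
        using g_lo[of n 0] by (simp add: phi_0)
      moreover have "g (n + 1) * (1 / 2) \<le> g (n + 1) * (1 - 3 * (kd + P1))"
        using est(9) g_nn by (intro mult_left_mono) auto
      moreover have "0 \<le> g (n + 1) * P1" using g_nn P1 by (intro mult_nonneg_nonneg) auto
      ultimately show ?case by (simp add: algebra_simps)
    qed
    have step: "g (Suc n) * (1 - w) \<le> g (Suc n + (1 + N))" for n
    proof -
      have "g n * (kd + P1) \<le> 2 * g (n + 1) * (kd + P1)"
        using half kd0 P1 by (intro mult_right_mono) auto
      moreover have "0 \<le> g (n + 1) * P1" using g_nn P1 by (intro mult_nonneg_nonneg) auto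
      ultimately show ?thesis using g_lo[of n N] by (simp add: w_def Pb_def algebra_simps)
    qed
    \<comment> \<open>For 0 <= w <= 1/2 this dominates - ln (1 - w), so one block survives with
      probability at least exp (-v).\<close>
    define v where "v = w + 2 * w\<^sup>2"
    have v0: "0 \<le> v" using est(5) by (simp add: v_def)
    have "- v \<le> ln (1 - w)" using ln_one_minus_pos_lower_bound[OF est(5,6)] by (simp add: v_def)
    then have ev: "exp (- v) \<le> 1 - w" using est(6) by (subst (asm) ln_ge_iff) auto
    have "(1 - r) * (exp (- v) * exp (- (t * (v / (real (1 + N) * s))))) \<le> F t"
      using step F_anti g1 ev v0 est(5,6) True s t
      by (intro geometric_decay_lower[where g=g and x="1 - w"]) (auto simp: gF)
    moreover have "(1 - (b + 2 * r)) * exp (- t / ((1 - b) * (m_Q / l))) \<le>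
        (1 - r) * exp (- v) * exp (- (t * (v / (real (1 + N) * s))))"
    proof (cases "1 - (b + 2 * r) \<le> 0")
      case neg: True
      then have "(1 - (b + 2 * r)) * exp (- t / ((1 - b) * (m_Q / l))) \<le> 0"
        by (intro mult_nonpos_nonneg) auto
      also have "0 \<le> (1 - r) * exp (- v) * exp (- (t * (v / (real (1 + N) * s))))" using True by simp
      finally show ?thesis .
    next
      case pos: False
      show ?thesis
      proof (rule mult_mono)
        have "1 - v \<le> exp (- v)" using exp_ge_add_one_self[of "- v"] by simp
        then have "(1 - r) * (1 - v) \<le> (1 - r) * exp (- v)" using True by (intro mult_left_mono) auto
        moreover have "r * v \<ge> 0" using r0 v0 by simp
        moreover have "v \<le> b" unfolding v_def by (rule est(8))
        ultimately show "1 - (b + 2 * r) \<le> (1 - r) * exp (- v)" using r0 by (simp add: algebra_simps)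
        have "v / (real (1 + N) * s) \<le> l / ((1 - b) * m_Q)"
        proof -
          have "v * ((1 - b) * m_Q) = (w + 2 * w\<^sup>2) * (1 - b) * m_Q" by (simp only: v_def mult.assoc)
          also have "\<dots> \<le> l * y * m_Q" using est(7) m by (intro mult_right_mono) auto
          also have "\<dots> = l * (real N * s)" using m by (simp add: y_def z_def)
          also have "\<dots> \<le> l * (real (1 + N) * s)" using l1 s by (intro mult_left_mono mult_right_mono) auto
          finally show ?thesis using b m s by (intro div_le) simp_all
        qed
        then have "t * (v / (real (1 + N) * s)) \<le> t * (l / ((1 - b) * m_Q))" using t by (intro mult_left_mono) auto
        then show "exp (- t / ((1 - b) * (m_Q / l))) \<le> exp (- (t * (v / (real (1 + N) * s))))" by simp
      qed (use True in auto)
    qed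
    ultimately show ?thesis by (simp add: mult.assoc)
  qed
  have distr: "measure (distr L borel (meeting_time k)) {z. ennreal t \<le> z} = F t" for t
  proof -
    have "{z :: ennreal. ennreal t \<le> z} \<in> sets borel" by measurable
    then show ?thesis unfolding F_def by (subst measure_distr) (auto simp: vimage_def Int_def conj_commute)
  qed
  have bk: "20 * (real k)\<^sup>2 * e = b" by (simp add: b_def)
  show ?thesis
    unfolding approx_exp_def bk l_def[symmetric] distr
    using L.prob_space_distr[OF meas] m l1 b r0 upper lower by auto
qed


text \<open>Each period of length \<open>t_mix V q \<pi> (1 / 4)\<close> halves the L1 distance, so
  about log2 (1/x) periods suffice. The 3 is 2, which bounds 1 / ln 2, plus 1 for rounding up; the
  latter uses ln (1/x) >= 1, that is x <= 1/e.\<close>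

lemma t_mix_le_log:
  assumes x: "0 < x" "x \<le> exp (- 1)" and a: "x \<le> a"
  shows "t_mix V q \<pi> a \<le> 3 * ln (1 / x) * t_mix V q \<pi> (1 / 4)"
proof -
  let ?l = "ln (1 / x)"
  have "ln x \<le> ln (exp (- 1))" using x by (subst ln_le_cancel_iff) auto
  then have l: "1 \<le> ?l" using x by (simp add: ln_div)
  define J where "J = nat \<lfloor>?l / ln 2\<rfloor>"
  have "real J = of_int \<lfloor>?l / ln 2\<rfloor>" unfolding J_def using l by simp
  then have J: "real J \<le> ?l / ln 2" "?l / ln 2 \<le> real (Suc J)" by linarith+
  have "?l \<le> real (Suc J) * ln 2" using J(2) by (simp add: field_simps)
  then have "exp (- (real (Suc J) * ln 2)) \<le> exp (- ?l)" by simp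
  moreover have "exp (- ?l) = x" using x by (simp add: ln_div)
  moreover have "exp (- (real (Suc J) * ln 2)) = (1 / 2) ^ Suc J"
    by (simp add: exp_minus exp_of_nat_mult power_one_over inverse_eq_divide del: of_nat_Suc power_Suc)
  ultimately have pw: "(1 / 2) ^ Suc J \<le> 2 * a" using x a by linarith
  have "?l * (2 / 3) \<le> ?l * ln 2" using ln2_ge_two_thirds l by (intro mult_left_mono) auto
  then have "?l / ln 2 \<le> 2 * ?l" using l by (simp add: pos_divide_le_eq)
  then have "real (Suc J) \<le> 3 * ?l" using J(1) l unfolding of_nat_Suc by linarith
  then have "real (Suc J) * t_mix V q \<pi> (1 / 4) \<le> 3 * ?l * t_mix V q \<pi> (1 / 4)"
    using t_mix_props(1)[of "1 / 4"] by (intro mult_right_mono) auto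
  moreover have "0 < a" using x a by linarith
  ultimately show ?thesis using t_mix_le_mult[OF _ pw] by linarith
qed

lemma alpha_pos: "0 < alpha V q \<pi>"
  unfolding alpha_def using q_max_nonneg t_mix_pos[of "1 / 4"] pi_max_pos
  by (intro mult_pos_pos add_pos_nonneg mult_nonneg_nonneg) auto

text \<open>Up to a time \<open>u\<close> of order t_mix / alpha, two stationary chains meet with
  probability at most 1/2, so the mean is at least u / 2.\<close>

lemma m_Q_ge_alpha:
  assumes a: "alpha V q \<pi> \<le> 1 / 16"
  shows "t_mix V q \<pi> (1 / 4) \<le> 32 * alpha V q \<pi> * m_Q"
proof -
  let ?t = "t_mix V q \<pi> (1 / 4)" and ?a = "alpha V q \<pi>"
  have t: "0 < ?t" by (rule t_mix_pos) auto
  note a0 = alpha_pos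
  \<comment> \<open>With this \<open>u\<close>, 4 q_max u is q_max t_mix / (4 alpha), and alpha <=
    1/16 gives 1 <= 1 / (4 alpha). The collision bound then collapses to 2 alpha / (4
    alpha).\<close>
  define u where "u = ?t / (16 * ?a)"
  have u: "0 < u" using t a0 by (simp add: u_def)
  have "pmeet u 1 \<le> 2 * (1 + 4 * q_max V q * u) * pi_max V \<pi>"
    by (rule pmeet_1_le[OF u avg_pair_hit_le_pi_max[OF u]])
  also have "\<dots> \<le> 2 * (1 / (4 * ?a) * (1 + q_max V q * ?t)) * pi_max V \<pi>"
  proof (intro mult_right_mono mult_left_mono)
    have "1 \<le> 1 / (4 * ?a)" using a a0 by (simp add: field_simps)
    moreover have "4 * q_max V q * u = 1 / (4 * ?a) * (q_max V q * ?t)" using a0 by (simp add: u_def field_simps)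
    ultimately show "1 + 4 * q_max V q * u \<le> 1 / (4 * ?a) * (1 + q_max V q * ?t)"
      by (simp only: distrib_left mult_1_right add_right_mono)
  qed (use pi_max_pos in auto)
  also have "\<dots> = 2 * (?a / (4 * ?a))" by (simp add: alpha_def)
  also have "\<dots> = 1 / 2" using a0 by simp
  finally have "1 / 2 \<le> phi 2 u 1" by simp
  then have "u * (1 / 2) \<le> u * phi 2 u 1" using u by (intro mult_left_mono) auto
  also have "\<dots> \<le> m_Q" using m_Q_ge[of u 1] u by simp
  finally show "?t \<le> 32 * ?a * m_Q" using a0 by (simp add: u_def field_simps)
qed

text \<open>The factor 10 makes e^2 = 100 X. In the transitive reversible case s / m <= 3 X; in the
  general case s / m <= 96 X and H <= 24 X.\<close>

lemma approx_exp_err: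
  fixes k :: nat
  assumes range: "err_in_range V q \<pi> P" and k: "2 \<le> k"
    and small: "(real k)\<^sup>2 * err 10 10 V q \<pi> P \<le> 1 / 1000"
    and \<Lambda>: "initial_law V k \<Lambda>"
  defines "e \<equiv> err 10 10 V q \<pi> P"
  defines "L \<equiv> indep_chains k P \<Lambda>"
  defines "r \<equiv> measure L {\<omega> \<in> space L. meeting_time k \<omega> \<le> ennreal (t_mix V q \<pi> (e\<^sup>2))}"
  shows "approx_exp (distr L borel (meeting_time k)) (m_Q / real (k choose 2))
    (20 * (real k)\<^sup>2 * e + 2 * r) (20 * (real k)\<^sup>2 * e)"
proof -
  let ?t = "t_mix V q \<pi> (1 / 4)"
  have t: "0 < ?t" by (rule t_mix_pos) auto
  define x where "x = (if reversible V q \<pi> \<and> transitive V q then rho V q \<pi> P else alpha V q \<pi>)"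
  have x1: "x \<le> exp (- 1)" using range by (simp add: err_in_range_def x_def)
  have x0: "0 < x"
  proof (cases "reversible V q \<pi> \<and> transitive V q")
    case True
    then have "0 < m_Q" by (intro m_Q_pos sum_pi_square_transitive) auto
    then show ?thesis using True t by (simp add: x_def rho_def)
  next
    case False
    show ?thesis unfolding x_def if_not_P[OF False] by (intro alpha_pos)
  qed
  define X where "X = x * ln (1 / x)"
  have "ln x \<le> ln (exp (- 1))" using x0 x1 by (subst ln_le_cancel_iff) auto
  then have lx: "1 \<le> ln (1 / x)" using x0 by (simp add: ln_div)
  have xX: "x \<le> X" using mult_left_mono[OF lx, of x] x0 by (simp add: X_def)
  have X0: "0 < X" using xX x0 by linarith
  have e: "e = 10 * sqrt X" by (simp add: e_def err_def X_def x_def)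
  have e0: "0 < e" using X0 by (simp add: e)
  have e2: "e\<^sup>2 = 100 * X" using X0 by (simp add: e power_mult_distrib)
  have "4 * e \<le> (real k)\<^sup>2 * e"
    using power_mono[of 2 "real k" 2] k e0 by (intro mult_right_mono) auto
  then have e4: "e \<le> 1 / 4000" using small by (simp add: e_def)
  have "e\<^sup>2 \<le> (1 / 4000)\<^sup>2" using e4 e0 by (intro power_mono) auto
  then have "100 * e\<^sup>2 \<le> 1" by (simp add: power2_eq_square)
  then have ee: "e\<^sup>2 < 1 / 2" and x16: "x \<le> 1 / 16" using xX X0 unfolding e2 by linarith+
  define s where "s = t_mix V q \<pi> (e\<^sup>2)"
  have s: "0 < s" "mixed s (2 * e\<^sup>2)"
    unfolding s_def using e0 ee by (auto intro!: t_mix_pos t_mix_props(2))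
  have sle: "s \<le> 3 * ln (1 / x) * ?t"
    unfolding s_def using xX X0 e2 by (intro t_mix_le_log x0 x1) linarith
  note core = approx_exp_meeting_time[OF k e0 small[folded e_def] s(1) _ s(2) _ _ _ \<Lambda>, folded L_def, unfolded s_def, folded r_def]
  show ?thesis
  proof (cases "reversible V q \<pi> \<and> transitive V q")
    case True
    then have m: "0 < m_Q" by (intro m_Q_pos sum_pi_square_transitive) auto
    have xr: "x = ?t / m_Q" using True by (simp add: x_def rho_def)
    have "s / m_Q \<le> 3 * ln (1 / x) * ?t / m_Q" using sle m by (intro divide_right_mono) auto
    also have "\<dots> = 3 * X" unfolding X_def xr by simp
    finally have sm: "s / m_Q \<le> 3 * X" .
    \<comment> \<open>The origin of the bound 6 e^2 for \<open>H\<close>: 4 e^2 from mixing, and 2 s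
      / m <= 6 X, which is below 2 e^2.\<close>
    have "pmeet s 1 \<le> 2 * (2 * e\<^sup>2) + real (1 + 1) * (s / m_Q)" by (rule pmeet_upper[OF s m])
    then have "pmeet s 1 \<le> 6 * e\<^sup>2" using sm X0 unfolding e2 by simp
    moreover have "s / m_Q \<le> e\<^sup>2" using sm X0 unfolding e2 by linarith
    ultimately show ?thesis
      using m s(1) True unfolding s_def
      by (intro core[where H="pmeet (t_mix V q \<pi> (e\<^sup>2)) 1"] avg_pair_hit_transitive) auto
  next
    case False
    then have xa: "x = alpha V q \<pi>" unfolding x_def by (rule if_not_P)
    \<comment> \<open>Positivity of the mean is obtained from this comparison: a small alpha forces
      m > 0, whereas a \<pi> concentrated at one point would give m = 0.\<close>
    have mt: "?t \<le> 32 * x * m_Q" using m_Q_ge_alpha x16 unfolding xa by simp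
    then have "0 < 32 * x * m_Q" using t by linarith
    then have m: "0 < m_Q" using x0 by (simp add: zero_less_mult_iff)
    have "3 * ln (1 / x) * ?t \<le> 3 * ln (1 / x) * (32 * x * m_Q)" using mt lx by (intro mult_left_mono) auto
    also have "\<dots> = 96 * X * m_Q" by (simp add: X_def)
    finally have "s \<le> 96 * X * m_Q" using sle by linarith
    then have "s / m_Q \<le> 96 * X" using m by (simp add: pos_divide_le_eq)
    then have sm: "s / m_Q \<le> e\<^sup>2" using X0 unfolding e2 by linarith
    define H where "H = 2 * (1 + 4 * q_max V q * s) * pi_max V \<pi>"
    have "4 * q_max V q * s \<le> 4 * q_max V q * (3 * ln (1 / x) * ?t)"
      using sle q_max_nonneg by (intro mult_left_mono) auto
    then have "1 + 4 * q_max V q * s \<le> 12 * ln (1 / x) * (1 + q_max V q * ?t)"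
      using lx by (simp add: algebra_simps)
    then have "H \<le> 2 * (12 * ln (1 / x) * (1 + q_max V q * ?t)) * pi_max V \<pi>"
      unfolding H_def using pi_max_pos by (intro mult_right_mono mult_left_mono) auto
    also have "\<dots> = 24 * X" by (simp add: X_def xa alpha_def)
    finally have "H \<le> 6 * e\<^sup>2" using X0 unfolding e2 by linarith
    then show ?thesis
      using m s(1) sm unfolding s_def H_def
      by (intro core[where H="2 * (1 + 4 * q_max V q * t_mix V q \<pi> (e\<^sup>2)) * pi_max V \<pi>"] avg_pair_hit_le_pi_max) auto
  qed
qed

end

theorem lemma4p2:
  shows "\<exists>c\<^sub>0 c\<^sub>1 C \<xi> :: real. 0 < c\<^sub>0 \<and> 0 < c\<^sub>1 \<and> 0 < C \<and> 0 < \<xi> \<and> C * \<xi> < 1 \<and>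
    (\<forall>(V :: nat set) q \<pi> P (k :: nat).
      finite V \<longrightarrow> 2 \<le> card V \<longrightarrow> rates V q \<longrightarrow> mixing V q \<pi> \<longrightarrow> markov_chain V q P \<longrightarrow>
      err_in_range V q \<pi> P \<longrightarrow>
      2 \<le> k \<longrightarrow>
      err c\<^sub>0 c\<^sub>1 V q \<pi> P \<le> 1 / (10 * real (k choose 2)) \<longrightarrow>
      (real k)\<^sup>2 * err c\<^sub>0 c\<^sub>1 V q \<pi> P \<le> \<xi> \<longrightarrow>
      (\<forall>\<Lambda>. initial_law V k \<Lambda> \<longrightarrow>
        (let e = err c\<^sub>0 c\<^sub>1 V q \<pi> P;
             L = indep_chains k P \<Lambda>;
             r = measure L {\<omega> \<in> space L. meeting_time k \<omega> \<le> ennreal (t_mix V q \<pi> (e\<^sup>2))}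
         in approx_exp (distr L borel (meeting_time k))
              (mean_meeting V \<pi> P / real (k choose 2))
              (C * (real k)\<^sup>2 * e + 2 * r)
              (C * (real k)\<^sup>2 * e))))"
proof (rule exI[of _ 10], rule exI[of _ 10], rule exI[of _ 20], rule exI[of _ "1 / 1000"], intro conjI allI impI)
  fix V :: "nat set" and q \<pi> P and k :: nat and \<Lambda>
  assume *: "finite V" "2 \<le> card V" "rates V q" "mixing V q \<pi>" "markov_chain V q P"
    and **: "err_in_range V q \<pi> P" "2 \<le> k" "(real k)\<^sup>2 * err 10 10 V q \<pi> P \<le> 1 / 1000" "initial_law V k \<Lambda>"
  interpret mixing_chain V q \<pi> P using * by unfold_locales
  show "let e = err 10 10 V q \<pi> P; L = indep_chains k P \<Lambda>;
      r = measure L {\<omega> \<in> space L. meeting_time k \<omega> \<le> ennreal (t_mix V q \<pi> (e\<^sup>2))}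
    in approx_exp (distr L borel (meeting_time k)) (mean_meeting V \<pi> P / real (k choose 2))
      (20 * (real k)\<^sup>2 * e + 2 * r) (20 * (real k)\<^sup>2 * e)"
    unfolding Let_def by (rule approx_exp_err[OF **])
qed auto

end
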